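(* Let $(\mathcal C,\otimes,\mathbf I,c)$ be a symmetric monoidal category, $H$ a bialgebra in $\mathcal C$, $(A,\lambda\colon H\otimes A\to A)$ a left $H$-module algebra, $(B,\rho\colon B\otimes H\to B)$ a right $H$-module algebra, and $(C,\ \delta_l\colon C\to H\otimes C,\ \delta_r\colon C\to C\otimes H)$ an $H$-bicomodule algebra in $\mathcal C$. Then: 1. The unital associative algebras $(V_1,V_2,V_3)=(B,C,A)$ form a braided system of unital associative algebras, with $$\xi_{1,2}=(\mathrm{Id}_C\otimes\rho)(c_{B,C}\otimes\mathrm{Id}_H)(\mathrm{Id}_B\otimes\delta_r),\qquad \xi_{1,3}=c_{B,A},$$ $$\xi_{2,3}=(\lambda\otimes\mathrm{Id}_C)(\mathrm{Id}_H\otimes c_{C,A})(\delta_l\otimes\mathrm{Id}_A).$$ 2. The formulas $$\mu=(\mu_A\otimes\mu_C\otimes\mu_B)\,\xi_{1,2}^{4}\,\xi_{2,3}^{2}\,\xi_{1,3}^{3},\qquad \nu=\nu_A\otimes\nu_C\otimes\nu_B$$ define a unital associative algebra structure on $A\otimes C\otimes B$, denoted by $A\otimes_\xi C\otimes_\xi B$. 3. The category of right modules over the pointed braided system $(B,C,A;\overline\xi)$ (with the algebra units as distinguished morphisms) is equivalent to the category of right modules over the algebra $A\otimes_\xi C\otimes_\xi B$: $$\mathbf{Mod}_{(B,C,A;\overline\xi)}\simeq\mathbf{Mod}_{A\otimes_\xi C\otimes_\xi B}.$$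
   Context: Monoidal categories are strict; juxtaposition is composition; $\xi_{i,j}^p$ means $\xi_{i,j}$ applied at tensor positions $p,p+1$. A bialgebra in $\mathcal C$ is an object with unital associative algebra structure $(\mu,\nu)$ and counital coassociative coalgebra structure $(\Delta,\varepsilon)$ with $\Delta\mu=(\mu\otimes\mu)(\mathrm{Id}\otimes c\otimes\mathrm{Id})(\Delta\otimes\Delta)$, $\Delta\nu=\nu\otimes\nu$, $\varepsilon\mu=\varepsilon\otimes\varepsilon$, $\varepsilon\nu=\mathrm{Id}_{\mathbf I}$. A left $H$-module algebra is a unital associative algebra $(A,\mu_A,\nu_A)$ with a left $H$-module structure $\lambda$ such that $\lambda(\mathrm{Id}_H\otimes\mu_A)=\mu_A(\lambda\otimes\lambda)(\mathrm{Id}_H\otimes c_{H,A}\otimes\mathrm{Id}_A)(\Delta\otimes\mathrm{Id}_{A\otimes A})$ and $\lambda(\mathrm{Id}_H\otimes\nu_A)=\nu_A\varepsilon$; right module algebras are defined symmetrically. An $H$-bicomodule algebra is a unital associative algebra $C$ with commuting left and right $H$-comodule structures $\delta_l,\delta_r$ such that $\mu_C,\nu_C$ are morphisms of left and of right comodules (equivalently, $\delta_l,\delta_r$ are algebra morphisms). A rank $r$ braided system is an ordered family $V_1,\dots,V_r$ with morphisms $\sigma_{i,j}\colon V_i\otimes V_j\to V_j\otimes V_i$, $i\le j$ (not necessarily invertible), satisfying $(\sigma_{j,k}\otimes \mathrm{Id})(\mathrm{Id}\otimes\sigma_{i,k})(\sigma_{i,j}\otimes\mathrm{Id})=(\mathrm{Id}\otimes\sigma_{i,j})(\sigma_{i,k}\otimes\mathrm{Id})(\mathrm{Id}\otimes\sigma_{j,k})$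 on $V_i\otimes V_j\otimes V_k$ for all $i\le j\le k$. It is pointed if endowed with morphisms $\nu_i\colon\mathbf I\to V_i$. A braided system of unital associative algebras consists of algebras $(V_i,\mu_i,\nu_i)$ and morphisms $\xi_{i,j}$, $i<j$, natural with respect to units ($\xi_{i,j}(\nu_i\otimes\mathrm{Id})=\mathrm{Id}\otimes\nu_i$, $\xi_{i,j}(\mathrm{Id}\otimes\nu_j)=\nu_j\otimes\mathrm{Id}$), which together with $\xi_{i,i}:=\nu_i\otimes\mu_i$ form a braided system. A right module over a pointed braided system is an object $M$ with $\rho_i\colon M\otimes V_i\to M$ such that $\rho_j(\rho_i\otimes\mathrm{Id}_{V_j})=\rho_i(\rho_j\otimes\mathrm{Id}_{V_i})(\mathrm{Id}_M\otimes\sigma_{i,j})$ for $i\le j$ and $\rho_i(\mathrm{Id}_M\otimes\nu_i)=\mathrm{Id}_M$; morphisms commute with all $\rho_i$. *)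

theory Defs
  imports "HOL-Library.FuncSet"
begin

record ('o, 'm) cat =
  Obj :: "'o set"
  Arr :: "'m set"
  src :: "'m \<Rightarrow> 'o"
  tgt :: "'m \<Rightarrow> 'o"
  idm :: "'o \<Rightarrow> 'm"  ("\<i>\<d>\<index>")
  cmp :: "'m \<Rightarrow> 'm \<Rightarrow> 'm"  (infixr "\<cdot>\<index>" 55)

definition hom_set :: "('o, 'm, 'x) cat_scheme \<Rightarrow> 'o \<Rightarrow> 'o \<Rightarrow> 'm set"  ("Hom\<index>")
  where "Hom\<^bsub>\<C>\<^esub> X Y = {f \<in> Arr \<C>. src \<C> f = X \<and> tgt \<C> f = Y}"

locale category =
  fixes \<C> :: "('o, 'm, 'x) cat_scheme" (structure)
  assumes src_Obj: "f \<in> Arr \<C> \<Longrightarrow> src \<C> f \<in> Obj \<C>"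
    and tgt_Obj: "f \<in> Arr \<C> \<Longrightarrow> tgt \<C> f \<in> Obj \<C>"
    and id_hom: "X \<in> Obj \<C> \<Longrightarrow> \<i>\<d> X \<in> Hom X X"
    and cmp_hom: "\<lbrakk>f \<in> Hom X Y; g \<in> Hom Y Z\<rbrakk> \<Longrightarrow> g \<cdot> f \<in> Hom X Z"
    and cmp_id: "f \<in> Hom X Y \<Longrightarrow> f \<cdot> \<i>\<d> X = f"
    and id_cmp: "f \<in> Hom X Y \<Longrightarrow> \<i>\<d> Y \<cdot> f = f"
    and cmp_assoc: "\<lbrakk>f \<in> Hom W X; g \<in> Hom X Y; h \<in> Hom Y Z\<rbrakk> \<Longrightarrow> (h \<cdot> g) \<cdot> f = h \<cdot> (g \<cdot> f)"

definition is_functor ::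
  "('o, 'm, 'x) cat_scheme \<Rightarrow> ('p, 'n, 'y) cat_scheme \<Rightarrow> ('o \<Rightarrow> 'p) \<Rightarrow> ('m \<Rightarrow> 'n) \<Rightarrow> bool"
  where "is_functor \<C> \<D> F\<^sub>o F\<^sub>m \<longleftrightarrow>
    F\<^sub>o ` Obj \<C> \<subseteq> Obj \<D> \<and>
    (\<forall>X Y. \<forall>f \<in> Hom\<^bsub>\<C>\<^esub> X Y. F\<^sub>m f \<in> Hom\<^bsub>\<D>\<^esub> (F\<^sub>o X) (F\<^sub>o Y)) \<and>
    (\<forall>X \<in> Obj \<C>. F\<^sub>m (\<i>\<d>\<^bsub>\<C>\<^esub> X) = \<i>\<d>\<^bsub>\<D>\<^esub> (F\<^sub>o X)) \<and>
    (\<forall>X Y Z. \<forall>f \<in> Hom\<^bsub>\<C>\<^esub> X Y. \<forall>g \<in> Hom\<^bsub>\<C>\<^esub> Y Z.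
       F\<^sub>m (g \<cdot>\<^bsub>\<C>\<^esub> f) = F\<^sub>m g \<cdot>\<^bsub>\<D>\<^esub> F\<^sub>m f)"

definition is_iso :: "('o, 'm, 'x) cat_scheme \<Rightarrow> 'o \<Rightarrow> 'o \<Rightarrow> 'm \<Rightarrow> bool"
  where "is_iso \<C> X Y f \<longleftrightarrow> f \<in> Hom\<^bsub>\<C>\<^esub> X Y \<and>
    (\<exists>g \<in> Hom\<^bsub>\<C>\<^esub> Y X. g \<cdot>\<^bsub>\<C>\<^esub> f = \<i>\<d>\<^bsub>\<C>\<^esub> X \<and> f \<cdot>\<^bsub>\<C>\<^esub> g = \<i>\<d>\<^bsub>\<C>\<^esub> Y)"

definition natural_iso ::
  "('o, 'm, 'x) cat_scheme \<Rightarrow> ('p, 'n, 'y) cat_scheme \<Rightarrow> ('o \<Rightarrow> 'p) \<Rightarrow> ('m \<Rightarrow> 'n) \<Rightarrow>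
   ('o \<Rightarrow> 'p) \<Rightarrow> ('m \<Rightarrow> 'n) \<Rightarrow> ('o \<Rightarrow> 'n) \<Rightarrow> bool"
  where "natural_iso \<C> \<D> F\<^sub>o F\<^sub>m G\<^sub>o G\<^sub>m \<eta> \<longleftrightarrow>
    (\<forall>X \<in> Obj \<C>. is_iso \<D> (F\<^sub>o X) (G\<^sub>o X) (\<eta> X)) \<and>
    (\<forall>X Y. \<forall>f \<in> Hom\<^bsub>\<C>\<^esub> X Y. \<eta> Y \<cdot>\<^bsub>\<D>\<^esub> F\<^sub>m f = G\<^sub>m f \<cdot>\<^bsub>\<D>\<^esub> \<eta> X)"

definition equivalent_categories ::
  "('o, 'm, 'x) cat_scheme \<Rightarrow> ('p, 'n, 'y) cat_scheme \<Rightarrow> bool"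
  where "equivalent_categories \<C> \<D> \<longleftrightarrow> category \<C> \<and> category \<D> \<and>
    (\<exists>F\<^sub>o F\<^sub>m G\<^sub>o G\<^sub>m \<eta> \<epsilon>.
      is_functor \<C> \<D> F\<^sub>o F\<^sub>m \<and> is_functor \<D> \<C> G\<^sub>o G\<^sub>m \<and>
      natural_iso \<C> \<C> (\<lambda>X. X) (\<lambda>f. f) (G\<^sub>o \<circ> F\<^sub>o) (G\<^sub>m \<circ> F\<^sub>m) \<eta> \<and>
      natural_iso \<D> \<D> (F\<^sub>o \<circ> G\<^sub>o) (F\<^sub>m \<circ> G\<^sub>m) (\<lambda>X. X) (\<lambda>f. f) \<epsilon>)"

record ('o, 'm) moncat = "('o, 'm) cat" +
  tenso :: "'o \<Rightarrow> 'o \<Rightarrow> 'o"  (infixr "\<otimes>\<^sub>o\<index>" 70)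
  tensm :: "'m \<Rightarrow> 'm \<Rightarrow> 'm"  (infixr "\<otimes>\<^sub>m\<index>" 70)
  unito :: "'o"  ("\<I>\<index>")

locale strict_monoidal_category = category \<C>
  for \<C> :: "('o, 'm, 'x) moncat_scheme" (structure) +
  assumes unit_Obj: "\<I> \<in> Obj \<C>"
    and tenso_Obj: "\<lbrakk>X \<in> Obj \<C>; Y \<in> Obj \<C>\<rbrakk> \<Longrightarrow> X \<otimes>\<^sub>o Y \<in> Obj \<C>"
    and tenso_assoc: "\<lbrakk>X \<in> Obj \<C>; Y \<in> Obj \<C>; Z \<in> Obj \<C>\<rbrakk> \<Longrightarrow>
      (X \<otimes>\<^sub>o Y) \<otimes>\<^sub>o Z = X \<otimes>\<^sub>o (Y \<otimes>\<^sub>o Z)"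
    and unit_tenso: "X \<in> Obj \<C> \<Longrightarrow> \<I> \<otimes>\<^sub>o X = X"
    and tenso_unit: "X \<in> Obj \<C> \<Longrightarrow> X \<otimes>\<^sub>o \<I> = X"
    and tensm_hom: "\<lbrakk>f \<in> Hom X Y; g \<in> Hom X' Y'\<rbrakk> \<Longrightarrow> f \<otimes>\<^sub>m g \<in> Hom (X \<otimes>\<^sub>o X') (Y \<otimes>\<^sub>o Y')"
    and tensm_id: "\<lbrakk>X \<in> Obj \<C>; Y \<in> Obj \<C>\<rbrakk> \<Longrightarrow> \<i>\<d> X \<otimes>\<^sub>m \<i>\<d> Y = \<i>\<d> (X \<otimes>\<^sub>o Y)"
    and interchange: "\<lbrakk>f \<in> Hom X Y; g \<in> Hom Y Z; f' \<in> Hom X' Y'; g' \<in> Hom Y' Z'\<rbrakk> \<Longrightarrow>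
      (g \<cdot> f) \<otimes>\<^sub>m (g' \<cdot> f') = (g \<otimes>\<^sub>m g') \<cdot> (f \<otimes>\<^sub>m f')"
    and tensm_assoc: "\<lbrakk>f \<in> Arr \<C>; g \<in> Arr \<C>; h \<in> Arr \<C>\<rbrakk> \<Longrightarrow>
      (f \<otimes>\<^sub>m g) \<otimes>\<^sub>m h = f \<otimes>\<^sub>m (g \<otimes>\<^sub>m h)"
    and unit_tensm: "f \<in> Arr \<C> \<Longrightarrow> \<i>\<d> \<I> \<otimes>\<^sub>m f = f"
    and tensm_unit: "f \<in> Arr \<C> \<Longrightarrow> f \<otimes>\<^sub>m \<i>\<d> \<I> = f"

record ('o, 'm) symcat = "('o, 'm) moncat" +
  braid :: "'o \<Rightarrow> 'o \<Rightarrow> 'm"  ("\<c>\<index>")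

locale strict_symmetric_monoidal_category = strict_monoidal_category \<C>
  for \<C> :: "('o, 'm, 'x) symcat_scheme" (structure) +
  assumes braid_hom: "\<lbrakk>X \<in> Obj \<C>; Y \<in> Obj \<C>\<rbrakk> \<Longrightarrow> \<c> X Y \<in> Hom (X \<otimes>\<^sub>o Y) (Y \<otimes>\<^sub>o X)"
    and braid_natural: "\<lbrakk>f \<in> Hom X X'; g \<in> Hom Y Y'\<rbrakk> \<Longrightarrow>
      \<c> X' Y' \<cdot> (f \<otimes>\<^sub>m g) = (g \<otimes>\<^sub>m f) \<cdot> \<c> X Y"
    and braid_tenso_left: "\<lbrakk>X \<in> Obj \<C>; Y \<in> Obj \<C>; Z \<in> Obj \<C>\<rbrakk> \<Longrightarrow>
      \<c> (X \<otimes>\<^sub>o Y) Z = (\<c> X Z \<otimes>\<^sub>m \<i>\<d> Y) \<cdot> (\<i>\<d> X \<otimes>\<^sub>m \<c> Y Z)"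
    and braid_tenso_right: "\<lbrakk>X \<in> Obj \<C>; Y \<in> Obj \<C>; Z \<in> Obj \<C>\<rbrakk> \<Longrightarrow>
      \<c> X (Y \<otimes>\<^sub>o Z) = (\<i>\<d> Y \<otimes>\<^sub>m \<c> X Z) \<cdot> (\<c> X Y \<otimes>\<^sub>m \<i>\<d> Z)"
    and braid_sym: "\<lbrakk>X \<in> Obj \<C>; Y \<in> Obj \<C>\<rbrakk> \<Longrightarrow> \<c> Y X \<cdot> \<c> X Y = \<i>\<d> (X \<otimes>\<^sub>o Y)"

definition tenso_list :: "('o, 'm, 'x) moncat_scheme \<Rightarrow> 'o list \<Rightarrow> 'o"
  where "tenso_list \<C> Xs = foldr (tenso \<C>) Xs (unito \<C>)"

text \<open>For \<open>f\<close> with source \<open>X\<^sub>p \<otimes> X\<^sub>p\<^sub>+\<^sub>1\<close> (positions start at 1), \<open>at_pos \<C> [X\<^sub>1, \<dots>, X\<^sub>n] p f\<close> is \<open>f\<^sup>p\<close>,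
  i.e. \<open>f\<close> applied at tensor positions \<open>p\<close>, \<open>p + 1\<close> of \<open>X\<^sub>1 \<otimes> \<dots> \<otimes> X\<^sub>n\<close>.\<close>
definition at_pos :: "('o, 'm, 'x) moncat_scheme \<Rightarrow> 'o list \<Rightarrow> nat \<Rightarrow> 'm \<Rightarrow> 'm"
  where "at_pos \<C> Xs p f =
    \<i>\<d>\<^bsub>\<C>\<^esub> (tenso_list \<C> (take (p - 1) Xs)) \<otimes>\<^sub>m\<^bsub>\<C>\<^esub> f \<otimes>\<^sub>m\<^bsub>\<C>\<^esub> \<i>\<d>\<^bsub>\<C>\<^esub> (tenso_list \<C> (drop (p + 1) Xs))"

locale unital_algebra = strict_monoidal_category \<C>
  for \<C> :: "('o, 'm, 'x) moncat_scheme" (structure) +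
  fixes A :: 'o and \<mu> \<nu> :: 'm
  assumes alg_Obj: "A \<in> Obj \<C>"
    and mult_hom: "\<mu> \<in> Hom (A \<otimes>\<^sub>o A) A"
    and unit_hom: "\<nu> \<in> Hom \<I> A"
    and mult_assoc: "\<mu> \<cdot> (\<mu> \<otimes>\<^sub>m \<i>\<d> A) = \<mu> \<cdot> (\<i>\<d> A \<otimes>\<^sub>m \<mu>)"
    and mult_unit_left: "\<mu> \<cdot> (\<nu> \<otimes>\<^sub>m \<i>\<d> A) = \<i>\<d> A"
    and mult_unit_right: "\<mu> \<cdot> (\<i>\<d> A \<otimes>\<^sub>m \<nu>) = \<i>\<d> A"

locale counital_coalgebra = strict_monoidal_category \<C>
  for \<C> :: "('o, 'm, 'x) moncat_scheme" (structure) +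
  fixes H :: 'o and \<Delta> \<epsilon> :: 'm
  assumes coalg_Obj: "H \<in> Obj \<C>"
    and comult_hom: "\<Delta> \<in> Hom H (H \<otimes>\<^sub>o H)"
    and counit_hom: "\<epsilon> \<in> Hom H \<I>"
    and comult_coassoc: "(\<Delta> \<otimes>\<^sub>m \<i>\<d> H) \<cdot> \<Delta> = (\<i>\<d> H \<otimes>\<^sub>m \<Delta>) \<cdot> \<Delta>"
    and counit_left: "(\<epsilon> \<otimes>\<^sub>m \<i>\<d> H) \<cdot> \<Delta> = \<i>\<d> H"
    and counit_right: "(\<i>\<d> H \<otimes>\<^sub>m \<epsilon>) \<cdot> \<Delta> = \<i>\<d> H"

locale bialgebra =
  strict_symmetric_monoidal_category \<C> + unital_algebra \<C> H \<mu> \<nu> + counital_coalgebra \<C> H \<Delta> \<epsilon>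
  for \<C> :: "('o, 'm, 'x) symcat_scheme" (structure) and H :: 'o and \<mu> \<nu> \<Delta> \<epsilon> :: 'm +
  assumes comult_mult: "\<Delta> \<cdot> \<mu> = (\<mu> \<otimes>\<^sub>m \<mu>) \<cdot> (\<i>\<d> H \<otimes>\<^sub>m \<c> H H \<otimes>\<^sub>m \<i>\<d> H) \<cdot> (\<Delta> \<otimes>\<^sub>m \<Delta>)"
    and comult_unit: "\<Delta> \<cdot> \<nu> = \<nu> \<otimes>\<^sub>m \<nu>"
    and counit_mult: "\<epsilon> \<cdot> \<mu> = \<epsilon> \<otimes>\<^sub>m \<epsilon>"
    and counit_unit: "\<epsilon> \<cdot> \<nu> = \<i>\<d> \<I>"

locale left_module = unital_algebra \<C> H \<mu> \<nu>
  for \<C> :: "('o, 'm, 'x) moncat_scheme" (structure) and H :: 'o and \<mu> \<nu> :: 'm +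
  fixes M :: 'o and lam :: 'm
  assumes lmod_Obj: "M \<in> Obj \<C>"
    and lact_hom: "lam \<in> Hom (H \<otimes>\<^sub>o M) M"
    and lact_assoc: "lam \<cdot> (\<mu> \<otimes>\<^sub>m \<i>\<d> M) = lam \<cdot> (\<i>\<d> H \<otimes>\<^sub>m lam)"
    and lact_unit: "lam \<cdot> (\<nu> \<otimes>\<^sub>m \<i>\<d> M) = \<i>\<d> M"

locale right_module = unital_algebra \<C> H \<mu> \<nu>
  for \<C> :: "('o, 'm, 'x) moncat_scheme" (structure) and H :: 'o and \<mu> \<nu> :: 'm +
  fixes M :: 'o and \<rho> :: 'm
  assumes rmod_Obj: "M \<in> Obj \<C>"
    and ract_hom: "\<rho> \<in> Hom (M \<otimes>\<^sub>o H) M"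
    and ract_assoc: "\<rho> \<cdot> (\<rho> \<otimes>\<^sub>m \<i>\<d> H) = \<rho> \<cdot> (\<i>\<d> M \<otimes>\<^sub>m \<mu>)"
    and ract_unit: "\<rho> \<cdot> (\<i>\<d> M \<otimes>\<^sub>m \<nu>) = \<i>\<d> M"

locale left_module_algebra =
  bialgebra \<C> H \<mu>\<^sub>H \<nu>\<^sub>H \<Delta> \<epsilon> + alg: unital_algebra \<C> A \<mu>\<^sub>A \<nu>\<^sub>A + left_module \<C> H \<mu>\<^sub>H \<nu>\<^sub>H A lam
  for \<C> :: "('o, 'm, 'x) symcat_scheme" (structure)
    and H :: 'o and \<mu>\<^sub>H \<nu>\<^sub>H \<Delta> \<epsilon> :: 'm and A :: 'o and \<mu>\<^sub>A \<nu>\<^sub>A lam :: 'm +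
  assumes lact_mult: "lam \<cdot> (\<i>\<d> H \<otimes>\<^sub>m \<mu>\<^sub>A) =
      \<mu>\<^sub>A \<cdot> (lam \<otimes>\<^sub>m lam) \<cdot> (\<i>\<d> H \<otimes>\<^sub>m \<c> H A \<otimes>\<^sub>m \<i>\<d> A) \<cdot> (\<Delta> \<otimes>\<^sub>m \<i>\<d> (A \<otimes>\<^sub>o A))"
    and lact_alg_unit: "lam \<cdot> (\<i>\<d> H \<otimes>\<^sub>m \<nu>\<^sub>A) = \<nu>\<^sub>A \<cdot> \<epsilon>"

locale right_module_algebra =
  bialgebra \<C> H \<mu>\<^sub>H \<nu>\<^sub>H \<Delta> \<epsilon> + alg: unital_algebra \<C> B \<mu>\<^sub>B \<nu>\<^sub>B + right_module \<C> H \<mu>\<^sub>H \<nu>\<^sub>H B \<rho>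
  for \<C> :: "('o, 'm, 'x) symcat_scheme" (structure)
    and H :: 'o and \<mu>\<^sub>H \<nu>\<^sub>H \<Delta> \<epsilon> :: 'm and B :: 'o and \<mu>\<^sub>B \<nu>\<^sub>B \<rho> :: 'm +
  assumes ract_mult: "\<rho> \<cdot> (\<mu>\<^sub>B \<otimes>\<^sub>m \<i>\<d> H) =
      \<mu>\<^sub>B \<cdot> (\<rho> \<otimes>\<^sub>m \<rho>) \<cdot> (\<i>\<d> B \<otimes>\<^sub>m \<c> B H \<otimes>\<^sub>m \<i>\<d> H) \<cdot> (\<i>\<d> (B \<otimes>\<^sub>o B) \<otimes>\<^sub>m \<Delta>)"
    and ract_alg_unit: "\<rho> \<cdot> (\<nu>\<^sub>B \<otimes>\<^sub>m \<i>\<d> H) = \<nu>\<^sub>B \<cdot> \<epsilon>"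

locale left_comodule = counital_coalgebra \<C> H \<Delta> \<epsilon>
  for \<C> :: "('o, 'm, 'x) moncat_scheme" (structure) and H :: 'o and \<Delta> \<epsilon> :: 'm +
  fixes M :: 'o and \<delta> :: 'm
  assumes lcomod_Obj: "M \<in> Obj \<C>"
    and lcoact_hom: "\<delta> \<in> Hom M (H \<otimes>\<^sub>o M)"
    and lcoact_coassoc: "(\<Delta> \<otimes>\<^sub>m \<i>\<d> M) \<cdot> \<delta> = (\<i>\<d> H \<otimes>\<^sub>m \<delta>) \<cdot> \<delta>"
    and lcoact_counit: "(\<epsilon> \<otimes>\<^sub>m \<i>\<d> M) \<cdot> \<delta> = \<i>\<d> M"

locale right_comodule = counital_coalgebra \<C> H \<Delta> \<epsilon>
  for \<C> :: "('o, 'm, 'x) moncat_scheme" (structure) and H :: 'o and \<Delta> \<epsilon> :: 'm +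
  fixes M :: 'o and \<delta> :: 'm
  assumes rcomod_Obj: "M \<in> Obj \<C>"
    and rcoact_hom: "\<delta> \<in> Hom M (M \<otimes>\<^sub>o H)"
    and rcoact_coassoc: "(\<i>\<d> M \<otimes>\<^sub>m \<Delta>) \<cdot> \<delta> = (\<delta> \<otimes>\<^sub>m \<i>\<d> H) \<cdot> \<delta>"
    and rcoact_counit: "(\<i>\<d> M \<otimes>\<^sub>m \<epsilon>) \<cdot> \<delta> = \<i>\<d> M"

definition left_comodule_hom ::
  "('o, 'm, 'x) moncat_scheme \<Rightarrow> 'o \<Rightarrow> 'o \<Rightarrow> 'm \<Rightarrow> 'o \<Rightarrow> 'm \<Rightarrow> 'm \<Rightarrow> bool"
  where "left_comodule_hom \<C> H M \<delta> N \<delta>' f \<longleftrightarrow>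
    f \<in> Hom\<^bsub>\<C>\<^esub> M N \<and> \<delta>' \<cdot>\<^bsub>\<C>\<^esub> f = (\<i>\<d>\<^bsub>\<C>\<^esub> H \<otimes>\<^sub>m\<^bsub>\<C>\<^esub> f) \<cdot>\<^bsub>\<C>\<^esub> \<delta>"

definition right_comodule_hom ::
  "('o, 'm, 'x) moncat_scheme \<Rightarrow> 'o \<Rightarrow> 'o \<Rightarrow> 'm \<Rightarrow> 'o \<Rightarrow> 'm \<Rightarrow> 'm \<Rightarrow> bool"
  where "right_comodule_hom \<C> H M \<delta> N \<delta>' f \<longleftrightarrow>
    f \<in> Hom\<^bsub>\<C>\<^esub> M N \<and> \<delta>' \<cdot>\<^bsub>\<C>\<^esub> f = (f \<otimes>\<^sub>m\<^bsub>\<C>\<^esub> \<i>\<d>\<^bsub>\<C>\<^esub> H) \<cdot>\<^bsub>\<C>\<^esub> \<delta>"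

text \<open>\<open>C \<otimes> C\<close> carries the codiagonal coactions (built from \<open>\<mu>\<^sub>H\<close>), and \<open>\<I>\<close> carries the coaction \<open>\<nu>\<^sub>H\<close>.\<close>
locale bicomodule_algebra =
  bialgebra \<C> H \<mu>\<^sub>H \<nu>\<^sub>H \<Delta> \<epsilon> + alg: unital_algebra \<C> C \<mu>\<^sub>C \<nu>\<^sub>C +
  left_comodule \<C> H \<Delta> \<epsilon> C \<delta>\<^sub>l + right_comodule \<C> H \<Delta> \<epsilon> C \<delta>\<^sub>r
  for \<C> :: "('o, 'm, 'x) symcat_scheme" (structure)
    and H :: 'o and \<mu>\<^sub>H \<nu>\<^sub>H \<Delta> \<epsilon> :: 'm and C :: 'o and \<mu>\<^sub>C \<nu>\<^sub>C \<delta>\<^sub>l \<delta>\<^sub>r :: 'm +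
  assumes coacts_commute: "(\<delta>\<^sub>l \<otimes>\<^sub>m \<i>\<d> H) \<cdot> \<delta>\<^sub>r = (\<i>\<d> H \<otimes>\<^sub>m \<delta>\<^sub>r) \<cdot> \<delta>\<^sub>l"
    and mult_left_comodule_hom: "left_comodule_hom \<C> H
      (C \<otimes>\<^sub>o C) ((\<mu>\<^sub>H \<otimes>\<^sub>m \<i>\<d> (C \<otimes>\<^sub>o C)) \<cdot> (\<i>\<d> H \<otimes>\<^sub>m \<c> C H \<otimes>\<^sub>m \<i>\<d> C) \<cdot> (\<delta>\<^sub>l \<otimes>\<^sub>m \<delta>\<^sub>l)) C \<delta>\<^sub>l \<mu>\<^sub>C"
    and unit_left_comodule_hom: "left_comodule_hom \<C> H \<I> \<nu>\<^sub>H C \<delta>\<^sub>l \<nu>\<^sub>C"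
    and mult_right_comodule_hom: "right_comodule_hom \<C> H
      (C \<otimes>\<^sub>o C) ((\<i>\<d> (C \<otimes>\<^sub>o C) \<otimes>\<^sub>m \<mu>\<^sub>H) \<cdot> (\<i>\<d> C \<otimes>\<^sub>m \<c> H C \<otimes>\<^sub>m \<i>\<d> H) \<cdot> (\<delta>\<^sub>r \<otimes>\<^sub>m \<delta>\<^sub>r)) C \<delta>\<^sub>r \<mu>\<^sub>C"
    and unit_right_comodule_hom: "right_comodule_hom \<C> H \<I> \<nu>\<^sub>H C \<delta>\<^sub>r \<nu>\<^sub>C"

text \<open>Families indexed by \<open>1, \<dots>, r\<close> are functions on \<^typ>\<open>nat\<close>; values at other indices (and of \<open>\<sigma> i j\<close> or \<open>\<xi> i j\<close>
  for \<open>i > j\<close>) are never used.\<close>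
locale braided_system = strict_monoidal_category \<C>
  for \<C> :: "('o, 'm, 'x) moncat_scheme" (structure) +
  fixes r :: nat and V :: "nat \<Rightarrow> 'o" and \<sigma> :: "nat \<Rightarrow> nat \<Rightarrow> 'm"
  assumes V_Obj: "\<lbrakk>1 \<le> i; i \<le> r\<rbrakk> \<Longrightarrow> V i \<in> Obj \<C>"
    and \<sigma>_hom: "\<lbrakk>1 \<le> i; i \<le> j; j \<le> r\<rbrakk> \<Longrightarrow> \<sigma> i j \<in> Hom (V i \<otimes>\<^sub>o V j) (V j \<otimes>\<^sub>o V i)"
    and yang_baxter: "\<lbrakk>1 \<le> i; i \<le> j; j \<le> k; k \<le> r\<rbrakk> \<Longrightarrow>
      (\<sigma> j k \<otimes>\<^sub>m \<i>\<d> (V i)) \<cdot> (\<i>\<d> (V j) \<otimes>\<^sub>m \<sigma> i k) \<cdot> (\<sigma> i j \<otimes>\<^sub>m \<i>\<d> (V k)) =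
      (\<i>\<d> (V k) \<otimes>\<^sub>m \<sigma> i j) \<cdot> (\<sigma> i k \<otimes>\<^sub>m \<i>\<d> (V j)) \<cdot> (\<i>\<d> (V i) \<otimes>\<^sub>m \<sigma> j k)"

locale pointed_braided_system = braided_system \<C> r V \<sigma>
  for \<C> :: "('o, 'm, 'x) moncat_scheme" (structure)
    and r :: nat and V :: "nat \<Rightarrow> 'o" and \<sigma> :: "nat \<Rightarrow> nat \<Rightarrow> 'm" +
  fixes \<nu> :: "nat \<Rightarrow> 'm"
  assumes \<nu>_hom: "\<lbrakk>1 \<le> i; i \<le> r\<rbrakk> \<Longrightarrow> \<nu> i \<in> Hom \<I> (V i)"

text \<open>The completion \<open>\<xi>\<close>-bar of \<open>(\<xi> i j)\<^sub>i\<^sub><\<^sub>j\<close> by \<open>\<xi> i i := \<nu> i \<otimes> \<mu> i\<close>.\<close>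
definition completed ::
  "('o, 'm, 'x) moncat_scheme \<Rightarrow> (nat \<Rightarrow> 'm) \<Rightarrow> (nat \<Rightarrow> 'm) \<Rightarrow> (nat \<Rightarrow> nat \<Rightarrow> 'm) \<Rightarrow> nat \<Rightarrow> nat \<Rightarrow> 'm"
  where "completed \<C> \<mu> \<nu> \<xi> i j = (if i = j then \<nu> i \<otimes>\<^sub>m\<^bsub>\<C>\<^esub> \<mu> i else \<xi> i j)"

locale braided_system_of_algebras = braided_system \<C> r V "completed \<C> \<mu> \<nu> \<xi>"
  for \<C> :: "('o, 'm, 'x) moncat_scheme" (structure)
    and r :: nat and V :: "nat \<Rightarrow> 'o" and \<mu> \<nu> :: "nat \<Rightarrow> 'm" and \<xi> :: "nat \<Rightarrow> nat \<Rightarrow> 'm" +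
  assumes V_algebra: "\<lbrakk>1 \<le> i; i \<le> r\<rbrakk> \<Longrightarrow> unital_algebra \<C> (V i) (\<mu> i) (\<nu> i)"
    and \<xi>_unit_left: "\<lbrakk>1 \<le> i; i < j; j \<le> r\<rbrakk> \<Longrightarrow> \<xi> i j \<cdot> (\<nu> i \<otimes>\<^sub>m \<i>\<d> (V j)) = \<i>\<d> (V j) \<otimes>\<^sub>m \<nu> i"
    and \<xi>_unit_right: "\<lbrakk>1 \<le> i; i < j; j \<le> r\<rbrakk> \<Longrightarrow> \<xi> i j \<cdot> (\<i>\<d> (V i) \<otimes>\<^sub>m \<nu> j) = \<nu> j \<otimes>\<^sub>m \<i>\<d> (V i)"

text \<open>The actions are taken undefined outside \<open>1, \<dots>, r\<close>, so that a module has a unique representation.\<close>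
locale system_module = pointed_braided_system \<C> r V \<sigma> \<nu>
  for \<C> :: "('o, 'm, 'x) moncat_scheme" (structure)
    and r :: nat and V :: "nat \<Rightarrow> 'o" and \<sigma> :: "nat \<Rightarrow> nat \<Rightarrow> 'm" and \<nu> :: "nat \<Rightarrow> 'm" +
  fixes M :: 'o and \<rho> :: "nat \<Rightarrow> 'm"
  assumes smod_Obj: "M \<in> Obj \<C>"
    and \<rho>_hom: "\<rho> \<in> (\<Pi>\<^sub>E i\<in>{1..r}. Hom (M \<otimes>\<^sub>o V i) M)"
    and \<rho>_\<sigma>: "\<lbrakk>1 \<le> i; i \<le> j; j \<le> r\<rbrakk> \<Longrightarrow>
      \<rho> j \<cdot> (\<rho> i \<otimes>\<^sub>m \<i>\<d> (V j)) = \<rho> i \<cdot> (\<rho> j \<otimes>\<^sub>m \<i>\<d> (V i)) \<cdot> (\<i>\<d> M \<otimes>\<^sub>m \<sigma> i j)"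
    and \<rho>_\<nu>: "\<lbrakk>1 \<le> i; i \<le> r\<rbrakk> \<Longrightarrow> \<rho> i \<cdot> (\<i>\<d> M \<otimes>\<^sub>m \<nu> i) = \<i>\<d> M"

text \<open>An arrow is a triple (source module, target module, underlying morphism).\<close>

definition Mod_algebra ::
  "('o, 'm, 'x) moncat_scheme \<Rightarrow> 'o \<Rightarrow> 'm \<Rightarrow> 'm \<Rightarrow> ('o \<times> 'm, ('o \<times> 'm) \<times> ('o \<times> 'm) \<times> 'm) cat"
  where "Mod_algebra \<C> A \<mu> \<nu> = \<lparr>
    Obj = {(M, \<rho>). right_module \<C> A \<mu> \<nu> M \<rho>},
    Arr = {((M, \<rho>), (N, \<rho>'), f).
      right_module \<C> A \<mu> \<nu> M \<rho> \<and> right_module \<C> A \<mu> \<nu> N \<rho>' \<and>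
      f \<in> Hom\<^bsub>\<C>\<^esub> M N \<and> f \<cdot>\<^bsub>\<C>\<^esub> \<rho> = \<rho>' \<cdot>\<^bsub>\<C>\<^esub> (f \<otimes>\<^sub>m\<^bsub>\<C>\<^esub> \<i>\<d>\<^bsub>\<C>\<^esub> A)},
    src = (\<lambda>(P, Q, f). P),
    tgt = (\<lambda>(P, Q, f). Q),
    idm = (\<lambda>P. (P, P, \<i>\<d>\<^bsub>\<C>\<^esub> (fst P))),
    cmp = (\<lambda>(P', Q', g) (P, Q, f). (P, Q', g \<cdot>\<^bsub>\<C>\<^esub> f)) \<rparr>"

definition Mod_system ::
  "('o, 'm, 'x) moncat_scheme \<Rightarrow> nat \<Rightarrow> (nat \<Rightarrow> 'o) \<Rightarrow> (nat \<Rightarrow> nat \<Rightarrow> 'm) \<Rightarrow> (nat \<Rightarrow> 'm) \<Rightarrow>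
   ('o \<times> (nat \<Rightarrow> 'm), ('o \<times> (nat \<Rightarrow> 'm)) \<times> ('o \<times> (nat \<Rightarrow> 'm)) \<times> 'm) cat"
  where "Mod_system \<C> r V \<sigma> \<nu> = \<lparr>
    Obj = {(M, \<rho>). system_module \<C> r V \<sigma> \<nu> M \<rho>},
    Arr = {((M, \<rho>), (N, \<rho>'), f).
      system_module \<C> r V \<sigma> \<nu> M \<rho> \<and> system_module \<C> r V \<sigma> \<nu> N \<rho>' \<and>
      f \<in> Hom\<^bsub>\<C>\<^esub> M N \<and>
      (\<forall>i\<in>{1..r}. f \<cdot>\<^bsub>\<C>\<^esub> \<rho> i = \<rho>' i \<cdot>\<^bsub>\<C>\<^esub> (f \<otimes>\<^sub>m\<^bsub>\<C>\<^esub> \<i>\<d>\<^bsub>\<C>\<^esub> (V i)))},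
    src = (\<lambda>(P, Q, f). P),
    tgt = (\<lambda>(P, Q, f). Q),
    idm = (\<lambda>P. (P, P, \<i>\<d>\<^bsub>\<C>\<^esub> (fst P))),
    cmp = (\<lambda>(P', Q', g) (P, Q, f). (P, Q', g \<cdot>\<^bsub>\<C>\<^esub> f)) \<rparr>"

end

theory Submission
  imports Defs
begin

text \<open>
  In Sweedler notation, \<open>\<xi>\<^sub>1\<^sub>2\<close> sends \<open>b \<otimes> c\<close> to \<open>c\<^sub>0 \<otimes> b\<cdot>c\<^sub>1\<close>, \<open>\<xi>\<^sub>2\<^sub>3\<close> sends \<open>c \<otimes> a\<close> to
  \<open>c\<^sub>-\<^sub>1\<cdot>a \<otimes> c\<^sub>0\<close>, and \<open>\<xi>\<^sub>1\<^sub>3\<close> is the symmetry. Everything rests on two facts about these swaps.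

  Each of them is a distributive law: it commutes with the multiplications and units of both
  algebras. For \<open>\<xi>\<^sub>1\<^sub>2\<close> and products in \<open>B\<close> this says
  \<open>c\<^sub>0 \<otimes> (b b')\<cdot>c\<^sub>1 = c\<^sub>0 \<otimes> (b\<cdot>c\<^sub>1)(b'\<cdot>c\<^sub>2)\<close>, which holds because \<open>B\<close> is a module algebra and the coaction
  is coassociative; for products in \<open>C\<close> it says
  \<open>(c c')\<^sub>0 \<otimes> b\<cdot>(c c')\<^sub>1 = c\<^sub>0 c'\<^sub>0 \<otimes> (b\<cdot>c\<^sub>1)\<cdot>c'\<^sub>1\<close>, which holds because the coaction is
  multiplicative and \<open>\<rho>\<close> is an action (\<open>coaction_swap_law\<close>). Reversing the tensor product turns left actions
  and coactions into right ones, so \<open>\<xi>\<^sub>2\<^sub>3\<close> is the same construction in the reversed category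
  (\<open>law_CA\<close>).

  The swaps also satisfy the Yang-Baxter equation on \<open>B \<otimes> C \<otimes> A\<close>: both sides send \<open>b \<otimes> c \<otimes> a\<close> to
  \<open>c\<^sub>-\<^sub>1\<cdot>a \<otimes> c\<^sub>0 \<otimes> b\<cdot>c\<^sub>1\<close>, where it is essential that the two coactions commute
  (\<open>yang_baxter_diagram\<close>). The Yang-Baxter equations with repeated indices follow from
  associativity and from the distributive laws.

  From here on only distributive laws matter. A distributive law \<open>\<xi> : X \<otimes> Y \<rightarrow> Y \<otimes> X\<close> makes \<open>Y \<otimes> X\<close> an
  algebra (\<open>twisted_algebra\<close>), and a module over it is the same as an object with a \<open>Y\<close>-action and an
  \<open>X\<close>-action that can be exchanged by means of \<open>\<xi>\<close>: the joint action is \<open>m\<cdot>(y \<otimes> x) = (m\<cdot>y)\<cdot>x\<close>, and the two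
  actions are recovered by restriction along \<open>X\<close> and \<open>Y\<close> (\<open>joint_action_module\<close>,
  \<open>module_components\<close>). The Yang-Baxter equation is what makes the composite
  \<open>B \<otimes> A \<otimes> C \<rightarrow> A \<otimes> B \<otimes> C \<rightarrow> A \<otimes> C \<otimes> B\<close> a distributive law between \<open>B\<close> and the twisted product \<open>A \<otimes> C\<close>
  (\<open>outer_law\<close>). Hence the two-algebra construction can be applied twice; it yields the algebra on
  \<open>A \<otimes> C \<otimes> B\<close> and a bijection between its modules and the modules over the braided system. The bijection
  leaves the underlying objects and morphisms alone, so that it is an isomorphism of categories.

  The identities between composite morphisms are proved as identities between string diagrams, which
  are lists of boxes placed on a row of wires. That two diagrams differ by sliding boxes past each other
  is checked by computing sorted forms, so that a proof only names the axioms it uses.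
\<close>

section \<open>Arrows of a strict monoidal category\<close>

context category
begin

lemma hom_iff: "f \<in> Hom X Y \<longleftrightarrow> f \<in> Arr \<C> \<and> src \<C> f = X \<and> tgt \<C> f = Y"
  by (simp add: hom_set_def)

lemma arr_simps [simp]:
  "f \<in> Arr \<C> \<Longrightarrow> src \<C> f \<in> Obj \<C>"
  "f \<in> Arr \<C> \<Longrightarrow> tgt \<C> f \<in> Obj \<C>"
  "X \<in> Obj \<C> \<Longrightarrow> \<i>\<d> X \<in> Arr \<C>"
  "X \<in> Obj \<C> \<Longrightarrow> src \<C> (\<i>\<d> X) = X"
  "X \<in> Obj \<C> \<Longrightarrow> tgt \<C> (\<i>\<d> X) = X"
  "\<lbrakk>f \<in> Arr \<C>; g \<in> Arr \<C>; tgt \<C> f = src \<C> g\<rbrakk> \<Longrightarrow> g \<cdot> f \<in> Arr \<C>"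
  "\<lbrakk>f \<in> Arr \<C>; g \<in> Arr \<C>; tgt \<C> f = src \<C> g\<rbrakk> \<Longrightarrow> src \<C> (g \<cdot> f) = src \<C> f"
  "\<lbrakk>f \<in> Arr \<C>; g \<in> Arr \<C>; tgt \<C> f = src \<C> g\<rbrakk> \<Longrightarrow> tgt \<C> (g \<cdot> f) = tgt \<C> g"
  using src_Obj tgt_Obj id_hom cmp_hom by (auto simp: hom_iff)

lemma cmp_simps [simp]:
  "\<lbrakk>f \<in> Arr \<C>; src \<C> f = X\<rbrakk> \<Longrightarrow> f \<cdot> \<i>\<d> X = f"
  "\<lbrakk>f \<in> Arr \<C>; tgt \<C> f = Y\<rbrakk> \<Longrightarrow> \<i>\<d> Y \<cdot> f = f"
  "\<lbrakk>f \<in> Arr \<C>; g \<in> Arr \<C>; h \<in> Arr \<C>; tgt \<C> f = src \<C> g; tgt \<C> g = src \<C> h\<rbrakk>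
    \<Longrightarrow> (h \<cdot> g) \<cdot> f = h \<cdot> (g \<cdot> f)"
  using cmp_id id_cmp cmp_assoc by (auto simp: hom_iff)

end

context strict_monoidal_category
begin

lemma tens_simps [simp]:
  "\<I> \<in> Obj \<C>"
  "\<lbrakk>X \<in> Obj \<C>; Y \<in> Obj \<C>\<rbrakk> \<Longrightarrow> X \<otimes>\<^sub>o Y \<in> Obj \<C>"
  "\<lbrakk>X \<in> Obj \<C>; Y \<in> Obj \<C>; Z \<in> Obj \<C>\<rbrakk> \<Longrightarrow> (X \<otimes>\<^sub>o Y) \<otimes>\<^sub>o Z = X \<otimes>\<^sub>o (Y \<otimes>\<^sub>o Z)"
  "X \<in> Obj \<C> \<Longrightarrow> \<I> \<otimes>\<^sub>o X = X"
  "X \<in> Obj \<C> \<Longrightarrow> X \<otimes>\<^sub>o \<I> = X"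
  "\<lbrakk>f \<in> Arr \<C>; g \<in> Arr \<C>\<rbrakk> \<Longrightarrow> f \<otimes>\<^sub>m g \<in> Arr \<C>"
  "\<lbrakk>f \<in> Arr \<C>; g \<in> Arr \<C>\<rbrakk> \<Longrightarrow> src \<C> (f \<otimes>\<^sub>m g) = src \<C> f \<otimes>\<^sub>o src \<C> g"
  "\<lbrakk>f \<in> Arr \<C>; g \<in> Arr \<C>\<rbrakk> \<Longrightarrow> tgt \<C> (f \<otimes>\<^sub>m g) = tgt \<C> f \<otimes>\<^sub>o tgt \<C> g"
  "\<lbrakk>X \<in> Obj \<C>; Y \<in> Obj \<C>\<rbrakk> \<Longrightarrow> \<i>\<d> X \<otimes>\<^sub>m \<i>\<d> Y = \<i>\<d> (X \<otimes>\<^sub>o Y)"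
  "\<lbrakk>f \<in> Arr \<C>; g \<in> Arr \<C>; h \<in> Arr \<C>\<rbrakk> \<Longrightarrow> (f \<otimes>\<^sub>m g) \<otimes>\<^sub>m h = f \<otimes>\<^sub>m (g \<otimes>\<^sub>m h)"
  "f \<in> Arr \<C> \<Longrightarrow> \<i>\<d> \<I> \<otimes>\<^sub>m f = f"
  "f \<in> Arr \<C> \<Longrightarrow> f \<otimes>\<^sub>m \<i>\<d> \<I> = f"
  using unit_Obj tenso_Obj tenso_assoc unit_tenso tenso_unit tensm_hom tensm_id tensm_assoc
    unit_tensm tensm_unit by (auto simp: hom_iff)

lemma id_id_tensm [simp]:
  "\<lbrakk>X \<in> Obj \<C>; Y \<in> Obj \<C>; f \<in> Arr \<C>\<rbrakk> \<Longrightarrow> \<i>\<d> X \<otimes>\<^sub>m \<i>\<d> Y \<otimes>\<^sub>m f = \<i>\<d> (X \<otimes>\<^sub>o Y) \<otimes>\<^sub>m f"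
  by (simp flip: tens_simps(9,10))

lemma interchange':
  "\<lbrakk>f \<in> Arr \<C>; g \<in> Arr \<C>; f' \<in> Arr \<C>; g' \<in> Arr \<C>; tgt \<C> f = src \<C> g; tgt \<C> f' = src \<C> g'\<rbrakk>
    \<Longrightarrow> (g \<cdot> f) \<otimes>\<^sub>m (g' \<cdot> f') = (g \<otimes>\<^sub>m g') \<cdot> (f \<otimes>\<^sub>m f')"
  using interchange by (auto simp: hom_iff)

lemma whisker_cmp:
  "\<lbrakk>X \<in> Obj \<C>; f \<in> Arr \<C>; g \<in> Arr \<C>; tgt \<C> f = src \<C> g\<rbrakk>
    \<Longrightarrow> \<i>\<d> X \<otimes>\<^sub>m (g \<cdot> f) = (\<i>\<d> X \<otimes>\<^sub>m g) \<cdot> (\<i>\<d> X \<otimes>\<^sub>m f)"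
  "\<lbrakk>X \<in> Obj \<C>; f \<in> Arr \<C>; g \<in> Arr \<C>; tgt \<C> f = src \<C> g\<rbrakk>
    \<Longrightarrow> (g \<cdot> f) \<otimes>\<^sub>m \<i>\<d> X = (g \<otimes>\<^sub>m \<i>\<d> X) \<cdot> (f \<otimes>\<^sub>m \<i>\<d> X)"
  using interchange'[of "\<i>\<d> X" "\<i>\<d> X"] interchange'[of _ _ "\<i>\<d> X" "\<i>\<d> X"] by simp_all

lemma tens_list [simp]:
  "tenso_list \<C> [] = \<I>"
  "X \<in> Obj \<C> \<Longrightarrow> tenso_list \<C> [X] = X"
  "tenso_list \<C> (X # Y # Xs) = X \<otimes>\<^sub>o tenso_list \<C> (Y # Xs)"
  by (simp_all add: tenso_list_def)

lemma tens_list_Obj [simp]: "set Xs \<subseteq> Obj \<C> \<Longrightarrow> tenso_list \<C> Xs \<in> Obj \<C>"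
  by (induction Xs) (simp_all add: tenso_list_def)

lemma tens_list_append:
  "\<lbrakk>set Xs \<subseteq> Obj \<C>; set Ys \<subseteq> Obj \<C>\<rbrakk>
    \<Longrightarrow> tenso_list \<C> (Xs @ Ys) = tenso_list \<C> Xs \<otimes>\<^sub>o tenso_list \<C> Ys"
proof (induction Xs)
  case Nil
  then show ?case using tens_list_Obj[of Ys] by simp
next
  case (Cons X Xs)
  then show ?case
    using tens_list_Obj[of Xs] tens_list_Obj[of Ys] by (simp add: tenso_list_def)
qed

lemma tensm_split:
  "\<lbrakk>f \<in> Arr \<C>; g \<in> Arr \<C>\<rbrakk> \<Longrightarrow> f \<otimes>\<^sub>m g = (\<i>\<d> (tgt \<C> f) \<otimes>\<^sub>m g) \<cdot> (f \<otimes>\<^sub>m \<i>\<d> (src \<C> g))"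
  using interchange'[of f "\<i>\<d> (tgt \<C> f)" "\<i>\<d> (src \<C> g)" g] by simp

lemma tensm_split':
  "\<lbrakk>f \<in> Arr \<C>; g \<in> Arr \<C>\<rbrakk> \<Longrightarrow> f \<otimes>\<^sub>m g = (f \<otimes>\<^sub>m \<i>\<d> (tgt \<C> g)) \<cdot> (\<i>\<d> (src \<C> f) \<otimes>\<^sub>m g)"
  using interchange'[of "\<i>\<d> (src \<C> f)" f g "\<i>\<d> (tgt \<C> g)"] by simp

end

section \<open>String diagrams as lists of boxes\<close>

text \<open>\<open>Box k f Xs Ys\<close> is the morphism \<open>f\<close> placed to the right of \<open>k\<close> wires; it consumes the wires
  \<open>Xs\<close> and produces the wires \<open>Ys\<close>. A diagram is a list of boxes, the first of which is applied first.
  Objects on wires are kept as lists because sublists of wires can be computed,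
  whereas a tensor product cannot be decomposed.\<close>
datatype ('o, 'm) box = Box nat 'm "'o list" "'o list"

fun outcome :: "'o list \<Rightarrow> ('o, 'm) box list \<Rightarrow> 'o list" where
  "outcome S [] = S"
| "outcome S (Box k f Xs Ys # bs) = outcome (take k S @ Ys @ drop (k + length Xs) S) bs"

fun shift :: "nat \<Rightarrow> ('o, 'm) box \<Rightarrow> ('o, 'm) box" where
  "shift n (Box k f Xs Ys) = Box (n + k) f Xs Ys"

text \<open>\<open>settle b bs\<close> moves the box \<open>b\<close>, which precedes \<open>bs\<close>, past the boxes that follow it as long as these
  lie entirely to its left. Repeating this for all boxes gives \<open>sorted_form\<close>, in which boxes further to the left come as early as
  possible. Two diagrams with equal sorted forms differ by planar isotopy only, that is, by uses of the
  interchange law.\<close>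
fun settle :: "('o, 'm) box \<Rightarrow> ('o, 'm) box list \<Rightarrow> ('o, 'm) box list" where
  "settle b [] = [b]"
| "settle (Box k f Xs Ys) (Box l g Zs Ws # bs) =
     (if l + length Zs \<le> k
      then Box l g Zs Ws # settle (Box (k - length Zs + length Ws) f Xs Ys) bs
      else Box k f Xs Ys # Box l g Zs Ws # bs)"

fun sorted_form :: "('o, 'm) box list \<Rightarrow> ('o, 'm) box list" where
  "sorted_form [] = []"
| "sorted_form (b # bs) = settle b (sorted_form bs)"

lemma outcome_append: "outcome S (a @ b) = outcome (outcome S a) b"
  by (induction S a rule: outcome.induct) auto

context strict_monoidal_category
begin

definition whisker :: "'o list \<Rightarrow> 'm \<Rightarrow> 'o list \<Rightarrow> 'm" where
  "whisker U f W = \<i>\<d> (tenso_list \<C> U) \<otimes>\<^sub>m f \<otimes>\<^sub>m \<i>\<d> (tenso_list \<C> W)"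

text \<open>The number of wires to the left may equal the length of the state, so that a box without inputs can
  be placed at the right end.\<close>
fun well_typed :: "'o list \<Rightarrow> ('o, 'm) box list \<Rightarrow> bool" where
  "well_typed S [] \<longleftrightarrow> set S \<subseteq> Obj \<C>"
| "well_typed S (Box k f Xs Ys # bs) \<longleftrightarrow> set S \<subseteq> Obj \<C> \<and> k \<le> length S \<and>
     take (length Xs) (drop k S) = Xs \<and> f \<in> Hom (tenso_list \<C> Xs) (tenso_list \<C> Ys) \<and>
     well_typed (take k S @ Ys @ drop (k + length Xs) S) bs"

fun value_of :: "'o list \<Rightarrow> ('o, 'm) box list \<Rightarrow> 'm" where
  "value_of S [] = \<i>\<d> (tenso_list \<C> S)"
| "value_of S (Box k f Xs Ys # bs) =
     value_of (take k S @ Ys @ drop (k + length Xs) S) bs \<cdot>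
     whisker (take k S) f (drop (k + length Xs) S)"

lemma well_typed_Obj: "well_typed S a \<Longrightarrow> set S \<subseteq> Obj \<C>"
  by (cases "(S, a)" rule: well_typed.cases) auto

lemma well_typed_append: "well_typed S (a @ b) \<longleftrightarrow> well_typed S a \<and> well_typed (outcome S a) b"
  using well_typed_Obj by (induction S a rule: outcome.induct) auto

lemma whisker_hom:
  assumes "f \<in> Hom (tenso_list \<C> Xs) (tenso_list \<C> Ys)"
    and "set U \<subseteq> Obj \<C>" "set W \<subseteq> Obj \<C>" "set Xs \<subseteq> Obj \<C>" "set Ys \<subseteq> Obj \<C>"
  shows "whisker U f W \<in> Hom (tenso_list \<C> (U @ Xs @ W)) (tenso_list \<C> (U @ Ys @ W))"
  using assms by (simp add: whisker_def hom_iff tens_list_append)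

lemma split_state:
  assumes "k \<le> length S" "take (length Xs) (drop k S) = Xs"
  obtains U W where "S = U @ Xs @ W" "k = length U"
proof
  show "S = take k S @ Xs @ drop (k + length Xs) S"
    using assms(2) by (metis add.commute append_take_drop_id drop_drop)
qed (use assms in auto)

lemma value_hom: "well_typed S a \<Longrightarrow> value_of S a \<in> Hom (tenso_list \<C> S) (tenso_list \<C> (outcome S a))"
proof (induction S a rule: outcome.induct)
  case (1 S)
  then show ?case by (simp add: hom_iff)
next
  case (2 S k f Xs Ys bs)
  from 2(2) obtain U W where S: "S = U @ Xs @ W" "k = length U"
    by (auto elim: split_state)
  have "set (take k S @ Ys @ drop (k + length Xs) S) \<subseteq> Obj \<C>"
    using 2(2) well_typed_Obj by fastforce
  then have "whisker U f W \<in> Hom (tenso_list \<C> S) (tenso_list \<C> (U @ Ys @ W))"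
    using whisker_hom[of f Xs Ys U W] 2(2) by (simp add: S)
  then show ?case
    using 2 by (simp add: S hom_iff)
qed

lemma value_append:
  "well_typed S (a @ b) \<Longrightarrow> value_of S (a @ b) = value_of (outcome S a) b \<cdot> value_of S a"
proof (induction S a rule: outcome.induct)
  case (1 S)
  then show ?case using value_hom[of S b] by (simp add: hom_iff)
next
  case (2 S k f Xs Ys bs)
  from 2(2) obtain U W where S: "S = U @ Xs @ W" "k = length U"
    by (auto elim: split_state)
  have "set (U @ Ys @ W) \<subseteq> Obj \<C>"
    using 2(2) well_typed_Obj[of "U @ Ys @ W" "bs @ b"] by (simp add: S)
  then have "whisker U f W \<in> Hom (tenso_list \<C> S) (tenso_list \<C> (U @ Ys @ W))"
    using whisker_hom[of f Xs Ys U W] 2(2) by (simp add: S)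
  moreover have "well_typed (U @ Ys @ W) bs" "well_typed (outcome (U @ Ys @ W) bs) b"
    using 2(2) by (auto simp: S well_typed_append)
  ultimately show ?case
    using 2 value_hom[of "U @ Ys @ W" bs] value_hom[of "outcome (U @ Ys @ W) bs" b]
    by (simp add: S hom_iff)
qed

lemma whisker_whisker:
  assumes "f \<in> Arr \<C>" "set U \<subseteq> Obj \<C>" "set W \<subseteq> Obj \<C>" "set U' \<subseteq> Obj \<C>" "set W' \<subseteq> Obj \<C>"
  shows "whisker U' (whisker U f W) W' = whisker (U' @ U) f (W @ W')"
  using assms by (simp add: whisker_def tens_list_append)

lemma value_shift:
  assumes "well_typed Zs a" "set U \<subseteq> Obj \<C>" "set W \<subseteq> Obj \<C>"
  shows "well_typed (U @ Zs @ W) (map (shift (length U)) a) \<and>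
    outcome (U @ Zs @ W) (map (shift (length U)) a) = U @ outcome Zs a @ W \<and>
    value_of (U @ Zs @ W) (map (shift (length U)) a) = whisker U (value_of Zs a) W"
  using assms(1)
proof (induction Zs a rule: outcome.induct)
  case (1 S)
  then show ?case using assms by (simp add: whisker_def tens_list_append)
next
  case (2 S k f Xs Ys bs)
  from 2(2) obtain P Q where S: "S = P @ Xs @ Q" "k = length P"
    by (auto elim: split_state)
  have wt: "well_typed (P @ Ys @ Q) bs" and f: "f \<in> Hom (tenso_list \<C> Xs) (tenso_list \<C> Ys)"
    using 2(2) by (auto simp: S)
  have obj: "set P \<subseteq> Obj \<C>" "set Ys \<subseteq> Obj \<C>" "set Q \<subseteq> Obj \<C>" "set Xs \<subseteq> Obj \<C>"
    using well_typed_Obj[OF wt] well_typed_Obj[OF 2(2)] by (auto simp: S(1))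
  have IH: "well_typed (U @ P @ Ys @ Q @ W) (map (shift (length U)) bs)"
    "outcome (U @ P @ Ys @ Q @ W) (map (shift (length U)) bs) = U @ outcome (P @ Ys @ Q) bs @ W"
    "value_of (U @ P @ Ys @ Q @ W) (map (shift (length U)) bs) = whisker U (value_of (P @ Ys @ Q) bs) W"
    using 2(1) wt by (simp_all add: S)
  have w: "whisker P f Q \<in> Hom (tenso_list \<C> S) (tenso_list \<C> (P @ Ys @ Q))"
    unfolding S(1) using f obj by (rule_tac whisker_hom)
  have "whisker U (value_of (P @ Ys @ Q) bs \<cdot> whisker P f Q) W =
      whisker U (value_of (P @ Ys @ Q) bs) W \<cdot> whisker (U @ P) f (Q @ W)"
    using w value_hom[OF wt] f obj assms(2,3)
    by (subst whisker_whisker[symmetric]) (simp_all add: whisker_def[of U] hom_iff whisker_cmp)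
  then show ?case
    using IH f obj assms(2,3) S by simp
qed

definition equal_on :: "'o list \<Rightarrow> ('o, 'm) box list \<Rightarrow> ('o, 'm) box list \<Rightarrow> bool" where
  "equal_on S a b \<longleftrightarrow> well_typed S a \<and> well_typed S b \<and> outcome S a = outcome S b \<and>
    value_of S a = value_of S b"

lemma equal_on_refl: "well_typed S a \<Longrightarrow> equal_on S a a"
  by (simp add: equal_on_def)

lemma equal_on_sym: "equal_on S a b \<Longrightarrow> equal_on S b a"
  by (simp add: equal_on_def)

lemma equal_on_trans [trans]: "equal_on S a b \<Longrightarrow> equal_on S b c \<Longrightarrow> equal_on S a c"
  by (simp add: equal_on_def)

lemma equal_on_append:
  assumes "equal_on S a a'" "equal_on (outcome S a) b b'"
  shows "equal_on S (a @ b) (a' @ b')"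
  using assms by (auto simp: equal_on_def well_typed_append outcome_append value_append)

lemma equal_on_shift:
  assumes "equal_on Zs a b" "set U \<subseteq> Obj \<C>" "set W \<subseteq> Obj \<C>"
  shows "equal_on (U @ Zs @ W) (map (shift (length U)) a) (map (shift (length U)) b)"
  using assms value_shift[of Zs a U W] value_shift[of Zs b U W] by (simp add: equal_on_def)

text \<open>The interchange law: a box that lies to the left of its predecessor may be applied first. Its
  predecessor then has to be moved by the difference between the numbers of wires produced and
  consumed.\<close>
lemma equal_on_slide:
  assumes "well_typed S [Box k f Xs Ys, Box l g Zs Ws]" "l + length Zs \<le> k"
  shows "equal_on S [Box k f Xs Ys, Box l g Zs Ws]
    [Box l g Zs Ws, Box (k - length Zs + length Ws) f Xs Ys]"
proof -
  from assms(1) obtain P W where S: "S = P @ Xs @ W" "k = length P"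
    by (auto elim: split_state)
  have "take (length Zs) (drop l P) = Zs"
    using assms by (simp add: S)
  then obtain U V where P: "P = U @ Zs @ V" "l = length U"
    using split_state[of l P Zs] assms(2) S(2) by auto
  have hom: "f \<in> Hom (tenso_list \<C> Xs) (tenso_list \<C> Ys)" "g \<in> Hom (tenso_list \<C> Zs) (tenso_list \<C> Ws)"
    and obj: "set U \<subseteq> Obj \<C>" "set V \<subseteq> Obj \<C>" "set W \<subseteq> Obj \<C>" "set Xs \<subseteq> Obj \<C>" "set Ys \<subseteq> Obj \<C>"
      "set Zs \<subseteq> Obj \<C>" "set Ws \<subseteq> Obj \<C>"
    using assms S P by auto
  have k: "k = length U + length Zs + length V"
    using S(2) P by simp
  let ?U = "tenso_list \<C> U" and ?V = "tenso_list \<C> V" and ?W = "tenso_list \<C> W"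
  let ?f = "\<i>\<d> ?V \<otimes>\<^sub>m f \<otimes>\<^sub>m \<i>\<d> ?W"
  have "\<i>\<d> ?U \<otimes>\<^sub>m ((g \<otimes>\<^sub>m \<i>\<d> (tgt \<C> ?f)) \<cdot> (\<i>\<d> (src \<C> g) \<otimes>\<^sub>m ?f)) =
      \<i>\<d> ?U \<otimes>\<^sub>m ((\<i>\<d> (tgt \<C> g) \<otimes>\<^sub>m ?f) \<cdot> (g \<otimes>\<^sub>m \<i>\<d> (src \<C> ?f)))"
    using hom obj by (subst (1 2) interchange'[symmetric]) (simp_all add: hom_iff)
  then have "(\<i>\<d> ?U \<otimes>\<^sub>m g \<otimes>\<^sub>m \<i>\<d> (?V \<otimes>\<^sub>o tgt \<C> f \<otimes>\<^sub>o ?W)) \<cdot> (\<i>\<d> (?U \<otimes>\<^sub>o src \<C> g \<otimes>\<^sub>o ?V) \<otimes>\<^sub>m f \<otimes>\<^sub>m \<i>\<d> ?W) =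
      (\<i>\<d> (?U \<otimes>\<^sub>o tgt \<C> g \<otimes>\<^sub>o ?V) \<otimes>\<^sub>m f \<otimes>\<^sub>m \<i>\<d> ?W) \<cdot> (\<i>\<d> ?U \<otimes>\<^sub>m g \<otimes>\<^sub>m \<i>\<d> (?V \<otimes>\<^sub>o src \<C> f \<otimes>\<^sub>o ?W))"
    using hom obj by (simp add: hom_iff whisker_cmp)
  then show ?thesis
    using hom obj P(2)
    by (simp add: equal_on_def S(1) P(1) k whisker_def tens_list_append hom_iff)
qed

lemma equal_on_settle: "well_typed S (b # bs) \<Longrightarrow> equal_on S (b # bs) (settle b bs)"
proof (induction b bs arbitrary: S rule: settle.induct)
  case (1 b)
  then show ?case by (simp add: equal_on_refl)
next
  case (2 k f Xs Ys l g Zs Ws bs)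
  show ?case
  proof (cases "l + length Zs \<le> k")
    case False
    then show ?thesis using equal_on_refl[OF 2(2)] by (simp only: settle.simps if_False)
  next
    case True
    let ?a = "[Box k f Xs Ys, Box l g Zs Ws]" and ?l = "Box l g Zs Ws"
    let ?k = "Box (k - length Zs + length Ws) f Xs Ys"
    have wt: "well_typed S ?a" "well_typed (outcome S ?a) bs"
      using 2(2) well_typed_append[of S ?a bs] unfolding append_Cons append_Nil by blast+
    have slide: "equal_on S ?a [?l, ?k]"
      using wt(1) True by (rule equal_on_slide)
    then have "well_typed S [?l, ?k]" "well_typed (outcome S [?l, ?k]) bs"
      using wt(2) unfolding equal_on_def by metis+
    then have wt': "well_typed S [?l]" "well_typed (outcome S [?l]) (?k # bs)"
      using well_typed_append[of S "[?l]" "?k # bs"] well_typed_append[of S "[?l, ?k]" bs]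
      unfolding append_Cons append_Nil by blast+
    have "equal_on S (?a @ bs) ([?l, ?k] @ bs)"
      by (rule equal_on_append[OF slide equal_on_refl[OF wt(2)]])
    also have "equal_on S ([?l] @ ?k # bs) ([?l] @ settle ?k bs)"
      by (rule equal_on_append[OF equal_on_refl[OF wt'(1)] 2(1)[OF True wt'(2)]])
    then have "equal_on S ([?l, ?k] @ bs) (?l # settle ?k bs)"
      by (simp only: append_Cons append_Nil)
    finally show ?thesis
      using True by (simp only: settle.simps if_True append_Cons append_Nil)
  qed
qed

lemma equal_on_sorted: "well_typed S a \<Longrightarrow> equal_on S a (sorted_form a)"
proof (induction a arbitrary: S)
  case Nil
  then show ?case by (simp add: equal_on_refl)
next
  case (Cons b bs)
  have wt: "well_typed S [b]" "well_typed (outcome S [b]) bs"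
    using Cons(2) well_typed_append[of S "[b]" bs] unfolding append_Cons append_Nil by blast+
  then have "equal_on S ([b] @ bs) ([b] @ sorted_form bs)"
    by (intro equal_on_append equal_on_refl Cons(1))
  then have *: "equal_on S (b # bs) (b # sorted_form bs)"
    by simp
  then have "equal_on S (b # sorted_form bs) (settle b (sorted_form bs))"
    by (intro equal_on_settle) (simp add: equal_on_def)
  with * have "equal_on S (b # bs) (settle b (sorted_form bs))"
    by (rule equal_on_trans)
  then show ?case
    by simp
qed

lemma equal_on_isotopy:
  assumes "sorted_form a = sorted_form b" "well_typed S a" "well_typed S b"
  shows "equal_on S a b"
  using equal_on_trans[OF equal_on_sorted[OF assms(2), unfolded assms(1)] equal_on_sym[OF equal_on_sorted[OF assms(3)]]] .

lemma equal_on_rewrite: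
  assumes "equal_on Zs a b"
    and "take (length Zs) (drop k (outcome S pre)) = Zs" "k \<le> length (outcome S pre)"
    and "well_typed S (pre @ map (shift k) a @ post)"
  shows "equal_on S (pre @ map (shift k) a @ post) (pre @ map (shift k) b @ post)"
proof -
  obtain U W where S: "outcome S pre = U @ Zs @ W" "k = length U"
    using split_state[OF assms(3,2)] by metis
  have wt: "well_typed S pre" "well_typed (outcome S pre) (map (shift k) a)"
    "well_typed (outcome (outcome S pre) (map (shift k) a)) post"
    using assms(4) by (auto simp: well_typed_append)
  have "set U \<subseteq> Obj \<C>" "set W \<subseteq> Obj \<C>"
    using well_typed_Obj[OF wt(2)] S by auto
  then have "equal_on (outcome S pre) (map (shift k) a) (map (shift k) b)"
    using equal_on_shift[OF assms(1)] S by auto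
  then show ?thesis
    using wt by (intro equal_on_append equal_on_refl) simp_all
qed

text \<open>The rule by which all diagrams below are transformed. A diagram \<open>c\<close> is brought by planar isotopy
  into a form that contains the left-hand side \<open>a\<close> of a known equation at position \<open>k\<close>; \<open>a\<close> is replaced by
  \<open>b\<close>, and the result is brought into the form \<open>d\<close>. The premises on sorted forms and on typing are settled by
  computation.\<close>
lemma equal_on_step:
  assumes "equal_on Zs a b"
    and "sorted_form c = sorted_form (pre @ map (shift k) a @ post)"
    and "sorted_form d = sorted_form (pre @ map (shift k) b @ post)"
    and "take (length Zs) (drop k (outcome S pre)) = Zs" "k \<le> length (outcome S pre)"
    and "well_typed S c" "well_typed S d" "well_typed S (pre @ map (shift k) a @ post)"
  shows "equal_on S c d"
proof -
  have rewrite: "equal_on S (pre @ map (shift k) a @ post) (pre @ map (shift k) b @ post)"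
    by (rule equal_on_rewrite[OF assms(1,4,5,8)])
  then have "well_typed S (pre @ map (shift k) b @ post)"
    by (simp only: equal_on_def)
  then have "equal_on S (pre @ map (shift k) b @ post) d"
    by (rule equal_on_isotopy[OF assms(3)[symmetric] _ assms(7)])
  with equal_on_isotopy[OF assms(2,6,8)] rewrite show ?thesis
    by (blast intro: equal_on_trans)
qed

end

section \<open>Modules over an algebra\<close>

context right_module
begin

text \<open>Acting successively through \<open>f\<close> and \<open>g\<close> is acting through their product; applied to the
  two inclusions into a twisted tensor product, this determines how the restricted actions interact.\<close>
lemma act_act:
  assumes f: "f \<in> Hom Z H" and g: "g \<in> Hom W H"
  shows "(\<rho> \<cdot> (\<i>\<d> M \<otimes>\<^sub>m g)) \<cdot> ((\<rho> \<cdot> (\<i>\<d> M \<otimes>\<^sub>m f)) \<otimes>\<^sub>m \<i>\<d> W) = \<rho> \<cdot> (\<i>\<d> M \<otimes>\<^sub>m (\<mu> \<cdot> (f \<otimes>\<^sub>m g)))"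
proof -
  have [simp]: "H \<in> Obj \<C>" "M \<in> Obj \<C>" "Z \<in> Obj \<C>" "W \<in> Obj \<C>"
    "f \<in> Arr \<C>" "src \<C> f = Z" "tgt \<C> f = H" "g \<in> Arr \<C>" "src \<C> g = W" "tgt \<C> g = H"
    "\<rho> \<in> Arr \<C>" "src \<C> \<rho> = M \<otimes>\<^sub>o H" "tgt \<C> \<rho> = M"
    "\<mu> \<in> Arr \<C>" "src \<C> \<mu> = H \<otimes>\<^sub>o H" "tgt \<C> \<mu> = H"
    using alg_Obj rmod_Obj mult_hom ract_hom f g src_Obj by (auto simp: hom_iff)
  have "(\<rho> \<cdot> (\<i>\<d> M \<otimes>\<^sub>m g)) \<cdot> ((\<rho> \<cdot> (\<i>\<d> M \<otimes>\<^sub>m f)) \<otimes>\<^sub>m \<i>\<d> W) =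
      \<rho> \<cdot> ((\<i>\<d> M \<otimes>\<^sub>m g) \<cdot> (\<rho> \<otimes>\<^sub>m \<i>\<d> W)) \<cdot> (\<i>\<d> M \<otimes>\<^sub>m f \<otimes>\<^sub>m \<i>\<d> W)"
    by (simp add: whisker_cmp)
  also have "(\<i>\<d> M \<otimes>\<^sub>m g) \<cdot> (\<rho> \<otimes>\<^sub>m \<i>\<d> W) = (\<rho> \<otimes>\<^sub>m \<i>\<d> H) \<cdot> (\<i>\<d> (M \<otimes>\<^sub>o H) \<otimes>\<^sub>m g)"
    using tensm_split[of \<rho> g] tensm_split'[of \<rho> g] by simp
  also have "\<rho> \<cdot> ((\<rho> \<otimes>\<^sub>m \<i>\<d> H) \<cdot> (\<i>\<d> (M \<otimes>\<^sub>o H) \<otimes>\<^sub>m g)) \<cdot> (\<i>\<d> M \<otimes>\<^sub>m f \<otimes>\<^sub>m \<i>\<d> W) =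
      (\<rho> \<cdot> (\<rho> \<otimes>\<^sub>m \<i>\<d> H)) \<cdot> (\<i>\<d> (M \<otimes>\<^sub>o H) \<otimes>\<^sub>m g) \<cdot> (\<i>\<d> M \<otimes>\<^sub>m f \<otimes>\<^sub>m \<i>\<d> W)"
    by simp
  also have "\<dots> = \<rho> \<cdot> (\<i>\<d> M \<otimes>\<^sub>m (\<mu> \<cdot> (f \<otimes>\<^sub>m g)))"
    unfolding ract_assoc by (simp add: tensm_split[of f g] whisker_cmp)
  finally show ?thesis .
qed

lemma restrict_module:
  assumes "unital_algebra \<C> B \<mu>\<^sub>B \<nu>\<^sub>B" and f: "f \<in> Hom B H"
    and "\<mu> \<cdot> (f \<otimes>\<^sub>m f) = f \<cdot> \<mu>\<^sub>B" "f \<cdot> \<nu>\<^sub>B = \<nu>"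
  shows "right_module \<C> B \<mu>\<^sub>B \<nu>\<^sub>B M (\<rho> \<cdot> (\<i>\<d> M \<otimes>\<^sub>m f))"
proof -
  interpret B: unital_algebra \<C> B \<mu>\<^sub>B \<nu>\<^sub>B by fact
  have [simp]: "H \<in> Obj \<C>" "M \<in> Obj \<C>" "B \<in> Obj \<C>"
    "f \<in> Arr \<C>" "src \<C> f = B" "tgt \<C> f = H"
    "\<rho> \<in> Arr \<C>" "src \<C> \<rho> = M \<otimes>\<^sub>o H" "tgt \<C> \<rho> = M"
    "\<mu>\<^sub>B \<in> Arr \<C>" "src \<C> \<mu>\<^sub>B = B \<otimes>\<^sub>o B" "tgt \<C> \<mu>\<^sub>B = B"
    "\<nu>\<^sub>B \<in> Arr \<C>" "src \<C> \<nu>\<^sub>B = \<I>" "tgt \<C> \<nu>\<^sub>B = B"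
    using alg_Obj rmod_Obj B.alg_Obj B.mult_hom B.unit_hom ract_hom f by (auto simp: hom_iff)
  have unit: "(\<i>\<d> M \<otimes>\<^sub>m f) \<cdot> (\<i>\<d> M \<otimes>\<^sub>m \<nu>\<^sub>B) = \<i>\<d> M \<otimes>\<^sub>m \<nu>"
    by (simp add: assms(4)[symmetric] whisker_cmp)
  show ?thesis
    by unfold_locales (use act_act[OF f f] assms(3) unit ract_unit in \<open>simp_all add: hom_iff whisker_cmp\<close>)
qed

end

section \<open>Distributive laws and twisted tensor products\<close>

text \<open>The two multiplicativity conditions are the hexagons that make \<open>\<xi>\<close> compatible with products;
  together with the unit conditions they say that \<open>\<xi>\<close> is a distributive law between the monads given by tensoring
  with \<open>X\<close> and with \<open>Y\<close>.\<close>
locale distributive_law = strict_monoidal_category \<C> +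
  X: unital_algebra \<C> X \<mu>\<^sub>X \<nu>\<^sub>X + Y: unital_algebra \<C> Y \<mu>\<^sub>Y \<nu>\<^sub>Y
  for \<C> :: "('o, 'm, 'x) moncat_scheme" (structure)
    and X :: 'o and \<mu>\<^sub>X \<nu>\<^sub>X :: 'm and Y :: 'o and \<mu>\<^sub>Y \<nu>\<^sub>Y :: 'm +
  fixes \<xi> :: 'm
  assumes swap_hom: "\<xi> \<in> Hom (X \<otimes>\<^sub>o Y) (Y \<otimes>\<^sub>o X)"
    and swap_mult_left: "\<xi> \<cdot> (\<mu>\<^sub>X \<otimes>\<^sub>m \<i>\<d> Y) = (\<i>\<d> Y \<otimes>\<^sub>m \<mu>\<^sub>X) \<cdot> (\<xi> \<otimes>\<^sub>m \<i>\<d> X) \<cdot> (\<i>\<d> X \<otimes>\<^sub>m \<xi>)"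
    and swap_mult_right: "\<xi> \<cdot> (\<i>\<d> X \<otimes>\<^sub>m \<mu>\<^sub>Y) = (\<mu>\<^sub>Y \<otimes>\<^sub>m \<i>\<d> X) \<cdot> (\<i>\<d> Y \<otimes>\<^sub>m \<xi>) \<cdot> (\<xi> \<otimes>\<^sub>m \<i>\<d> Y)"
    and swap_unit_left: "\<xi> \<cdot> (\<nu>\<^sub>X \<otimes>\<^sub>m \<i>\<d> Y) = \<i>\<d> Y \<otimes>\<^sub>m \<nu>\<^sub>X"
    and swap_unit_right: "\<xi> \<cdot> (\<i>\<d> X \<otimes>\<^sub>m \<nu>\<^sub>Y) = \<nu>\<^sub>Y \<otimes>\<^sub>m \<i>\<d> X"
begin

abbreviation "twist k \<equiv> Box k \<xi> [X, Y] [Y, X]"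
abbreviation "mult_X k \<equiv> Box k \<mu>\<^sub>X [X, X] [X]"
abbreviation "mult_Y k \<equiv> Box k \<mu>\<^sub>Y [Y, Y] [Y]"
abbreviation "unit_X k \<equiv> Box k \<nu>\<^sub>X [] [X]"
abbreviation "unit_Y k \<equiv> Box k \<nu>\<^sub>Y [] [Y]"

lemma generators [simp]:
  "X \<in> Obj \<C>" "Y \<in> Obj \<C>"
  "\<mu>\<^sub>X \<in> Arr \<C>" "src \<C> \<mu>\<^sub>X = X \<otimes>\<^sub>o X" "tgt \<C> \<mu>\<^sub>X = X"
  "\<mu>\<^sub>Y \<in> Arr \<C>" "src \<C> \<mu>\<^sub>Y = Y \<otimes>\<^sub>o Y" "tgt \<C> \<mu>\<^sub>Y = Y"
  "\<nu>\<^sub>X \<in> Arr \<C>" "src \<C> \<nu>\<^sub>X = \<I>" "tgt \<C> \<nu>\<^sub>X = X"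
  "\<nu>\<^sub>Y \<in> Arr \<C>" "src \<C> \<nu>\<^sub>Y = \<I>" "tgt \<C> \<nu>\<^sub>Y = Y"
  "\<xi> \<in> Arr \<C>" "src \<C> \<xi> = X \<otimes>\<^sub>o Y" "tgt \<C> \<xi> = Y \<otimes>\<^sub>o X"
  using X.alg_Obj Y.alg_Obj X.mult_hom X.unit_hom Y.mult_hom Y.unit_hom swap_hom
  by (simp_all add: hom_iff)

lemma diagrams:
  shows assoc_X: "equal_on [X, X, X] [mult_X 0, mult_X 0] [mult_X 1, mult_X 0]"
    and assoc_Y: "equal_on [Y, Y, Y] [mult_Y 0, mult_Y 0] [mult_Y 1, mult_Y 0]"
    and unit_left_X: "equal_on [X] [unit_X 0, mult_X 0] []"
    and unit_right_X: "equal_on [X] [unit_X 1, mult_X 0] []"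
    and unit_left_Y: "equal_on [Y] [unit_Y 0, mult_Y 0] []"
    and unit_right_Y: "equal_on [Y] [unit_Y 1, mult_Y 0] []"
    and twist_mult_X: "equal_on [X, X, Y] [mult_X 0, twist 0] [twist 1, twist 0, mult_X 1]"
    and twist_mult_Y: "equal_on [X, Y, Y] [mult_Y 1, twist 0] [twist 0, twist 1, mult_Y 0]"
    and twist_unit_X: "equal_on [Y] [unit_X 0, twist 0] [unit_X 1]"
    and twist_unit_Y: "equal_on [X] [unit_Y 1, twist 0] [unit_Y 0]"
  using X.mult_assoc Y.mult_assoc X.mult_unit_left X.mult_unit_right Y.mult_unit_left
    Y.mult_unit_right swap_mult_left swap_mult_right swap_unit_left swap_unit_right
  by (simp_all add: equal_on_def whisker_def hom_iff)

text \<open>The inner swap of each bracketing has to cross a product, on the left-hand side a product in \<open>X\<close> and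
  on the right-hand side one in \<open>Y\<close>. Once the swap is moved in front of it, all three swaps
  come first on both sides, and what remains is associativity of \<open>X\<close> and of \<open>Y\<close>.\<close>
lemma twisted_assoc:
  "equal_on [Y, X, Y, X, Y, X]
    [twist 1, mult_Y 0, mult_X 1, twist 1, mult_Y 0, mult_X 1]
    [twist 3, mult_Y 2, mult_X 3, twist 1, mult_Y 0, mult_X 1]"
proof -
  have "equal_on [Y, X, Y, X, Y, X]
    [twist 1, mult_Y 0, mult_X 1, twist 1, mult_Y 0, mult_X 1]
    [twist 1, mult_Y 0, twist 2, twist 1, mult_X 2, mult_Y 0, mult_X 1]"
    by (rule equal_on_step[OF twist_mult_X, where k = 1 and pre = "[twist 1, mult_Y 0]"
          and post = "[mult_Y 0, mult_X 1]"]) (simp_all add: hom_iff)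
  also have "equal_on [Y, X, Y, X, Y, X] \<dots>
    [twist 1, twist 3, twist 2, mult_Y 1, mult_Y 0, mult_X 1, mult_X 1]"
    by (rule equal_on_step[OF assoc_Y, where k = 0 and pre = "[twist 1, twist 3, twist 2]"
          and post = "[mult_X 1, mult_X 1]"]) (simp_all add: hom_iff)
  also have "equal_on [Y, X, Y, X, Y, X] \<dots>
    [twist 1, twist 3, twist 2, mult_Y 1, mult_Y 0, mult_X 2, mult_X 1]"
    by (rule equal_on_step[OF assoc_X, where k = 1 and post = "[]" and
          pre = "[twist 1, twist 3, twist 2, mult_Y 1, mult_Y 0]"]) (simp_all add: hom_iff)
  also have "equal_on [Y, X, Y, X, Y, X] \<dots>
    [twist 3, mult_X 4, mult_Y 2, twist 1, mult_Y 0, mult_X 1]"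
    by (rule equal_on_step[OF equal_on_sym[OF twist_mult_Y], where k = 1 and
          pre = "[twist 3, mult_X 4]" and post = "[mult_Y 0, mult_X 1]"])
      (simp_all add: hom_iff)
  also have "equal_on [Y, X, Y, X, Y, X] \<dots>
    [twist 3, mult_Y 2, mult_X 3, twist 1, mult_Y 0, mult_X 1]"
    by (rule equal_on_isotopy) (simp_all add: hom_iff)
  finally show ?thesis .
qed

definition "twisted_mult = (\<mu>\<^sub>Y \<otimes>\<^sub>m \<mu>\<^sub>X) \<cdot> (\<i>\<d> Y \<otimes>\<^sub>m \<xi> \<otimes>\<^sub>m \<i>\<d> X)"

definition "twisted_unit = \<nu>\<^sub>Y \<otimes>\<^sub>m \<nu>\<^sub>X"

lemma twisted_mult_layers:
  "twisted_mult = (\<i>\<d> Y \<otimes>\<^sub>m \<mu>\<^sub>X) \<cdot> (\<mu>\<^sub>Y \<otimes>\<^sub>m \<i>\<d> (X \<otimes>\<^sub>o X)) \<cdot> (\<i>\<d> Y \<otimes>\<^sub>m \<xi> \<otimes>\<^sub>m \<i>\<d> X)"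
  by (simp add: twisted_mult_def tensm_split[of \<mu>\<^sub>Y \<mu>\<^sub>X])

lemma twisted_unit_layers: "twisted_unit = (\<i>\<d> Y \<otimes>\<^sub>m \<nu>\<^sub>X) \<cdot> \<nu>\<^sub>Y"
  by (simp add: twisted_unit_def tensm_split[of \<nu>\<^sub>Y \<nu>\<^sub>X])

lemma twisted_unit_left:
  "equal_on [Y, X] [unit_Y 0, unit_X 1, twist 1, mult_Y 0, mult_X 1] []"
proof -
  have "equal_on [Y, X] [unit_Y 0, unit_X 1, twist 1, mult_Y 0, mult_X 1]
    [unit_Y 0, mult_Y 0, unit_X 1, mult_X 1]"
    by (rule equal_on_step[OF twist_unit_X, where k = 1 and pre = "[unit_Y 0]"
          and post = "[mult_Y 0, mult_X 1]"]) (simp_all add: hom_iff)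
  also have "equal_on [Y, X] \<dots> [unit_X 1, mult_X 1]"
    by (rule equal_on_step[OF unit_left_Y, where k = 0 and pre = "[]"
          and post = "[unit_X 1, mult_X 1]"]) (simp_all add: hom_iff)
  also have "equal_on [Y, X] \<dots> []"
    by (rule equal_on_step[OF unit_left_X, where k = 1 and pre = "[]"
          and post = "[]"]) (simp_all add: hom_iff)
  finally show ?thesis .
qed

lemma twisted_unit_right:
  "equal_on [Y, X] [unit_Y 2, unit_X 3, twist 1, mult_Y 0, mult_X 1] []"
proof -
  have "equal_on [Y, X] [unit_Y 2, unit_X 3, twist 1, mult_Y 0, mult_X 1]
    [unit_Y 1, mult_Y 0, unit_X 2, mult_X 1]"
    by (rule equal_on_step[OF twist_unit_Y, where k = 1 and pre = "[]"
          and post = "[unit_X 3, mult_Y 0, mult_X 1]"]) (simp_all add: hom_iff)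
  also have "equal_on [Y, X] \<dots> [unit_X 2, mult_X 1]"
    by (rule equal_on_step[OF unit_right_Y, where k = 0 and pre = "[]"
          and post = "[unit_X 2, mult_X 1]"]) (simp_all add: hom_iff)
  also have "equal_on [Y, X] \<dots> []"
    by (rule equal_on_step[OF unit_right_X, where k = 1 and pre = "[]"
          and post = "[]"]) (simp_all add: hom_iff)
  finally show ?thesis .
qed

lemma twisted_algebra: "unital_algebra \<C> (Y \<otimes>\<^sub>o X) twisted_mult twisted_unit"
proof
  show "twisted_mult \<cdot> (twisted_mult \<otimes>\<^sub>m \<i>\<d> (Y \<otimes>\<^sub>o X)) = twisted_mult \<cdot> (\<i>\<d> (Y \<otimes>\<^sub>o X) \<otimes>\<^sub>m twisted_mult)"
    using twisted_assoc
    by (simp add: twisted_mult_layers equal_on_def whisker_def whisker_cmp)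
  show "twisted_mult \<cdot> (twisted_unit \<otimes>\<^sub>m \<i>\<d> (Y \<otimes>\<^sub>o X)) = \<i>\<d> (Y \<otimes>\<^sub>o X)"
    using twisted_unit_left
    by (simp add: twisted_mult_layers twisted_unit_layers equal_on_def whisker_def whisker_cmp)
  show "twisted_mult \<cdot> (\<i>\<d> (Y \<otimes>\<^sub>o X) \<otimes>\<^sub>m twisted_unit) = \<i>\<d> (Y \<otimes>\<^sub>o X)"
    using twisted_unit_right
    by (simp add: twisted_mult_layers twisted_unit_layers equal_on_def whisker_def whisker_cmp)
qed (simp_all add: twisted_mult_def twisted_unit_def hom_iff)

end

section \<open>Modules over a twisted tensor product\<close>

context distributive_law
begin

lemma twisted_mult_arr [simp]:
  "twisted_mult \<in> Arr \<C>" "src \<C> twisted_mult = Y \<otimes>\<^sub>o X \<otimes>\<^sub>o Y \<otimes>\<^sub>o X" "tgt \<C> twisted_mult = Y \<otimes>\<^sub>o X"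
  "twisted_unit \<in> Arr \<C>" "src \<C> twisted_unit = \<I>" "tgt \<C> twisted_unit = Y \<otimes>\<^sub>o X"
  by (simp_all add: twisted_mult_def twisted_unit_def)

text \<open>\<open>X\<close> and \<open>Y\<close> embed into \<open>Y \<otimes> X\<close> as \<open>1 \<otimes> x\<close> and \<open>y \<otimes> 1\<close>. The products of these elements, computed
  below, determine the algebra: \<open>(y \<otimes> 1)(1 \<otimes> x) = y \<otimes> x\<close> and \<open>(1 \<otimes> x)(y \<otimes> 1) = \<xi>(x \<otimes> y)\<close>.\<close>
definition "incl_X = \<nu>\<^sub>Y \<otimes>\<^sub>m \<i>\<d> X"

definition "incl_Y = \<i>\<d> Y \<otimes>\<^sub>m \<nu>\<^sub>X"

lemma incl_arr [simp]:
  "incl_X \<in> Arr \<C>" "src \<C> incl_X = X" "tgt \<C> incl_X = Y \<otimes>\<^sub>o X"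
  "incl_Y \<in> Arr \<C>" "src \<C> incl_Y = Y" "tgt \<C> incl_Y = Y \<otimes>\<^sub>o X"
  by (simp_all add: incl_X_def incl_Y_def)

lemma incl_X_mult: "twisted_mult \<cdot> (incl_X \<otimes>\<^sub>m incl_X) = incl_X \<cdot> \<mu>\<^sub>X"
proof -
  have "equal_on [X, X] [unit_Y 0, unit_Y 2, twist 1, mult_Y 0, mult_X 1]
    [unit_Y 0, unit_Y 1, mult_Y 0, mult_X 1]"
    by (rule equal_on_step[OF twist_unit_Y, where k = 1 and pre = "[unit_Y 0]"
          and post = "[mult_Y 0, mult_X 1]"]) (simp_all add: hom_iff)
  also have "equal_on [X, X] \<dots> [mult_X 0, unit_Y 0]"
    by (rule equal_on_step[OF unit_right_Y, where k = 0 and pre = "[unit_Y 0]"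
          and post = "[mult_X 1]"]) (simp_all add: hom_iff)
  finally show ?thesis
    by (simp add: equal_on_def whisker_def twisted_mult_layers tensm_split[of incl_X incl_X])
      (simp add: incl_X_def)
qed

lemma incl_Y_mult: "twisted_mult \<cdot> (incl_Y \<otimes>\<^sub>m incl_Y) = incl_Y \<cdot> \<mu>\<^sub>Y"
proof -
  have "equal_on [Y, Y] [unit_X 1, unit_X 3, twist 1, mult_Y 0, mult_X 1]
    [unit_X 2, unit_X 3, mult_Y 0, mult_X 1]"
    by (rule equal_on_step[OF twist_unit_X, where k = 1 and pre = "[]"
          and post = "[unit_X 3, mult_Y 0, mult_X 1]"]) (simp_all add: hom_iff)
  also have "equal_on [Y, Y] \<dots> [mult_Y 0, unit_X 1]"
    by (rule equal_on_step[OF unit_right_X, where k = 1 and pre = "[mult_Y 0, unit_X 1]"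
          and post = "[]"]) (simp_all add: hom_iff)
  finally show ?thesis
    by (simp add: equal_on_def whisker_def twisted_mult_layers tensm_split[of incl_Y incl_Y])
      (simp add: incl_Y_def)
qed

lemma incl_YX_mult: "twisted_mult \<cdot> (incl_Y \<otimes>\<^sub>m incl_X) = \<i>\<d> (Y \<otimes>\<^sub>o X)"
proof -
  have "equal_on [Y, X] [unit_X 1, unit_Y 2, twist 1, mult_Y 0, mult_X 1]
    [unit_Y 1, unit_X 2, mult_Y 0, mult_X 1]"
    by (rule equal_on_step[OF twist_unit_X, where k = 1 and pre = "[unit_Y 1]"
          and post = "[mult_Y 0, mult_X 1]"]) (simp_all add: hom_iff)
  also have "equal_on [Y, X] \<dots> [unit_X 1, mult_X 1]"
    by (rule equal_on_step[OF unit_right_Y, where k = 0 and pre = "[]"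
          and post = "[unit_X 1, mult_X 1]"]) (simp_all add: hom_iff)
  also have "equal_on [Y, X] \<dots> []"
    by (rule equal_on_step[OF unit_left_X, where k = 1 and pre = "[]"
          and post = "[]"]) (simp_all add: hom_iff)
  finally show ?thesis
    by (simp add: equal_on_def whisker_def twisted_mult_layers tensm_split[of incl_Y incl_X])
      (simp add: incl_Y_def incl_X_def)
qed

lemma incl_XY_mult: "twisted_mult \<cdot> (incl_X \<otimes>\<^sub>m incl_Y) = \<xi>"
proof -
  have "equal_on [X, Y] [unit_Y 0, unit_X 3, twist 1, mult_Y 0, mult_X 1]
    [twist 0, unit_X 2, mult_X 1]"
    by (rule equal_on_step[OF unit_left_Y, where k = 0 and pre = "[twist 0]"
          and post = "[unit_X 2, mult_X 1]"]) (simp_all add: hom_iff)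
  also have "equal_on [X, Y] \<dots> [twist 0]"
    by (rule equal_on_step[OF unit_right_X, where k = 1 and pre = "[twist 0]"
          and post = "[]"]) (simp_all add: hom_iff)
  finally show ?thesis
    by (simp add: equal_on_def whisker_def twisted_mult_layers tensm_split[of incl_X incl_Y])
      (simp add: incl_Y_def incl_X_def)
qed

lemma incl_unit: "incl_X \<cdot> \<nu>\<^sub>X = twisted_unit" "incl_Y \<cdot> \<nu>\<^sub>Y = twisted_unit"
  using tensm_split[of \<nu>\<^sub>Y \<nu>\<^sub>X] tensm_split'[of \<nu>\<^sub>Y \<nu>\<^sub>X]
  by (simp_all add: incl_X_def incl_Y_def twisted_unit_def)

definition compatible :: "'o \<Rightarrow> 'm \<Rightarrow> 'm \<Rightarrow> bool" where
  "compatible M \<rho>\<^sub>X \<rho>\<^sub>Y \<longleftrightarrow> \<rho>\<^sub>Y \<cdot> (\<rho>\<^sub>X \<otimes>\<^sub>m \<i>\<d> Y) = \<rho>\<^sub>X \<cdot> (\<rho>\<^sub>Y \<otimes>\<^sub>m \<i>\<d> X) \<cdot> (\<i>\<d> M \<otimes>\<^sub>m \<xi>)"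

definition joint_action :: "'m \<Rightarrow> 'm \<Rightarrow> 'm" where
  "joint_action \<rho>\<^sub>X \<rho>\<^sub>Y = \<rho>\<^sub>X \<cdot> (\<rho>\<^sub>Y \<otimes>\<^sub>m \<i>\<d> X)"

text \<open>The action by \<open>g\<close> can be taken after the exchange instead of before it, since \<open>g\<close> intertwines \<open>\<xi>'\<close> with
  \<open>\<xi>\<close>. For \<open>g\<close> an inclusion into a twisted product this splits compatibility with the product into
  compatibilities with its factors.\<close>
lemma compatible_restrict:
  assumes "right_module \<C> X \<mu>\<^sub>X \<nu>\<^sub>X M \<rho>\<^sub>X" "right_module \<C> Y \<mu>\<^sub>Y \<nu>\<^sub>Y M \<rho>\<^sub>Y" "compatible M \<rho>\<^sub>X \<rho>\<^sub>Y"
    and g: "g \<in> Hom Z Y" and \<xi>': "\<xi>' \<in> Hom (X \<otimes>\<^sub>o Z) (Z \<otimes>\<^sub>o X)"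
    and square: "\<xi> \<cdot> (\<i>\<d> X \<otimes>\<^sub>m g) = (g \<otimes>\<^sub>m \<i>\<d> X) \<cdot> \<xi>'"
  shows "(\<rho>\<^sub>Y \<cdot> (\<i>\<d> M \<otimes>\<^sub>m g)) \<cdot> (\<rho>\<^sub>X \<otimes>\<^sub>m \<i>\<d> Z) =
    \<rho>\<^sub>X \<cdot> ((\<rho>\<^sub>Y \<cdot> (\<i>\<d> M \<otimes>\<^sub>m g)) \<otimes>\<^sub>m \<i>\<d> X) \<cdot> (\<i>\<d> M \<otimes>\<^sub>m \<xi>')"
proof -
  interpret MX: right_module \<C> X \<mu>\<^sub>X \<nu>\<^sub>X M \<rho>\<^sub>X by fact
  interpret MY: right_module \<C> Y \<mu>\<^sub>Y \<nu>\<^sub>Y M \<rho>\<^sub>Y by fact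
  have [simp]: "M \<in> Obj \<C>" "Z \<in> Obj \<C>" "g \<in> Arr \<C>" "src \<C> g = Z" "tgt \<C> g = Y"
    "\<xi>' \<in> Arr \<C>" "src \<C> \<xi>' = X \<otimes>\<^sub>o Z" "tgt \<C> \<xi>' = Z \<otimes>\<^sub>o X"
    "\<rho>\<^sub>X \<in> Arr \<C>" "src \<C> \<rho>\<^sub>X = M \<otimes>\<^sub>o X" "tgt \<C> \<rho>\<^sub>X = M"
    "\<rho>\<^sub>Y \<in> Arr \<C>" "src \<C> \<rho>\<^sub>Y = M \<otimes>\<^sub>o Y" "tgt \<C> \<rho>\<^sub>Y = M"
    using g \<xi>' MX.rmod_Obj MX.ract_hom MY.ract_hom src_Obj[of g] by (simp_all add: hom_iff)
  have "(\<rho>\<^sub>Y \<cdot> (\<i>\<d> M \<otimes>\<^sub>m g)) \<cdot> (\<rho>\<^sub>X \<otimes>\<^sub>m \<i>\<d> Z) = \<rho>\<^sub>Y \<cdot> ((\<i>\<d> M \<otimes>\<^sub>m g) \<cdot> (\<rho>\<^sub>X \<otimes>\<^sub>m \<i>\<d> Z))"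
    by simp
  also have "(\<i>\<d> M \<otimes>\<^sub>m g) \<cdot> (\<rho>\<^sub>X \<otimes>\<^sub>m \<i>\<d> Z) = (\<rho>\<^sub>X \<otimes>\<^sub>m \<i>\<d> Y) \<cdot> (\<i>\<d> (M \<otimes>\<^sub>o X) \<otimes>\<^sub>m g)"
    using tensm_split[of \<rho>\<^sub>X g] tensm_split'[of \<rho>\<^sub>X g] by simp
  also have "\<rho>\<^sub>Y \<cdot> ((\<rho>\<^sub>X \<otimes>\<^sub>m \<i>\<d> Y) \<cdot> (\<i>\<d> (M \<otimes>\<^sub>o X) \<otimes>\<^sub>m g)) =
      (\<rho>\<^sub>Y \<cdot> (\<rho>\<^sub>X \<otimes>\<^sub>m \<i>\<d> Y)) \<cdot> (\<i>\<d> (M \<otimes>\<^sub>o X) \<otimes>\<^sub>m g)"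
    by simp
  also have "\<dots> = \<rho>\<^sub>X \<cdot> (\<rho>\<^sub>Y \<otimes>\<^sub>m \<i>\<d> X) \<cdot> (\<i>\<d> M \<otimes>\<^sub>m (\<xi> \<cdot> (\<i>\<d> X \<otimes>\<^sub>m g)))"
    using assms(3) unfolding compatible_def by (simp add: whisker_cmp)
  also have "\<dots> = \<rho>\<^sub>X \<cdot> ((\<rho>\<^sub>Y \<cdot> (\<i>\<d> M \<otimes>\<^sub>m g)) \<otimes>\<^sub>m \<i>\<d> X) \<cdot> (\<i>\<d> M \<otimes>\<^sub>m \<xi>')"
    unfolding square by (simp add: whisker_cmp)
  finally show ?thesis .
qed

text \<open>Compatibility moves the inner \<open>X\<close>-action of \<open>(((m\<cdot>y)\<cdot>x)\<cdot>y')\<cdot>x'\<close> past the \<open>Y\<close>-action that follows it. Then the two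
  \<open>Y\<close>-actions are adjacent, and so are the two \<open>X\<close>-actions, and each pair is an action by a product.\<close>
lemma joint_action_module:
  assumes "right_module \<C> X \<mu>\<^sub>X \<nu>\<^sub>X M \<rho>\<^sub>X" "right_module \<C> Y \<mu>\<^sub>Y \<nu>\<^sub>Y M \<rho>\<^sub>Y" "compatible M \<rho>\<^sub>X \<rho>\<^sub>Y"
  shows "right_module \<C> (Y \<otimes>\<^sub>o X) twisted_mult twisted_unit M (joint_action \<rho>\<^sub>X \<rho>\<^sub>Y)"
    and "joint_action \<rho>\<^sub>X \<rho>\<^sub>Y \<cdot> (\<i>\<d> M \<otimes>\<^sub>m incl_X) = \<rho>\<^sub>X"
    and "joint_action \<rho>\<^sub>X \<rho>\<^sub>Y \<cdot> (\<i>\<d> M \<otimes>\<^sub>m incl_Y) = \<rho>\<^sub>Y"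
proof -
  interpret MX: right_module \<C> X \<mu>\<^sub>X \<nu>\<^sub>X M \<rho>\<^sub>X by fact
  interpret MY: right_module \<C> Y \<mu>\<^sub>Y \<nu>\<^sub>Y M \<rho>\<^sub>Y by fact
  have [simp]: "M \<in> Obj \<C>"
    "\<rho>\<^sub>X \<in> Arr \<C>" "src \<C> \<rho>\<^sub>X = M \<otimes>\<^sub>o X" "tgt \<C> \<rho>\<^sub>X = M"
    "\<rho>\<^sub>Y \<in> Arr \<C>" "src \<C> \<rho>\<^sub>Y = M \<otimes>\<^sub>o Y" "tgt \<C> \<rho>\<^sub>Y = M"
    using MX.rmod_Obj MX.ract_hom MY.ract_hom by (simp_all add: hom_iff)
  define act_X act_Y where acts [simp]: "act_X = Box 0 \<rho>\<^sub>X [M, X] [M]" "act_Y = Box 0 \<rho>\<^sub>Y [M, Y] [M]"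
  have module:
    "equal_on [M, X, X] [act_X, act_X] [mult_X 1, act_X]"
    "equal_on [M, Y, Y] [act_Y, act_Y] [mult_Y 1, act_Y]"
    "equal_on [M] [unit_X 1, act_X] []" "equal_on [M] [unit_Y 1, act_Y] []"
    "equal_on [M, X, Y] [act_X, act_Y] [twist 1, act_Y, act_X]"
    using MX.ract_assoc MY.ract_assoc MX.ract_unit MY.ract_unit assms(3)
    by (simp_all add: equal_on_def whisker_def compatible_def hom_iff)
  have "equal_on [M, Y, X, Y, X] [act_Y, act_X, act_Y, act_X] [act_Y, twist 1, act_Y, act_X, act_X]"
    by (rule equal_on_step[OF module(5), where k = 0 and pre = "[act_Y]" and post = "[act_X]"])
      (simp_all add: hom_iff)
  also have "equal_on [M, Y, X, Y, X] \<dots> [twist 2, mult_Y 1, act_Y, act_X, act_X]"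
    by (rule equal_on_step[OF module(2), where k = 0 and pre = "[twist 2]" and post = "[act_X, act_X]"])
      (simp_all add: hom_iff)
  also have "equal_on [M, Y, X, Y, X] \<dots> [twist 2, mult_Y 1, mult_X 2, act_Y, act_X]"
    by (rule equal_on_step[OF module(1), where k = 0 and pre = "[twist 2, mult_Y 1, act_Y]"
          and post = "[]"]) (simp_all add: hom_iff)
  finally have assoc: "equal_on [M, Y, X, Y, X] [act_Y, act_X, act_Y, act_X]
    [twist 2, mult_Y 1, mult_X 2, act_Y, act_X]" .
  have right: "equal_on [M, Y] [unit_X 2, act_Y, act_X] [act_Y]"
    by (rule equal_on_step[OF module(3), where k = 0 and pre = "[act_Y]" and post = "[]"])
      (simp_all add: hom_iff)
  have left: "equal_on [M, X] [unit_Y 1, act_Y, act_X] [act_X]"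
    by (rule equal_on_step[OF module(4), where k = 0 and pre = "[]" and post = "[act_X]"])
      (simp_all add: hom_iff)
  show "joint_action \<rho>\<^sub>X \<rho>\<^sub>Y \<cdot> (\<i>\<d> M \<otimes>\<^sub>m incl_X) = \<rho>\<^sub>X" "joint_action \<rho>\<^sub>X \<rho>\<^sub>Y \<cdot> (\<i>\<d> M \<otimes>\<^sub>m incl_Y) = \<rho>\<^sub>Y"
    using left right
    by (simp_all add: joint_action_def incl_X_def incl_Y_def equal_on_def whisker_def)
  have "equal_on [M] [unit_Y 1, unit_X 2, act_Y, act_X] [unit_Y 1, act_Y]"
    by (rule equal_on_step[OF right, where k = 0 and pre = "[unit_Y 1]" and post = "[]"])
      (simp_all add: hom_iff)
  also note module(4)
  finally have unit: "equal_on [M] [unit_Y 1, unit_X 2, act_Y, act_X] []" .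
  interpret T: unital_algebra \<C> "Y \<otimes>\<^sub>o X" twisted_mult twisted_unit
    by (rule twisted_algebra)
  show "right_module \<C> (Y \<otimes>\<^sub>o X) twisted_mult twisted_unit M (joint_action \<rho>\<^sub>X \<rho>\<^sub>Y)"
    by unfold_locales (use assoc unit in \<open>simp_all add: joint_action_def twisted_mult_layers
        twisted_unit_layers equal_on_def whisker_def whisker_cmp hom_iff\<close>)
qed

text \<open>The restricted actions are compatible because both sides of the compatibility condition are the
  action by \<open>(1 \<otimes> x)(y \<otimes> 1) = \<xi>(x \<otimes> y)\<close>.\<close>
lemma module_components:
  assumes "right_module \<C> (Y \<otimes>\<^sub>o X) twisted_mult twisted_unit M \<rho>"
  shows "right_module \<C> X \<mu>\<^sub>X \<nu>\<^sub>X M (\<rho> \<cdot> (\<i>\<d> M \<otimes>\<^sub>m incl_X))"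
    and "right_module \<C> Y \<mu>\<^sub>Y \<nu>\<^sub>Y M (\<rho> \<cdot> (\<i>\<d> M \<otimes>\<^sub>m incl_Y))"
    and "compatible M (\<rho> \<cdot> (\<i>\<d> M \<otimes>\<^sub>m incl_X)) (\<rho> \<cdot> (\<i>\<d> M \<otimes>\<^sub>m incl_Y))"
    and "joint_action (\<rho> \<cdot> (\<i>\<d> M \<otimes>\<^sub>m incl_X)) (\<rho> \<cdot> (\<i>\<d> M \<otimes>\<^sub>m incl_Y)) = \<rho>"
proof -
  interpret M: right_module \<C> "Y \<otimes>\<^sub>o X" twisted_mult twisted_unit M \<rho> by fact
  have [simp]: "M \<in> Obj \<C>" "\<rho> \<in> Arr \<C>" "src \<C> \<rho> = M \<otimes>\<^sub>o Y \<otimes>\<^sub>o X" "tgt \<C> \<rho> = M"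
    using M.rmod_Obj M.ract_hom by (simp_all add: hom_iff)
  have hom: "incl_X \<in> Hom X (Y \<otimes>\<^sub>o X)" "incl_Y \<in> Hom Y (Y \<otimes>\<^sub>o X)"
    by (simp_all add: hom_iff)
  show "right_module \<C> X \<mu>\<^sub>X \<nu>\<^sub>X M (\<rho> \<cdot> (\<i>\<d> M \<otimes>\<^sub>m incl_X))"
    by (rule M.restrict_module[OF X.unital_algebra_axioms hom(1) incl_X_mult incl_unit(1)])
  show "right_module \<C> Y \<mu>\<^sub>Y \<nu>\<^sub>Y M (\<rho> \<cdot> (\<i>\<d> M \<otimes>\<^sub>m incl_Y))"
    by (rule M.restrict_module[OF Y.unital_algebra_axioms hom(2) incl_Y_mult incl_unit(2)])
  show joint: "joint_action (\<rho> \<cdot> (\<i>\<d> M \<otimes>\<^sub>m incl_X)) (\<rho> \<cdot> (\<i>\<d> M \<otimes>\<^sub>m incl_Y)) = \<rho>"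
    unfolding joint_action_def M.act_act[OF hom(2,1)] incl_YX_mult by simp
  have "\<rho> \<cdot> (\<i>\<d> M \<otimes>\<^sub>m \<xi>) =
      joint_action (\<rho> \<cdot> (\<i>\<d> M \<otimes>\<^sub>m incl_X)) (\<rho> \<cdot> (\<i>\<d> M \<otimes>\<^sub>m incl_Y)) \<cdot> (\<i>\<d> M \<otimes>\<^sub>m \<xi>)"
    by (simp only: joint)
  then show "compatible M (\<rho> \<cdot> (\<i>\<d> M \<otimes>\<^sub>m incl_X)) (\<rho> \<cdot> (\<i>\<d> M \<otimes>\<^sub>m incl_Y))"
    unfolding compatible_def M.act_act[OF hom] incl_XY_mult by (simp add: joint_action_def)
qed

end

section \<open>The swap of a module algebra with a comodule algebra\<close>

context strict_symmetric_monoidal_category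
begin

lemma braid_arr [simp]:
  "\<lbrakk>X \<in> Obj \<C>; Y \<in> Obj \<C>\<rbrakk> \<Longrightarrow> \<c> X Y \<in> Arr \<C>"
  "\<lbrakk>X \<in> Obj \<C>; Y \<in> Obj \<C>\<rbrakk> \<Longrightarrow> src \<C> (\<c> X Y) = X \<otimes>\<^sub>o Y"
  "\<lbrakk>X \<in> Obj \<C>; Y \<in> Obj \<C>\<rbrakk> \<Longrightarrow> tgt \<C> (\<c> X Y) = Y \<otimes>\<^sub>o X"
  using braid_hom by (auto simp: hom_iff)

text \<open>The hexagon equation for \<open>\<I> \<otimes> \<I>\<close> makes the symmetry with \<open>\<I>\<close> idempotent, and an invertible
  idempotent is an identity.\<close>
lemma braid_unit [simp]:
  assumes "X \<in> Obj \<C>"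
  shows "\<c> \<I> X = \<i>\<d> X" "\<c> X \<I> = \<i>\<d> X"
proof -
  have "\<c> \<I> X = (\<c> X \<I> \<cdot> \<c> \<I> X) \<cdot> \<c> \<I> X"
    using assms by (simp add: braid_sym)
  also have "\<dots> = \<c> X \<I> \<cdot> (\<c> \<I> X \<cdot> \<c> \<I> X)"
    using assms by (simp del: cmp_simps(1,2))
  also have "\<c> \<I> X \<cdot> \<c> \<I> X = \<c> \<I> X"
    using braid_tenso_left[of \<I> \<I> X] assms by simp
  also have "\<c> X \<I> \<cdot> \<c> \<I> X = \<i>\<d> X"
    using assms by (simp add: braid_sym)
  finally show left: "\<c> \<I> X = \<i>\<d> X" .
  show "\<c> X \<I> = \<i>\<d> X"
    using braid_sym[of \<I> X] assms by (simp add: left)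
qed

abbreviation cross :: "'o \<Rightarrow> 'o \<Rightarrow> nat \<Rightarrow> ('o, 'm) box" where
  "cross X Y k \<equiv> Box k (\<c> X Y) [X, Y] [Y, X]"

text \<open>This is naturality of the symmetry with respect to the symmetry itself.\<close>
lemma cross_cross_cross:
  assumes "X \<in> Obj \<C>" "Y \<in> Obj \<C>" "Z \<in> Obj \<C>"
  shows "equal_on [X, Y, Z] [cross X Y 0, cross X Z 1, cross Y Z 0] [cross Y Z 1, cross X Z 0, cross X Y 1]"
  using braid_natural[of "\<c> X Y" "X \<otimes>\<^sub>o Y" "Y \<otimes>\<^sub>o X" "\<i>\<d> Z" Z Z] assms
  by (simp add: equal_on_def whisker_def hom_iff braid_tenso_left)

end

text \<open>Only one coaction on \<open>C\<close> is required, so that the results apply to either coaction of a bicomodule algebra, to the left one in the reversed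
  category.\<close>
locale comodule_algebra_action =
  right_module_algebra \<C> H \<mu>\<^sub>H \<nu>\<^sub>H \<Delta> \<epsilon> B \<mu>\<^sub>B \<nu>\<^sub>B \<rho> +
  C: unital_algebra \<C> C \<mu>\<^sub>C \<nu>\<^sub>C + C: right_comodule \<C> H \<Delta> \<epsilon> C \<delta>
  for \<C> :: "('o, 'm, 'x) symcat_scheme" (structure)
    and H :: 'o and \<mu>\<^sub>H \<nu>\<^sub>H \<Delta> \<epsilon> :: 'm and B :: 'o and \<mu>\<^sub>B \<nu>\<^sub>B \<rho> :: 'm
    and C :: 'o and \<mu>\<^sub>C \<nu>\<^sub>C \<delta> :: 'm +
  assumes coact_mult: "\<delta> \<cdot> \<mu>\<^sub>C =
      (\<mu>\<^sub>C \<otimes>\<^sub>m \<i>\<d> H) \<cdot> (\<i>\<d> (C \<otimes>\<^sub>o C) \<otimes>\<^sub>m \<mu>\<^sub>H) \<cdot> (\<i>\<d> C \<otimes>\<^sub>m \<c> H C \<otimes>\<^sub>m \<i>\<d> H) \<cdot> (\<delta> \<otimes>\<^sub>m \<delta>)"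
    and coact_unit: "\<delta> \<cdot> \<nu>\<^sub>C = (\<nu>\<^sub>C \<otimes>\<^sub>m \<i>\<d> H) \<cdot> \<nu>\<^sub>H"
begin

abbreviation "mult_H k \<equiv> Box k \<mu>\<^sub>H [H, H] [H]"
abbreviation "unit_H k \<equiv> Box k \<nu>\<^sub>H [] [H]"
abbreviation "comult k \<equiv> Box k \<Delta> [H] [H, H]"
abbreviation "counit k \<equiv> Box k \<epsilon> [H] []"
abbreviation "mult_B k \<equiv> Box k \<mu>\<^sub>B [B, B] [B]"
abbreviation "unit_B k \<equiv> Box k \<nu>\<^sub>B [] [B]"
abbreviation "act k \<equiv> Box k \<rho> [B, H] [B]"
abbreviation "mult_C k \<equiv> Box k \<mu>\<^sub>C [C, C] [C]"
abbreviation "unit_C k \<equiv> Box k \<nu>\<^sub>C [] [C]"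
abbreviation "coact k \<equiv> Box k \<delta> [C] [C, H]"

lemma generators [simp]:
  "H \<in> Obj \<C>" "B \<in> Obj \<C>" "C \<in> Obj \<C>"
  "\<mu>\<^sub>H \<in> Arr \<C>" "src \<C> \<mu>\<^sub>H = H \<otimes>\<^sub>o H" "tgt \<C> \<mu>\<^sub>H = H"
  "\<nu>\<^sub>H \<in> Arr \<C>" "src \<C> \<nu>\<^sub>H = \<I>" "tgt \<C> \<nu>\<^sub>H = H"
  "\<Delta> \<in> Arr \<C>" "src \<C> \<Delta> = H" "tgt \<C> \<Delta> = H \<otimes>\<^sub>o H"
  "\<epsilon> \<in> Arr \<C>" "src \<C> \<epsilon> = H" "tgt \<C> \<epsilon> = \<I>"
  "\<mu>\<^sub>B \<in> Arr \<C>" "src \<C> \<mu>\<^sub>B = B \<otimes>\<^sub>o B" "tgt \<C> \<mu>\<^sub>B = B"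
  "\<nu>\<^sub>B \<in> Arr \<C>" "src \<C> \<nu>\<^sub>B = \<I>" "tgt \<C> \<nu>\<^sub>B = B"
  "\<rho> \<in> Arr \<C>" "src \<C> \<rho> = B \<otimes>\<^sub>o H" "tgt \<C> \<rho> = B"
  "\<mu>\<^sub>C \<in> Arr \<C>" "src \<C> \<mu>\<^sub>C = C \<otimes>\<^sub>o C" "tgt \<C> \<mu>\<^sub>C = C"
  "\<nu>\<^sub>C \<in> Arr \<C>" "src \<C> \<nu>\<^sub>C = \<I>" "tgt \<C> \<nu>\<^sub>C = C"
  "\<delta> \<in> Arr \<C>" "src \<C> \<delta> = C" "tgt \<C> \<delta> = C \<otimes>\<^sub>o H"
  using alg_Obj mult_hom unit_hom comult_hom counit_hom alg.alg_Obj alg.mult_hom alg.unit_hom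
    ract_hom C.alg_Obj C.mult_hom C.unit_hom C.rcoact_hom
  by (simp_all add: hom_iff)

text \<open>The axioms as equations between diagrams, read from left to right: for instance, \<open>act_mult\<close> is
  \<open>(b b')\<cdot>h = (b\<cdot>h\<^sub>1)(b'\<cdot>h\<^sub>2)\<close> and \<open>mult_coact\<close> is \<open>(c c')\<^sub>0 \<otimes> (c c')\<^sub>1 = c\<^sub>0 c'\<^sub>0 \<otimes> c\<^sub>1 c'\<^sub>1\<close>.\<close>
lemma diagrams:
  shows act_mult: "equal_on [B, B, H] [mult_B 0, act 0] [comult 2, cross B H 1, act 0, act 1, mult_B 0]"
    and act_unit: "equal_on [H] [unit_B 0, act 0] [counit 0, unit_B 0]"
    and act_act: "equal_on [B, H, H] [act 0, act 0] [mult_H 1, act 0]"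
    and unit_act: "equal_on [B] [unit_H 1, act 0] []"
    and mult_coact: "equal_on [C, C] [mult_C 0, coact 0] [coact 0, coact 2, cross H C 1, mult_H 2, mult_C 0]"
    and unit_coact: "equal_on [] [unit_C 0, coact 0] [unit_H 0, unit_C 0]"
    and coact_coact: "equal_on [C] [coact 0, comult 1] [coact 0, coact 0]"
    and coact_counit: "equal_on [C] [coact 0, counit 1] []"
  using ract_mult ract_alg_unit ract_assoc ract_unit coact_mult coact_unit C.rcoact_coassoc C.rcoact_counit
    tensm_split[of \<rho> \<rho>] tensm_split[of \<delta> \<delta>] tensm_split'[of \<delta> \<delta>]
  by (simp_all add: equal_on_def whisker_def hom_iff)

text \<open>Naturality of the symmetry, with the symmetry of a tensor product already resolved
  into crossings of single wires.\<close>
lemma crossings: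
  shows mult_B_cross: "equal_on [B, B, C] [mult_B 0, cross B C 0] [cross B C 1, cross B C 0, mult_B 1]"
    and unit_B_cross: "equal_on [C] [unit_B 0, cross B C 0] [unit_B 1]"
    and act_cross: "equal_on [B, H, C] [act 0, cross B C 0] [cross H C 1, cross B C 0, act 1]"
    and mult_C_cross: "equal_on [B, C, C] [mult_C 1, cross B C 0] [cross B C 0, cross B C 1, mult_C 0]"
    and unit_C_cross: "equal_on [B] [unit_C 1, cross B C 0] [unit_C 0]"
    and coact_cross: "equal_on [B, C] [cross B C 0, coact 0] [coact 1, cross B C 0, cross B H 1]"
  using braid_natural[of \<mu>\<^sub>B "B \<otimes>\<^sub>o B" B "\<i>\<d> C" C C] braid_natural[of \<nu>\<^sub>B \<I> B "\<i>\<d> C" C C]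
    braid_natural[of \<rho> "B \<otimes>\<^sub>o H" B "\<i>\<d> C" C C] braid_natural[of "\<i>\<d> B" B B \<mu>\<^sub>C "C \<otimes>\<^sub>o C" C]
    braid_natural[of "\<i>\<d> B" B B \<nu>\<^sub>C \<I> C] braid_natural[of "\<i>\<d> B" B B \<delta> C "C \<otimes>\<^sub>o H"]
  by (simp_all add: equal_on_def whisker_def hom_iff braid_tenso_left braid_tenso_right)

text \<open>Both sides send \<open>b \<otimes> b' \<otimes> c\<close> to \<open>c\<^sub>0 \<otimes> (b\<cdot>c\<^sub>1)(b'\<cdot>c\<^sub>2)\<close>. On the left, \<open>c\<^sub>1\<close> and \<open>c\<^sub>2\<close> arise from a
  comultiplication, on the right from a second coaction; coassociativity identifies them.\<close>
lemma swap_mult_B: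
  "equal_on [B, B, C] [mult_B 0, coact 1, cross B C 0, act 1]
    [coact 2, cross B C 1, act 2, coact 1, cross B C 0, act 1, mult_B 1]"
proof -
  have "equal_on [B, B, C] [mult_B 0, coact 1, cross B C 0, act 1]
      [coact 2, cross B C 1, cross B C 0, mult_B 1, act 1]"
    by (rule equal_on_step[OF mult_B_cross, where k = 0 and pre = "[coact 2]" and post = "[act 1]"])
      (simp_all add: hom_iff)
  also have "equal_on [B, B, C] \<dots>
      [coact 2, cross B C 1, cross B C 0, comult 3, cross B H 2, act 1, act 2, mult_B 1]"
    by (rule equal_on_step[OF act_mult, where k = 1 and
          pre = "[coact 2, cross B C 1, cross B C 0]" and post = "[]"])
      (simp_all add: hom_iff)
  also have "equal_on [B, B, C] \<dots>
      [coact 2, coact 2, cross B C 1, cross B C 0, cross B H 2, act 1, act 2, mult_B 1]"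
    by (rule equal_on_step[OF coact_coact, where k = 2 and pre = "[]" and
          post = "[cross B C 1, cross B C 0, cross B H 2, act 1, act 2, mult_B 1]"])
      (simp_all add: hom_iff)
  also have "equal_on [B, B, C] \<dots>
      [coact 2, cross B C 1, act 2, coact 1, cross B C 0, act 1, mult_B 1]"
    by (rule equal_on_step[OF equal_on_sym[OF coact_cross], where k = 1 and pre = "[coact 2]" and
          post = "[act 3, cross B C 0, act 1, mult_B 1]"])
      (simp_all add: hom_iff)
  finally show ?thesis .
qed

text \<open>Both sides send \<open>b \<otimes> c \<otimes> c'\<close> to \<open>c\<^sub>0 c'\<^sub>0 \<otimes> (b\<cdot>c\<^sub>1)\<cdot>c'\<^sub>1\<close>.\<close>
lemma swap_mult_C:
  "equal_on [B, C, C] [mult_C 1, coact 1, cross B C 0, act 1]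
    [coact 1, cross B C 0, act 1, coact 2, cross B C 1, act 2, mult_C 0]"
proof -
  have "equal_on [B, C, C] [mult_C 1, coact 1, cross B C 0, act 1]
      [coact 1, coact 3, cross H C 2, mult_H 3, mult_C 1, cross B C 0, act 1]"
    by (rule equal_on_step[OF mult_coact, where k = 1 and pre = "[]" and post = "[cross B C 0, act 1]"])
      (simp_all add: hom_iff)
  also have "equal_on [B, C, C] \<dots>
      [coact 1, coact 3, cross H C 2, cross B C 0, cross B C 1, mult_H 3, act 2, mult_C 0]"
    by (rule equal_on_step[OF mult_C_cross, where k = 0 and
          pre = "[coact 1, coact 3, cross H C 2, mult_H 3]" and post = "[act 1]"])
      (simp_all add: hom_iff)
  also have "equal_on [B, C, C] \<dots>
      [coact 1, coact 3, cross H C 2, cross B C 0, cross B C 1, act 2, act 2, mult_C 0]"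
    by (rule equal_on_step[OF equal_on_sym[OF act_act], where k = 2 and
          pre = "[coact 1, coact 3, cross H C 2, cross B C 0, cross B C 1]" and post = "[mult_C 0]"])
      (simp_all add: hom_iff)
  also have "equal_on [B, C, C] \<dots>
      [coact 1, cross B C 0, act 1, coact 2, cross B C 1, act 2, mult_C 0]"
    by (rule equal_on_step[OF equal_on_sym[OF act_cross], where k = 1 and
          pre = "[coact 1, cross B C 0, coact 3]" and post = "[act 2, mult_C 0]"])
      (simp_all add: hom_iff)
  finally show ?thesis .
qed

text \<open>\<open>c\<^sub>0 \<otimes> 1\<cdot>c\<^sub>1 = c\<^sub>0 \<epsilon>(c\<^sub>1) \<otimes> 1 = c \<otimes> 1\<close>\<close>
lemma swap_unit_B: "equal_on [C] [unit_B 0, coact 1, cross B C 0, act 1] [unit_B 1]"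
proof -
  have "equal_on [C] [unit_B 0, coact 1, cross B C 0, act 1] [coact 0, unit_B 1, act 1]"
    by (rule equal_on_step[OF unit_B_cross, where k = 0 and pre = "[coact 0]" and post = "[act 1]"])
      (simp_all add: hom_iff)
  also have "equal_on [C] \<dots> [coact 0, counit 1, unit_B 1]"
    by (rule equal_on_step[OF act_unit, where k = 1 and pre = "[coact 0]" and post = "[]"])
      (simp_all add: hom_iff)
  also have "equal_on [C] \<dots> [unit_B 1]"
    by (rule equal_on_step[OF coact_counit, where k = 0 and pre = "[]" and post = "[unit_B 1]"])
      (simp_all add: hom_iff)
  finally show ?thesis .
qed

text \<open>\<open>1 \<otimes> b\<cdot>1 = 1 \<otimes> b\<close>, since the coaction preserves the unit.\<close>
lemma swap_unit_C: "equal_on [B] [unit_C 1, coact 1, cross B C 0, act 1] [unit_C 0]"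
proof -
  have "equal_on [B] [unit_C 1, coact 1, cross B C 0, act 1] [unit_H 1, unit_C 1, cross B C 0, act 1]"
    by (rule equal_on_step[OF unit_coact, where k = 1 and pre = "[]" and post = "[cross B C 0, act 1]"])
      (simp_all add: hom_iff)
  also have "equal_on [B] \<dots> [unit_H 1, unit_C 0, act 1]"
    by (rule equal_on_step[OF unit_C_cross, where k = 0 and pre = "[unit_H 1]" and post = "[act 1]"])
      (simp_all add: hom_iff)
  also have "equal_on [B] \<dots> [unit_C 0]"
    by (rule equal_on_step[OF unit_act, where k = 1 and pre = "[unit_C 0]" and post = "[]"])
      (simp_all add: hom_iff)
  finally show ?thesis .
qed

definition "coaction_swap = (\<i>\<d> C \<otimes>\<^sub>m \<rho>) \<cdot> (\<c> B C \<otimes>\<^sub>m \<i>\<d> H) \<cdot> (\<i>\<d> B \<otimes>\<^sub>m \<delta>)"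

lemma coaction_swap_law: "distributive_law \<C> B \<mu>\<^sub>B \<nu>\<^sub>B C \<mu>\<^sub>C \<nu>\<^sub>C coaction_swap"
proof
  show "coaction_swap \<in> Hom (B \<otimes>\<^sub>o C) (C \<otimes>\<^sub>o B)"
    by (simp add: coaction_swap_def hom_iff)
  show "coaction_swap \<cdot> (\<mu>\<^sub>B \<otimes>\<^sub>m \<i>\<d> C) =
    (\<i>\<d> C \<otimes>\<^sub>m \<mu>\<^sub>B) \<cdot> (coaction_swap \<otimes>\<^sub>m \<i>\<d> B) \<cdot> (\<i>\<d> B \<otimes>\<^sub>m coaction_swap)"
    using swap_mult_B by (simp add: coaction_swap_def equal_on_def whisker_def whisker_cmp)
  show "coaction_swap \<cdot> (\<i>\<d> B \<otimes>\<^sub>m \<mu>\<^sub>C) =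
    (\<mu>\<^sub>C \<otimes>\<^sub>m \<i>\<d> B) \<cdot> (\<i>\<d> C \<otimes>\<^sub>m coaction_swap) \<cdot> (coaction_swap \<otimes>\<^sub>m \<i>\<d> C)"
    using swap_mult_C by (simp add: coaction_swap_def equal_on_def whisker_def whisker_cmp)
  show "coaction_swap \<cdot> (\<nu>\<^sub>B \<otimes>\<^sub>m \<i>\<d> C) = \<i>\<d> C \<otimes>\<^sub>m \<nu>\<^sub>B"
    using swap_unit_B by (simp add: coaction_swap_def equal_on_def whisker_def whisker_cmp)
  show "coaction_swap \<cdot> (\<i>\<d> B \<otimes>\<^sub>m \<nu>\<^sub>C) = \<nu>\<^sub>C \<otimes>\<^sub>m \<i>\<d> B"
    using swap_unit_C by (simp add: coaction_swap_def equal_on_def whisker_def whisker_cmp)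
qed

end

section \<open>Reversing the tensor product\<close>

text \<open>The same category with the order of tensor factors reversed. Algebras, coalgebras and bialgebras
  stay what they are, while left modules and comodules become right ones.\<close>
definition mirror :: "('o, 'm, 'x) symcat_scheme \<Rightarrow> ('o, 'm, 'x) symcat_scheme" where
  "mirror \<C> = \<C>\<lparr>tenso := \<lambda>X Y. Y \<otimes>\<^sub>o\<^bsub>\<C>\<^esub> X, tensm := \<lambda>f g. g \<otimes>\<^sub>m\<^bsub>\<C>\<^esub> f, braid := \<lambda>X Y. \<c>\<^bsub>\<C>\<^esub> Y X\<rparr>"

lemma mirror_simps [simp]:
  "Obj (mirror \<C>) = Obj \<C>" "Arr (mirror \<C>) = Arr \<C>" "src (mirror \<C>) = src \<C>" "tgt (mirror \<C>) = tgt \<C>"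
  "idm (mirror \<C>) = idm \<C>" "cmp (mirror \<C>) = cmp \<C>" "unito (mirror \<C>) = unito \<C>"
  "tenso (mirror \<C>) X Y = tenso \<C> Y X" "tensm (mirror \<C>) f g = tensm \<C> g f"
  "braid (mirror \<C>) X Y = braid \<C> Y X"
  "hom_set (mirror \<C>) X Y = hom_set \<C> X Y"
  by (simp_all add: mirror_def hom_set_def)

context strict_symmetric_monoidal_category
begin

lemma mirror_symmetric: "strict_symmetric_monoidal_category (mirror \<C>)"
  by unfold_locales
    (auto simp: hom_iff interchange' braid_sym braid_tenso_left braid_tenso_right
      intro: braid_natural)

lemma mirror_algebra: "unital_algebra \<C> A \<mu> \<nu> \<Longrightarrow> unital_algebra (mirror \<C>) A \<mu> \<nu>"
  using strict_symmetric_monoidal_category.axioms(1)[OF mirror_symmetric]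
  by (auto simp: unital_algebra_def unital_algebra_axioms_def)

lemma mirror_law:
  assumes "unital_algebra \<C> X \<mu>\<^sub>X \<nu>\<^sub>X" "unital_algebra \<C> Y \<mu>\<^sub>Y \<nu>\<^sub>Y"
    and "distributive_law (mirror \<C>) X \<mu>\<^sub>X \<nu>\<^sub>X Y \<mu>\<^sub>Y \<nu>\<^sub>Y \<xi>"
  shows "distributive_law \<C> Y \<mu>\<^sub>Y \<nu>\<^sub>Y X \<mu>\<^sub>X \<nu>\<^sub>X \<xi>"
  using assms strict_monoidal_category_axioms
  by (auto simp: distributive_law_def distributive_law_axioms_def)

end

context bialgebra
begin

lemma mirror_bialgebra: "bialgebra (mirror \<C>) H \<mu> \<nu> \<Delta> \<epsilon>"
proof -
  interpret M: strict_symmetric_monoidal_category "mirror \<C>"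
    by (rule mirror_symmetric)
  have [simp]: "H \<in> Obj \<C>"
    by (rule alg_Obj)
  show ?thesis
    by unfold_locales
      (use mult_hom unit_hom mult_assoc mult_unit_left mult_unit_right comult_hom counit_hom
        comult_coassoc counit_left counit_right comult_mult comult_unit counit_mult counit_unit
       in simp_all)
qed

end

context left_module_algebra
begin

lemma mirror_module_algebra: "right_module_algebra (mirror \<C>) H \<mu>\<^sub>H \<nu>\<^sub>H \<Delta> \<epsilon> A \<mu>\<^sub>A \<nu>\<^sub>A lam"
proof -
  interpret M: bialgebra "mirror \<C>" H \<mu>\<^sub>H \<nu>\<^sub>H \<Delta> \<epsilon>
    by (rule mirror_bialgebra)
  interpret M: unital_algebra "mirror \<C>" A \<mu>\<^sub>A \<nu>\<^sub>A
    by (rule mirror_algebra[OF alg.unital_algebra_axioms])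
  have [simp]: "H \<in> Obj \<C>" "A \<in> Obj \<C>"
    by (rule alg_Obj alg.alg_Obj)+
  show ?thesis
    by unfold_locales
      (use lmod_Obj lact_hom lact_assoc lact_unit lact_mult lact_alg_unit in simp_all)
qed

end

context bicomodule_algebra
begin

lemma right_action_swap:
  assumes "right_module_algebra \<C> H \<mu>\<^sub>H \<nu>\<^sub>H \<Delta> \<epsilon> B \<mu>\<^sub>B \<nu>\<^sub>B \<rho>"
  shows "comodule_algebra_action \<C> H \<mu>\<^sub>H \<nu>\<^sub>H \<Delta> \<epsilon> B \<mu>\<^sub>B \<nu>\<^sub>B \<rho> C \<mu>\<^sub>C \<nu>\<^sub>C \<delta>\<^sub>r"
proof -
  interpret right_module_algebra \<C> H \<mu>\<^sub>H \<nu>\<^sub>H \<Delta> \<epsilon> B \<mu>\<^sub>B \<nu>\<^sub>B \<rho> by fact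
  show ?thesis
    by unfold_locales
      (use mult_right_comodule_hom unit_right_comodule_hom in \<open>simp_all add: right_comodule_hom_def\<close>)
qed

lemma left_action_swap:
  assumes "left_module_algebra \<C> H \<mu>\<^sub>H \<nu>\<^sub>H \<Delta> \<epsilon> A \<mu>\<^sub>A \<nu>\<^sub>A lam"
  shows "comodule_algebra_action (mirror \<C>) H \<mu>\<^sub>H \<nu>\<^sub>H \<Delta> \<epsilon> A \<mu>\<^sub>A \<nu>\<^sub>A lam C \<mu>\<^sub>C \<nu>\<^sub>C \<delta>\<^sub>l"
proof -
  interpret M: right_module_algebra "mirror \<C>" H \<mu>\<^sub>H \<nu>\<^sub>H \<Delta> \<epsilon> A \<mu>\<^sub>A \<nu>\<^sub>A lam
    using assms by (rule left_module_algebra.mirror_module_algebra)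
  interpret M: unital_algebra "mirror \<C>" C \<mu>\<^sub>C \<nu>\<^sub>C
    by (rule mirror_algebra[OF alg.unital_algebra_axioms])
  have [simp]: "H \<in> Obj \<C>" "C \<in> Obj \<C>"
    by (rule alg_Obj alg.alg_Obj)+
  have "\<c> C H \<in> Arr \<C>"
    by simp
  then show ?thesis
    by unfold_locales
      (use lcomod_Obj lcoact_hom lcoact_coassoc lcoact_counit mult_left_comodule_hom unit_left_comodule_hom
        in \<open>simp_all add: left_comodule_hom_def\<close>)
qed

end

section \<open>The three swaps of a bicomodule algebra with two module algebras\<close>

locale bicomodule_action =
  left_module_algebra \<C> H \<mu>\<^sub>H \<nu>\<^sub>H \<Delta> \<epsilon> A \<mu>\<^sub>A \<nu>\<^sub>A lam +
  B: right_module_algebra \<C> H \<mu>\<^sub>H \<nu>\<^sub>H \<Delta> \<epsilon> B \<mu>\<^sub>B \<nu>\<^sub>B \<rho> +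
  C: bicomodule_algebra \<C> H \<mu>\<^sub>H \<nu>\<^sub>H \<Delta> \<epsilon> C \<mu>\<^sub>C \<nu>\<^sub>C \<delta>\<^sub>l \<delta>\<^sub>r
  for \<C> :: "('o, 'm, 'x) symcat_scheme" (structure)
    and H :: 'o and \<mu>\<^sub>H \<nu>\<^sub>H \<Delta> \<epsilon> :: 'm
    and A :: 'o and \<mu>\<^sub>A \<nu>\<^sub>A lam :: 'm and B :: 'o and \<mu>\<^sub>B \<nu>\<^sub>B \<rho> :: 'm
    and C :: 'o and \<mu>\<^sub>C \<nu>\<^sub>C \<delta>\<^sub>l \<delta>\<^sub>r :: 'm
begin

definition "\<xi>\<^sub>B\<^sub>C = (\<i>\<d> C \<otimes>\<^sub>m \<rho>) \<cdot> (\<c> B C \<otimes>\<^sub>m \<i>\<d> H) \<cdot> (\<i>\<d> B \<otimes>\<^sub>m \<delta>\<^sub>r)"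

definition "\<xi>\<^sub>C\<^sub>A = (lam \<otimes>\<^sub>m \<i>\<d> C) \<cdot> (\<i>\<d> H \<otimes>\<^sub>m \<c> C A) \<cdot> (\<delta>\<^sub>l \<otimes>\<^sub>m \<i>\<d> A)"

lemma law_BC: "distributive_law \<C> B \<mu>\<^sub>B \<nu>\<^sub>B C \<mu>\<^sub>C \<nu>\<^sub>C \<xi>\<^sub>B\<^sub>C"
proof -
  interpret R: comodule_algebra_action \<C> H \<mu>\<^sub>H \<nu>\<^sub>H \<Delta> \<epsilon> B \<mu>\<^sub>B \<nu>\<^sub>B \<rho> C \<mu>\<^sub>C \<nu>\<^sub>C \<delta>\<^sub>r
    by (rule C.right_action_swap[OF B.right_module_algebra_axioms])
  show ?thesis
    using R.coaction_swap_law by (simp add: R.coaction_swap_def \<xi>\<^sub>B\<^sub>C_def)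
qed

lemma law_CA: "distributive_law \<C> C \<mu>\<^sub>C \<nu>\<^sub>C A \<mu>\<^sub>A \<nu>\<^sub>A \<xi>\<^sub>C\<^sub>A"
proof (rule mirror_law)
  interpret L: comodule_algebra_action "mirror \<C>" H \<mu>\<^sub>H \<nu>\<^sub>H \<Delta> \<epsilon> A \<mu>\<^sub>A \<nu>\<^sub>A lam C \<mu>\<^sub>C \<nu>\<^sub>C \<delta>\<^sub>l
    by (rule C.left_action_swap[OF left_module_algebra_axioms])
  show "distributive_law (mirror \<C>) A \<mu>\<^sub>A \<nu>\<^sub>A C \<mu>\<^sub>C \<nu>\<^sub>C \<xi>\<^sub>C\<^sub>A"
    using L.coaction_swap_law by (simp add: L.coaction_swap_def \<xi>\<^sub>C\<^sub>A_def)
qed (rule alg.unital_algebra_axioms C.alg.unital_algebra_axioms)+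

lemma law_BA: "distributive_law \<C> B \<mu>\<^sub>B \<nu>\<^sub>B A \<mu>\<^sub>A \<nu>\<^sub>A (\<c> B A)"
proof -
  have [simp]: "A \<in> Obj \<C>" "B \<in> Obj \<C>"
    "\<mu>\<^sub>A \<in> Arr \<C>" "src \<C> \<mu>\<^sub>A = A \<otimes>\<^sub>o A" "tgt \<C> \<mu>\<^sub>A = A"
    "\<nu>\<^sub>A \<in> Arr \<C>" "src \<C> \<nu>\<^sub>A = \<I>" "tgt \<C> \<nu>\<^sub>A = A"
    "\<mu>\<^sub>B \<in> Arr \<C>" "src \<C> \<mu>\<^sub>B = B \<otimes>\<^sub>o B" "tgt \<C> \<mu>\<^sub>B = B"
    "\<nu>\<^sub>B \<in> Arr \<C>" "src \<C> \<nu>\<^sub>B = \<I>" "tgt \<C> \<nu>\<^sub>B = B"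
    using alg.alg_Obj alg.mult_hom alg.unit_hom B.alg.alg_Obj B.alg.mult_hom B.alg.unit_hom
    by (simp_all add: hom_iff)
  show ?thesis
    by unfold_locales
      (use braid_natural[of \<mu>\<^sub>B "B \<otimes>\<^sub>o B" B "\<i>\<d> A" A A] braid_natural[of \<nu>\<^sub>B \<I> B "\<i>\<d> A" A A]
        braid_natural[of "\<i>\<d> B" B B \<mu>\<^sub>A "A \<otimes>\<^sub>o A" A] braid_natural[of "\<i>\<d> B" B B \<nu>\<^sub>A \<I> A]
        in \<open>simp_all add: hom_iff braid_tenso_left braid_tenso_right\<close>)
qed

lemma generators [simp]:
  "H \<in> Obj \<C>" "A \<in> Obj \<C>" "B \<in> Obj \<C>" "C \<in> Obj \<C>"
  "lam \<in> Arr \<C>" "src \<C> lam = H \<otimes>\<^sub>o A" "tgt \<C> lam = A"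
  "\<rho> \<in> Arr \<C>" "src \<C> \<rho> = B \<otimes>\<^sub>o H" "tgt \<C> \<rho> = B"
  "\<delta>\<^sub>l \<in> Arr \<C>" "src \<C> \<delta>\<^sub>l = C" "tgt \<C> \<delta>\<^sub>l = H \<otimes>\<^sub>o C"
  "\<delta>\<^sub>r \<in> Arr \<C>" "src \<C> \<delta>\<^sub>r = C" "tgt \<C> \<delta>\<^sub>r = C \<otimes>\<^sub>o H"
  using alg_Obj alg.alg_Obj B.alg.alg_Obj C.alg.alg_Obj lact_hom B.ract_hom C.lcoact_hom C.rcoact_hom
  by (simp_all add: hom_iff)

abbreviation "act_A k \<equiv> Box k lam [H, A] [A]"
abbreviation "act_B k \<equiv> Box k \<rho> [B, H] [B]"
abbreviation "coact_l k \<equiv> Box k \<delta>\<^sub>l [C] [H, C]"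
abbreviation "coact_r k \<equiv> Box k \<delta>\<^sub>r [C] [C, H]"

lemma crossings:
  shows commute: "equal_on [C] [coact_r 0, coact_l 0] [coact_l 0, coact_r 1]"
    and coact_l_cross: "equal_on [B, C] [cross B C 0, coact_l 0] [coact_l 1, cross B H 0, cross B C 1]"
    and coact_r_cross: "equal_on [C, A] [cross C A 0, coact_r 1] [coact_r 0, cross H A 1, cross C A 0]"
    and act_A_cross: "equal_on [B, H, A] [act_A 1, cross B A 0] [cross B H 0, cross B A 1, act_A 0]"
    and act_B_cross: "equal_on [B, H, A] [act_B 0, cross B A 0] [cross H A 1, cross B A 0, act_B 1]"
  using C.coacts_commute braid_natural[of "\<i>\<d> B" B B \<delta>\<^sub>l C "H \<otimes>\<^sub>o C"]
    braid_natural[of \<delta>\<^sub>r C "C \<otimes>\<^sub>o H" "\<i>\<d> A" A A] braid_natural[of "\<i>\<d> B" B B lam "H \<otimes>\<^sub>o A" A]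
    braid_natural[of \<rho> "B \<otimes>\<^sub>o H" B "\<i>\<d> A" A A]
  by (simp_all add: equal_on_def whisker_def hom_iff braid_tenso_left braid_tenso_right)

text \<open>Both sides send \<open>b \<otimes> c \<otimes> a\<close> to \<open>c\<^sub>-\<^sub>1\<cdot>a \<otimes> c\<^sub>0 \<otimes> b\<cdot>c\<^sub>1\<close>. The actions are moved to the end and the coactions
  to the beginning by naturality of the symmetry; then the order of the coactions is exchanged, and the remaining
  crossings form a Yang-Baxter equation of the symmetry.\<close>
lemma yang_baxter_diagram:
  "equal_on [B, C, A] [coact_r 1, cross B C 0, act_B 1, cross B A 1, coact_l 0, cross C A 1, act_A 0]
    [coact_l 1, cross C A 2, act_A 1, cross B A 0, coact_r 2, cross B C 1, act_B 2]"
proof -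
  have "equal_on [B, C, A]
      [coact_r 1, cross B C 0, act_B 1, cross B A 1, coact_l 0, cross C A 1, act_A 0]
      [coact_r 1, cross B C 0, coact_l 0, cross H A 3, cross B A 2, act_B 3, cross C A 1, act_A 0]"
    by (rule equal_on_step[OF act_B_cross, where k = 1 and pre = "[coact_r 1, cross B C 0]"
          and post = "[coact_l 0, cross C A 1, act_A 0]"]) (simp_all add: hom_iff)
  also have "equal_on [B, C, A] \<dots>
      [coact_r 1, coact_l 1, cross B H 0, cross B C 1, cross H A 3, cross B A 2, cross C A 1, act_B 3, act_A 0]"
    by (rule equal_on_step[OF coact_l_cross, where k = 0 and pre = "[coact_r 1]"
          and post = "[cross H A 3, cross B A 2, act_B 3, cross C A 1, act_A 0]"])
      (simp_all add: hom_iff)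
  also have "equal_on [B, C, A] \<dots>
      [coact_l 1, coact_r 2, cross B H 0, cross B C 1, cross H A 3, cross B A 2, cross C A 1, act_B 3, act_A 0]"
    by (rule equal_on_step[OF commute, where k = 1 and pre = "[]"
          and post = "[cross B H 0, cross B C 1, cross H A 3, cross B A 2, cross C A 1, act_B 3, act_A 0]"])
      (simp_all add: hom_iff)
  also have "equal_on [B, C, A] \<dots>
      [coact_l 1, coact_r 2, cross B H 0, cross H A 3, cross C A 2, cross B A 1, cross B C 2, act_B 3, act_A 0]"
    by (rule equal_on_step[OF cross_cross_cross[of B C A], where k = 1 and
          pre = "[coact_l 1, coact_r 2, cross B H 0, cross H A 3]" and post = "[act_B 3, act_A 0]"])
      (simp_all add: hom_iff)
  also have "equal_on [B, C, A] \<dots>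
      [coact_l 1, cross C A 2, cross B H 0, cross B A 1, coact_r 3, cross B C 2, act_B 3, act_A 0]"
    by (rule equal_on_step[OF equal_on_sym[OF coact_r_cross], where k = 2 and pre = "[coact_l 1]" and
          post = "[cross B H 0, cross B A 1, cross B C 2, act_B 3, act_A 0]"])
      (simp_all add: hom_iff)
  also have "equal_on [B, C, A] \<dots>
      [coact_l 1, cross C A 2, act_A 1, cross B A 0, coact_r 2, cross B C 1, act_B 2]"
    by (rule equal_on_step[OF equal_on_sym[OF act_A_cross], where k = 0 and
          pre = "[coact_l 1, cross C A 2]" and post = "[coact_r 2, cross B C 1, act_B 2]"])
      (simp_all add: hom_iff)
  finally show ?thesis .
qed

lemma yang_baxter_BCA:
  "(\<xi>\<^sub>C\<^sub>A \<otimes>\<^sub>m \<i>\<d> B) \<cdot> (\<i>\<d> C \<otimes>\<^sub>m \<c> B A) \<cdot> (\<xi>\<^sub>B\<^sub>C \<otimes>\<^sub>m \<i>\<d> A) =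
   (\<i>\<d> A \<otimes>\<^sub>m \<xi>\<^sub>B\<^sub>C) \<cdot> (\<c> B A \<otimes>\<^sub>m \<i>\<d> C) \<cdot> (\<i>\<d> B \<otimes>\<^sub>m \<xi>\<^sub>C\<^sub>A)"
  using yang_baxter_diagram
  by (simp add: \<xi>\<^sub>B\<^sub>C_def \<xi>\<^sub>C\<^sub>A_def equal_on_def whisker_def whisker_cmp)

end

section \<open>Yang-Baxter equations and linear maps\<close>

context unital_algebra
begin

text \<open>Both sides send \<open>x \<otimes> y \<otimes> z\<close> to \<open>1 \<otimes> 1 \<otimes> x y z\<close>, with different bracketings.\<close>
lemma multiplication_swap_yang_baxter:
  "((\<nu> \<otimes>\<^sub>m \<mu>) \<otimes>\<^sub>m \<i>\<d> A) \<cdot> (\<i>\<d> A \<otimes>\<^sub>m \<nu> \<otimes>\<^sub>m \<mu>) \<cdot> ((\<nu> \<otimes>\<^sub>m \<mu>) \<otimes>\<^sub>m \<i>\<d> A) =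
   (\<i>\<d> A \<otimes>\<^sub>m \<nu> \<otimes>\<^sub>m \<mu>) \<cdot> ((\<nu> \<otimes>\<^sub>m \<mu>) \<otimes>\<^sub>m \<i>\<d> A) \<cdot> (\<i>\<d> A \<otimes>\<^sub>m \<nu> \<otimes>\<^sub>m \<mu>)"
proof -
  have [simp]: "A \<in> Obj \<C>" "\<mu> \<in> Arr \<C>" "src \<C> \<mu> = A \<otimes>\<^sub>o A" "tgt \<C> \<mu> = A"
    "\<nu> \<in> Arr \<C>" "src \<C> \<nu> = \<I>" "tgt \<C> \<nu> = A"
    using alg_Obj mult_hom unit_hom by (simp_all add: hom_iff)
  let ?m = "\<lambda>k. Box k \<mu> [A, A] [A]" and ?u = "\<lambda>k. Box k \<nu> [] [A]"
  have assoc: "equal_on [A, A, A] [?m 0, ?m 0] [?m 1, ?m 0]"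
    and unit: "equal_on [A] [?u 1, ?m 0] []"
    using mult_assoc mult_unit_right by (simp_all add: equal_on_def whisker_def hom_iff)
  have "equal_on [A, A, A] [?m 0, ?u 0, ?m 1, ?u 1, ?m 0, ?u 0] [?m 0, ?m 0, ?u 0, ?u 1]"
    by (rule equal_on_step[OF unit, where k = 0 and pre = "[?m 0, ?u 0, ?m 1]" and post = "[?u 0]"])
      (simp_all add: hom_iff)
  also have "equal_on [A, A, A] \<dots> [?m 1, ?m 0, ?u 0, ?u 1]"
    by (rule equal_on_step[OF assoc, where k = 0 and pre = "[]" and post = "[?u 0, ?u 1]"])
      (simp_all add: hom_iff)
  also have "equal_on [A, A, A] \<dots> [?m 1, ?u 1, ?m 0, ?u 0, ?m 1, ?u 1]"
    by (rule equal_on_step[OF equal_on_sym[OF unit], where k = 0 and pre = "[?m 1]"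
          and post = "[?u 0, ?m 1, ?u 1]"])
      (simp_all add: hom_iff)
  finally show ?thesis
    by (simp add: equal_on_def whisker_def tensm_split'[of \<nu> \<mu>] whisker_cmp)
qed

text \<open>The swap \<open>\<nu> \<otimes> \<mu>\<close> sends \<open>x \<otimes> y\<close> to \<open>1 \<otimes> x y\<close>, so for a unital action the swap condition
  \<open>(m\<cdot>x)\<cdot>y = (m\<cdot>1)\<cdot>(x y)\<close> is associativity.\<close>
lemma module_iff_swap_invariant:
  assumes M: "M \<in> Obj \<C>" and hom: "\<rho> \<in> Hom (M \<otimes>\<^sub>o A) M" and unit: "\<rho> \<cdot> (\<i>\<d> M \<otimes>\<^sub>m \<nu>) = \<i>\<d> M"
  shows "right_module \<C> A \<mu> \<nu> M \<rho> \<longleftrightarrow>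
    \<rho> \<cdot> (\<rho> \<otimes>\<^sub>m \<i>\<d> A) = \<rho> \<cdot> (\<rho> \<otimes>\<^sub>m \<i>\<d> A) \<cdot> (\<i>\<d> M \<otimes>\<^sub>m \<nu> \<otimes>\<^sub>m \<mu>)"
proof -
  have [simp]: "A \<in> Obj \<C>" "\<mu> \<in> Arr \<C>" "src \<C> \<mu> = A \<otimes>\<^sub>o A" "tgt \<C> \<mu> = A"
    "\<nu> \<in> Arr \<C>" "src \<C> \<nu> = \<I>" "tgt \<C> \<nu> = A"
    "\<rho> \<in> Arr \<C>" "src \<C> \<rho> = M \<otimes>\<^sub>o A" "tgt \<C> \<rho> = M"
    using alg_Obj mult_hom unit_hom hom by (simp_all add: hom_iff)
  have "(\<rho> \<otimes>\<^sub>m \<i>\<d> A) \<cdot> (\<i>\<d> M \<otimes>\<^sub>m \<nu> \<otimes>\<^sub>m \<mu>) = (\<rho> \<cdot> (\<i>\<d> M \<otimes>\<^sub>m \<nu>)) \<otimes>\<^sub>m (\<i>\<d> A \<cdot> \<mu>)"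
    using M by (subst interchange') simp_all
  then have "(\<rho> \<otimes>\<^sub>m \<i>\<d> A) \<cdot> (\<i>\<d> M \<otimes>\<^sub>m \<nu> \<otimes>\<^sub>m \<mu>) = \<i>\<d> M \<otimes>\<^sub>m \<mu>"
    by (simp add: unit)
  then show ?thesis
    using assms unital_algebra_axioms by (simp add: right_module_def right_module_axioms_def)
qed

end

context distributive_law
begin

text \<open>The swaps of \<open>1\<close> and \<open>x x'\<close> with \<open>y\<close> on the left-hand side reduce to that of \<open>x x'\<close>, so that
  this equation amounts to multiplicativity of \<open>\<xi>\<close> in \<open>X\<close>; the next one is multiplicativity in \<open>Y\<close>.\<close>
lemma yang_baxter_XXY:
  "(\<xi> \<otimes>\<^sub>m \<i>\<d> X) \<cdot> (\<i>\<d> X \<otimes>\<^sub>m \<xi>) \<cdot> ((\<nu>\<^sub>X \<otimes>\<^sub>m \<mu>\<^sub>X) \<otimes>\<^sub>m \<i>\<d> Y) =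
   (\<i>\<d> Y \<otimes>\<^sub>m \<nu>\<^sub>X \<otimes>\<^sub>m \<mu>\<^sub>X) \<cdot> (\<xi> \<otimes>\<^sub>m \<i>\<d> X) \<cdot> (\<i>\<d> X \<otimes>\<^sub>m \<xi>)"
proof -
  have "equal_on [X, X, Y] [mult_X 0, unit_X 0, twist 1, twist 0] [mult_X 0, twist 0, unit_X 1]"
    by (rule equal_on_step[OF twist_unit_X, where k = 0 and pre = "[mult_X 0, twist 0]" and post = "[]"])
      (simp_all add: hom_iff)
  also have "equal_on [X, X, Y] \<dots> [twist 1, twist 0, mult_X 1, unit_X 1]"
    by (rule equal_on_step[OF twist_mult_X, where k = 0 and pre = "[]" and post = "[unit_X 1]"])
      (simp_all add: hom_iff)
  finally show ?thesis
    by (simp add: equal_on_def whisker_def tensm_split'[of \<nu>\<^sub>X \<mu>\<^sub>X] whisker_cmp)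
qed

lemma yang_baxter_XYY:
  "((\<nu>\<^sub>Y \<otimes>\<^sub>m \<mu>\<^sub>Y) \<otimes>\<^sub>m \<i>\<d> X) \<cdot> (\<i>\<d> Y \<otimes>\<^sub>m \<xi>) \<cdot> (\<xi> \<otimes>\<^sub>m \<i>\<d> Y) =
   (\<i>\<d> Y \<otimes>\<^sub>m \<xi>) \<cdot> (\<xi> \<otimes>\<^sub>m \<i>\<d> Y) \<cdot> (\<i>\<d> X \<otimes>\<^sub>m \<nu>\<^sub>Y \<otimes>\<^sub>m \<mu>\<^sub>Y)"
proof -
  have "equal_on [X, Y, Y] [mult_Y 1, unit_Y 1, twist 0, twist 1] [mult_Y 1, twist 0, unit_Y 0]"
    by (rule equal_on_step[OF twist_unit_Y, where k = 0 and pre = "[mult_Y 1]" and post = "[twist 1]"])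
      (simp_all add: hom_iff)
  also have "equal_on [X, Y, Y] \<dots> [twist 0, twist 1, mult_Y 0, unit_Y 0]"
    by (rule equal_on_step[OF twist_mult_Y, where k = 0 and pre = "[]" and post = "[unit_Y 0]"])
      (simp_all add: hom_iff)
  finally show ?thesis
    by (simp add: equal_on_def whisker_def tensm_split'[of \<nu>\<^sub>Y \<mu>\<^sub>Y] whisker_cmp)
qed

text \<open>A map that is linear for the joint action is linear for its restrictions, and the two actions
  are such restrictions; conversely, the joint action is a composite of the two actions.\<close>
lemma linear_joint_iff:
  assumes M: "right_module \<C> X \<mu>\<^sub>X \<nu>\<^sub>X M \<rho>\<^sub>X" "right_module \<C> Y \<mu>\<^sub>Y \<nu>\<^sub>Y M \<rho>\<^sub>Y" "compatible M \<rho>\<^sub>X \<rho>\<^sub>Y"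
    and N: "right_module \<C> X \<mu>\<^sub>X \<nu>\<^sub>X N \<rho>\<^sub>X'" "right_module \<C> Y \<mu>\<^sub>Y \<nu>\<^sub>Y N \<rho>\<^sub>Y'" "compatible N \<rho>\<^sub>X' \<rho>\<^sub>Y'"
    and f: "f \<in> Hom M N"
  shows "f \<cdot> joint_action \<rho>\<^sub>X \<rho>\<^sub>Y = joint_action \<rho>\<^sub>X' \<rho>\<^sub>Y' \<cdot> (f \<otimes>\<^sub>m \<i>\<d> (Y \<otimes>\<^sub>o X)) \<longleftrightarrow>
    f \<cdot> \<rho>\<^sub>X = \<rho>\<^sub>X' \<cdot> (f \<otimes>\<^sub>m \<i>\<d> X) \<and> f \<cdot> \<rho>\<^sub>Y = \<rho>\<^sub>Y' \<cdot> (f \<otimes>\<^sub>m \<i>\<d> Y)"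
    (is "?joint \<longleftrightarrow> _")
proof -
  interpret MX: right_module \<C> X \<mu>\<^sub>X \<nu>\<^sub>X M \<rho>\<^sub>X by fact
  interpret MY: right_module \<C> Y \<mu>\<^sub>Y \<nu>\<^sub>Y M \<rho>\<^sub>Y by fact
  interpret NX: right_module \<C> X \<mu>\<^sub>X \<nu>\<^sub>X N \<rho>\<^sub>X' by fact
  interpret NY: right_module \<C> Y \<mu>\<^sub>Y \<nu>\<^sub>Y N \<rho>\<^sub>Y' by fact
  have [simp]: "M \<in> Obj \<C>" "N \<in> Obj \<C>" "f \<in> Arr \<C>" "src \<C> f = M" "tgt \<C> f = N"
    "\<rho>\<^sub>X \<in> Arr \<C>" "src \<C> \<rho>\<^sub>X = M \<otimes>\<^sub>o X" "tgt \<C> \<rho>\<^sub>X = M"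
    "\<rho>\<^sub>Y \<in> Arr \<C>" "src \<C> \<rho>\<^sub>Y = M \<otimes>\<^sub>o Y" "tgt \<C> \<rho>\<^sub>Y = M"
    "\<rho>\<^sub>X' \<in> Arr \<C>" "src \<C> \<rho>\<^sub>X' = N \<otimes>\<^sub>o X" "tgt \<C> \<rho>\<^sub>X' = N"
    "\<rho>\<^sub>Y' \<in> Arr \<C>" "src \<C> \<rho>\<^sub>Y' = N \<otimes>\<^sub>o Y" "tgt \<C> \<rho>\<^sub>Y' = N"
    using MX.rmod_Obj NX.rmod_Obj MX.ract_hom MY.ract_hom NX.ract_hom NY.ract_hom f
    by (simp_all add: hom_iff)
  have [simp]: "joint_action \<rho>\<^sub>X \<rho>\<^sub>Y \<in> Arr \<C>" "src \<C> (joint_action \<rho>\<^sub>X \<rho>\<^sub>Y) = M \<otimes>\<^sub>o Y \<otimes>\<^sub>o X"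
    "tgt \<C> (joint_action \<rho>\<^sub>X \<rho>\<^sub>Y) = M"
    "joint_action \<rho>\<^sub>X' \<rho>\<^sub>Y' \<in> Arr \<C>" "src \<C> (joint_action \<rho>\<^sub>X' \<rho>\<^sub>Y') = N \<otimes>\<^sub>o Y \<otimes>\<^sub>o X"
    "tgt \<C> (joint_action \<rho>\<^sub>X' \<rho>\<^sub>Y') = N"
    by (simp_all add: joint_action_def)
  have restrict: "f \<cdot> (joint_action \<rho>\<^sub>X \<rho>\<^sub>Y \<cdot> (\<i>\<d> M \<otimes>\<^sub>m g)) =
      (joint_action \<rho>\<^sub>X' \<rho>\<^sub>Y' \<cdot> (\<i>\<d> N \<otimes>\<^sub>m g)) \<cdot> (f \<otimes>\<^sub>m \<i>\<d> Z)"
    if ?joint "g \<in> Arr \<C>" "src \<C> g = Z" "tgt \<C> g = Y \<otimes>\<^sub>o X" for g Z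
  proof -
    have [simp]: "g \<in> Arr \<C>" "src \<C> g = Z" "tgt \<C> g = Y \<otimes>\<^sub>o X" "Z \<in> Obj \<C>"
      using that by auto
    have "f \<cdot> (joint_action \<rho>\<^sub>X \<rho>\<^sub>Y \<cdot> (\<i>\<d> M \<otimes>\<^sub>m g)) = (f \<cdot> joint_action \<rho>\<^sub>X \<rho>\<^sub>Y) \<cdot> (\<i>\<d> M \<otimes>\<^sub>m g)"
      by simp
    also have "\<dots> = joint_action \<rho>\<^sub>X' \<rho>\<^sub>Y' \<cdot> ((f \<otimes>\<^sub>m \<i>\<d> (Y \<otimes>\<^sub>o X)) \<cdot> (\<i>\<d> M \<otimes>\<^sub>m g))"
      unfolding that(1) by simp
    also have "(f \<otimes>\<^sub>m \<i>\<d> (Y \<otimes>\<^sub>o X)) \<cdot> (\<i>\<d> M \<otimes>\<^sub>m g) = (\<i>\<d> N \<otimes>\<^sub>m g) \<cdot> (f \<otimes>\<^sub>m \<i>\<d> Z)"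
      using tensm_split[of f g] tensm_split'[of f g] by simp
    finally show ?thesis
      by simp
  qed
  show ?thesis
  proof (intro iffI conjI)
    assume joint: ?joint
    show "f \<cdot> \<rho>\<^sub>X = \<rho>\<^sub>X' \<cdot> (f \<otimes>\<^sub>m \<i>\<d> X)"
      using restrict[OF joint incl_arr(1-3)] unfolding joint_action_module(2)[OF M] joint_action_module(2)[OF N] .
    show "f \<cdot> \<rho>\<^sub>Y = \<rho>\<^sub>Y' \<cdot> (f \<otimes>\<^sub>m \<i>\<d> Y)"
      using restrict[OF joint incl_arr(4-6)] unfolding joint_action_module(3)[OF M] joint_action_module(3)[OF N] .
  next
    assume linear: "f \<cdot> \<rho>\<^sub>X = \<rho>\<^sub>X' \<cdot> (f \<otimes>\<^sub>m \<i>\<d> X) \<and> f \<cdot> \<rho>\<^sub>Y = \<rho>\<^sub>Y' \<cdot> (f \<otimes>\<^sub>m \<i>\<d> Y)"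
    have "f \<cdot> joint_action \<rho>\<^sub>X \<rho>\<^sub>Y = (f \<cdot> \<rho>\<^sub>X) \<cdot> (\<rho>\<^sub>Y \<otimes>\<^sub>m \<i>\<d> X)"
      by (simp add: joint_action_def)
    also have "\<dots> = \<rho>\<^sub>X' \<cdot> ((f \<cdot> \<rho>\<^sub>Y) \<otimes>\<^sub>m \<i>\<d> X)"
      unfolding conjunct1[OF linear] by (simp add: whisker_cmp)
    also have "\<dots> = \<rho>\<^sub>X' \<cdot> ((\<rho>\<^sub>Y' \<cdot> (f \<otimes>\<^sub>m \<i>\<d> Y)) \<otimes>\<^sub>m \<i>\<d> X)"
      unfolding conjunct2[OF linear] ..
    also have "\<dots> = joint_action \<rho>\<^sub>X' \<rho>\<^sub>Y' \<cdot> (f \<otimes>\<^sub>m \<i>\<d> (Y \<otimes>\<^sub>o X))"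
      by (simp add: joint_action_def whisker_cmp)
    finally show ?joint .
  qed
qed

end

section \<open>Three algebras with compatible distributive laws\<close>

locale braided_triple = strict_monoidal_category \<C> +
  BC: distributive_law \<C> B \<mu>\<^sub>B \<nu>\<^sub>B C \<mu>\<^sub>C \<nu>\<^sub>C \<xi>\<^sub>B\<^sub>C +
  BA: distributive_law \<C> B \<mu>\<^sub>B \<nu>\<^sub>B A \<mu>\<^sub>A \<nu>\<^sub>A \<xi>\<^sub>B\<^sub>A +
  CA: distributive_law \<C> C \<mu>\<^sub>C \<nu>\<^sub>C A \<mu>\<^sub>A \<nu>\<^sub>A \<xi>\<^sub>C\<^sub>A
  for \<C> :: "('o, 'm, 'x) moncat_scheme" (structure)
    and B :: 'o and \<mu>\<^sub>B \<nu>\<^sub>B :: 'm and C :: 'o and \<mu>\<^sub>C \<nu>\<^sub>C :: 'm and A :: 'o and \<mu>\<^sub>A \<nu>\<^sub>A :: 'm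
    and \<xi>\<^sub>B\<^sub>C \<xi>\<^sub>B\<^sub>A \<xi>\<^sub>C\<^sub>A :: 'm +
  assumes yang_baxter_BCA:
    "(\<xi>\<^sub>C\<^sub>A \<otimes>\<^sub>m \<i>\<d> B) \<cdot> (\<i>\<d> C \<otimes>\<^sub>m \<xi>\<^sub>B\<^sub>A) \<cdot> (\<xi>\<^sub>B\<^sub>C \<otimes>\<^sub>m \<i>\<d> A) =
     (\<i>\<d> A \<otimes>\<^sub>m \<xi>\<^sub>B\<^sub>C) \<cdot> (\<xi>\<^sub>B\<^sub>A \<otimes>\<^sub>m \<i>\<d> C) \<cdot> (\<i>\<d> B \<otimes>\<^sub>m \<xi>\<^sub>C\<^sub>A)"
begin

abbreviation "BC k \<equiv> Box k \<xi>\<^sub>B\<^sub>C [B, C] [C, B]"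
abbreviation "BA k \<equiv> Box k \<xi>\<^sub>B\<^sub>A [B, A] [A, B]"
abbreviation "CA k \<equiv> Box k \<xi>\<^sub>C\<^sub>A [C, A] [A, C]"
abbreviation "mult_A k \<equiv> Box k \<mu>\<^sub>A [A, A] [A]"
abbreviation "mult_B k \<equiv> Box k \<mu>\<^sub>B [B, B] [B]"
abbreviation "mult_C k \<equiv> Box k \<mu>\<^sub>C [C, C] [C]"
abbreviation "unit_A k \<equiv> Box k \<nu>\<^sub>A [] [A]"
abbreviation "unit_B k \<equiv> Box k \<nu>\<^sub>B [] [B]"
abbreviation "unit_C k \<equiv> Box k \<nu>\<^sub>C [] [C]"

lemma yang_baxter_diagram: "equal_on [B, C, A] [BC 0, BA 1, CA 0] [CA 1, BA 0, BC 1]"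
  using yang_baxter_BCA by (simp add: equal_on_def whisker_def hom_iff)

definition "outer_swap = (\<i>\<d> A \<otimes>\<^sub>m \<xi>\<^sub>B\<^sub>C) \<cdot> (\<xi>\<^sub>B\<^sub>A \<otimes>\<^sub>m \<i>\<d> C)"

text \<open>Compatibility with products in \<open>A \<otimes> C\<close> requires that \<open>B\<close> can be moved past the swap of \<open>C\<close> with
  \<open>A\<close> that is part of the multiplication; this is the Yang-Baxter equation.\<close>
lemma outer_law:
  "distributive_law \<C> B \<mu>\<^sub>B \<nu>\<^sub>B (A \<otimes>\<^sub>o C) CA.twisted_mult CA.twisted_unit outer_swap"
proof -
  have "equal_on [B, B, A, C] [mult_B 0, BA 0, BC 1] [BA 1, BA 0, mult_B 1, BC 1]"
    by (rule equal_on_step[OF BA.twist_mult_X, where k = 0 and pre = "[]" and post = "[BC 1]"])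
      (simp_all add: hom_iff)
  also have "equal_on [B, B, A, C] \<dots> [BA 1, BC 2, BA 0, BC 1, mult_B 2]"
    by (rule equal_on_step[OF BC.twist_mult_X, where k = 1 and pre = "[BA 1, BA 0]" and post = "[]"])
      (simp_all add: hom_iff)
  finally have mult_left:
    "equal_on [B, B, A, C] [mult_B 0, BA 0, BC 1] [BA 1, BC 2, BA 0, BC 1, mult_B 2]" .
  have "equal_on [B, A, C, A, C] [CA 2, mult_A 1, mult_C 2, BA 0, BC 1]
      [CA 2, BA 0, BA 1, mult_A 0, mult_C 2, BC 1]"
    by (rule equal_on_step[OF BA.twist_mult_Y, where k = 0 and pre = "[CA 2]"
          and post = "[mult_C 2, BC 1]"]) (simp_all add: hom_iff)
  also have "equal_on [B, A, C, A, C] \<dots> [CA 2, BA 0, BA 1, BC 2, BC 3, mult_A 0, mult_C 1]"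
    by (rule equal_on_step[OF BC.twist_mult_Y, where k = 1 and pre = "[CA 2, BA 0, BA 1, mult_A 0]"
          and post = "[]"]) (simp_all add: hom_iff)
  also have "equal_on [B, A, C, A, C] \<dots> [BA 0, BC 1, BA 2, BC 3, CA 1, mult_A 0, mult_C 1]"
    by (rule equal_on_step[OF equal_on_sym[OF yang_baxter_diagram], where k = 1 and pre = "[BA 0]"
          and post = "[BC 3, mult_A 0, mult_C 1]"]) (simp_all add: hom_iff)
  finally have mult_right: "equal_on [B, A, C, A, C] [CA 2, mult_A 1, mult_C 2, BA 0, BC 1]
      [BA 0, BC 1, BA 2, BC 3, CA 1, mult_A 0, mult_C 1]" .
  have "equal_on [A, C] [unit_B 0, BA 0, BC 1] [unit_B 1, BC 1]"
    by (rule equal_on_step[OF BA.twist_unit_X, where k = 0 and pre = "[]" and post = "[BC 1]"])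
      (simp_all add: hom_iff)
  also have "equal_on [A, C] \<dots> [unit_B 2]"
    by (rule equal_on_step[OF BC.twist_unit_X, where k = 1 and pre = "[]" and post = "[]"])
      (simp_all add: hom_iff)
  finally have unit_left: "equal_on [A, C] [unit_B 0, BA 0, BC 1] [unit_B 2]" .
  have "equal_on [B] [unit_A 1, unit_C 2, BA 0, BC 1] [unit_A 0, unit_C 2, BC 1]"
    by (rule equal_on_step[OF BA.twist_unit_Y, where k = 0 and pre = "[]" and post = "[unit_C 2, BC 1]"])
      (simp_all add: hom_iff)
  also have "equal_on [B] \<dots> [unit_A 0, unit_C 1]"
    by (rule equal_on_step[OF BC.twist_unit_Y, where k = 1 and pre = "[unit_A 0]" and post = "[]"])
      (simp_all add: hom_iff)
  finally have unit_right: "equal_on [B] [unit_A 1, unit_C 2, BA 0, BC 1] [unit_A 0, unit_C 1]" .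
  interpret AC: unital_algebra \<C> "A \<otimes>\<^sub>o C" CA.twisted_mult CA.twisted_unit
    by (rule CA.twisted_algebra)
  show ?thesis
    by unfold_locales
      (use mult_left mult_right unit_left unit_right in \<open>simp_all add: outer_swap_def
        CA.twisted_mult_layers CA.twisted_unit_layers equal_on_def whisker_def whisker_cmp hom_iff\<close>)
qed

sublocale outer: distributive_law \<C> B \<mu>\<^sub>B \<nu>\<^sub>B "A \<otimes>\<^sub>o C" CA.twisted_mult CA.twisted_unit outer_swap
  by (rule outer_law)

text \<open>The twisted product of \<open>B\<close> with \<open>A \<otimes> C\<close> swaps \<open>B\<close> with \<open>A\<close>, \<open>B\<close> with \<open>C\<close> and \<open>C\<close> with \<open>A\<close>, in this
  order; the last two swaps act on disjoint factors and may be interchanged.\<close>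
lemma outer_mult_eq:
  "outer.twisted_mult = (\<mu>\<^sub>A \<otimes>\<^sub>m \<mu>\<^sub>C \<otimes>\<^sub>m \<mu>\<^sub>B)
    \<cdot> at_pos \<C> [A, A, C, B, C, B] 4 \<xi>\<^sub>B\<^sub>C
    \<cdot> at_pos \<C> [A, C, A, B, C, B] 2 \<xi>\<^sub>C\<^sub>A
    \<cdot> at_pos \<C> [A, C, B, A, C, B] 3 \<xi>\<^sub>B\<^sub>A"
proof -
  have "equal_on [A, C, B, A, C, B] [BA 2, BC 3, CA 1, mult_A 0, mult_C 1, mult_B 2]
      [BA 2, CA 1, BC 3, mult_A 0, mult_C 1, mult_B 2]"
    by (rule equal_on_isotopy) (simp_all add: hom_iff)
  moreover have "\<mu>\<^sub>A \<otimes>\<^sub>m \<mu>\<^sub>C \<otimes>\<^sub>m \<mu>\<^sub>B =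
      (\<i>\<d> (A \<otimes>\<^sub>o C) \<otimes>\<^sub>m \<mu>\<^sub>B) \<cdot> (\<i>\<d> A \<otimes>\<^sub>m \<mu>\<^sub>C \<otimes>\<^sub>m \<i>\<d> (B \<otimes>\<^sub>o B)) \<cdot>
      (\<mu>\<^sub>A \<otimes>\<^sub>m \<i>\<d> (C \<otimes>\<^sub>o C \<otimes>\<^sub>o B \<otimes>\<^sub>o B))"
    using tensm_split[of \<mu>\<^sub>A "\<mu>\<^sub>C \<otimes>\<^sub>m \<mu>\<^sub>B"] tensm_split[of \<mu>\<^sub>C \<mu>\<^sub>B] by (simp add: whisker_cmp)
  ultimately show ?thesis
    unfolding outer.twisted_mult_layers
    by (simp add: outer_swap_def CA.twisted_mult_layers at_pos_def
        equal_on_def whisker_def whisker_cmp)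
qed

lemma outer_unit_eq: "outer.twisted_unit = \<nu>\<^sub>A \<otimes>\<^sub>m \<nu>\<^sub>C \<otimes>\<^sub>m \<nu>\<^sub>B"
  unfolding outer.twisted_unit_def by (simp add: CA.twisted_unit_def)

text \<open>On \<open>1 \<otimes> c\<close> and \<open>a \<otimes> 1\<close> the outer swap reduces to the given ones, by their unit conditions.
  This allows the compatibility with the outer swap to be restricted to \<open>C\<close> and to \<open>A\<close>.\<close>
lemma outer_swap_incl:
  "outer_swap \<cdot> (\<i>\<d> B \<otimes>\<^sub>m CA.incl_X) = (CA.incl_X \<otimes>\<^sub>m \<i>\<d> B) \<cdot> \<xi>\<^sub>B\<^sub>C"
  "outer_swap \<cdot> (\<i>\<d> B \<otimes>\<^sub>m CA.incl_Y) = (CA.incl_Y \<otimes>\<^sub>m \<i>\<d> B) \<cdot> \<xi>\<^sub>B\<^sub>A"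
proof -
  have "equal_on [B, C] [unit_A 1, BA 0, BC 1] [BC 0, unit_A 0]"
    by (rule equal_on_step[OF BA.twist_unit_Y, where k = 0 and pre = "[]" and post = "[BC 1]"])
      (simp_all add: hom_iff)
  then show "outer_swap \<cdot> (\<i>\<d> B \<otimes>\<^sub>m CA.incl_X) = (CA.incl_X \<otimes>\<^sub>m \<i>\<d> B) \<cdot> \<xi>\<^sub>B\<^sub>C"
    by (simp add: outer_swap_def CA.incl_X_def equal_on_def whisker_def whisker_cmp)
  have "equal_on [B, A] [unit_C 2, BA 0, BC 1] [BA 0, unit_C 1]"
    by (rule equal_on_step[OF BC.twist_unit_Y, where k = 1 and pre = "[BA 0]" and post = "[]"])
      (simp_all add: hom_iff)
  then show "outer_swap \<cdot> (\<i>\<d> B \<otimes>\<^sub>m CA.incl_Y) = (CA.incl_Y \<otimes>\<^sub>m \<i>\<d> B) \<cdot> \<xi>\<^sub>B\<^sub>A"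
    by (simp add: outer_swap_def CA.incl_Y_def equal_on_def whisker_def whisker_cmp)
qed

definition compatible_actions :: "'o \<Rightarrow> 'm \<Rightarrow> 'm \<Rightarrow> 'm \<Rightarrow> bool" where
  "compatible_actions M \<rho>\<^sub>B \<rho>\<^sub>C \<rho>\<^sub>A \<longleftrightarrow>
    right_module \<C> B \<mu>\<^sub>B \<nu>\<^sub>B M \<rho>\<^sub>B \<and> right_module \<C> C \<mu>\<^sub>C \<nu>\<^sub>C M \<rho>\<^sub>C \<and> right_module \<C> A \<mu>\<^sub>A \<nu>\<^sub>A M \<rho>\<^sub>A \<and>
    BC.compatible M \<rho>\<^sub>B \<rho>\<^sub>C \<and> BA.compatible M \<rho>\<^sub>B \<rho>\<^sub>A \<and> CA.compatible M \<rho>\<^sub>C \<rho>\<^sub>A"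

lemma outer_compatible:
  assumes "compatible_actions M \<rho>\<^sub>B \<rho>\<^sub>C \<rho>\<^sub>A"
  shows "outer.compatible M \<rho>\<^sub>B (CA.joint_action \<rho>\<^sub>C \<rho>\<^sub>A)"
proof -
  interpret MB: right_module \<C> B \<mu>\<^sub>B \<nu>\<^sub>B M \<rho>\<^sub>B using assms by (simp add: compatible_actions_def)
  interpret MC: right_module \<C> C \<mu>\<^sub>C \<nu>\<^sub>C M \<rho>\<^sub>C using assms by (simp add: compatible_actions_def)
  interpret MA: right_module \<C> A \<mu>\<^sub>A \<nu>\<^sub>A M \<rho>\<^sub>A using assms by (simp add: compatible_actions_def)
  have [simp]: "M \<in> Obj \<C>"
    "\<rho>\<^sub>B \<in> Arr \<C>" "src \<C> \<rho>\<^sub>B = M \<otimes>\<^sub>o B" "tgt \<C> \<rho>\<^sub>B = M"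
    "\<rho>\<^sub>C \<in> Arr \<C>" "src \<C> \<rho>\<^sub>C = M \<otimes>\<^sub>o C" "tgt \<C> \<rho>\<^sub>C = M"
    "\<rho>\<^sub>A \<in> Arr \<C>" "src \<C> \<rho>\<^sub>A = M \<otimes>\<^sub>o A" "tgt \<C> \<rho>\<^sub>A = M"
    using MB.rmod_Obj MB.ract_hom MC.ract_hom MA.ract_hom by (simp_all add: hom_iff)
  define act_B act_C act_A where
    [simp]: "act_B = Box 0 \<rho>\<^sub>B [M, B] [M]" "act_C = Box 0 \<rho>\<^sub>C [M, C] [M]" "act_A = Box 0 \<rho>\<^sub>A [M, A] [M]"
  have compat: "equal_on [M, B, C] [act_B, act_C] [BC 1, act_C, act_B]"
    "equal_on [M, B, A] [act_B, act_A] [BA 1, act_A, act_B]"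
    using assms
    by (simp_all add: compatible_actions_def BC.compatible_def BA.compatible_def equal_on_def
        whisker_def hom_iff)
  have "equal_on [M, B, A, C] [act_B, act_A, act_C] [BA 1, act_A, act_B, act_C]"
    by (rule equal_on_step[OF compat(2), where k = 0 and pre = "[]" and post = "[act_C]"])
      (simp_all add: hom_iff)
  also have "equal_on [M, B, A, C] \<dots> [BA 1, BC 2, act_A, act_C, act_B]"
    by (rule equal_on_step[OF compat(1), where k = 0 and pre = "[BA 1, act_A]" and post = "[]"])
      (simp_all add: hom_iff)
  finally show ?thesis
    unfolding outer.compatible_def
    by (simp add: CA.joint_action_def outer_swap_def equal_on_def whisker_def whisker_cmp)
qed

text \<open>\<open>m\<cdot>(a \<otimes> c \<otimes> b) = ((m\<cdot>a)\<cdot>c)\<cdot>b\<close>; the three definitions that follow recover the single actions by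
  restriction along the inclusions.\<close>
definition total_action :: "'m \<Rightarrow> 'm \<Rightarrow> 'm \<Rightarrow> 'm" where
  "total_action \<rho>\<^sub>B \<rho>\<^sub>C \<rho>\<^sub>A = outer.joint_action \<rho>\<^sub>B (CA.joint_action \<rho>\<^sub>C \<rho>\<^sub>A)"

definition "action_B M \<rho> = \<rho> \<cdot> (\<i>\<d> M \<otimes>\<^sub>m outer.incl_X)"
definition "action_C M \<rho> = (\<rho> \<cdot> (\<i>\<d> M \<otimes>\<^sub>m outer.incl_Y)) \<cdot> (\<i>\<d> M \<otimes>\<^sub>m CA.incl_X)"
definition "action_A M \<rho> = (\<rho> \<cdot> (\<i>\<d> M \<otimes>\<^sub>m outer.incl_Y)) \<cdot> (\<i>\<d> M \<otimes>\<^sub>m CA.incl_Y)"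

lemma total_action:
  assumes "compatible_actions M \<rho>\<^sub>B \<rho>\<^sub>C \<rho>\<^sub>A"
  shows "right_module \<C> (A \<otimes>\<^sub>o C \<otimes>\<^sub>o B) outer.twisted_mult outer.twisted_unit M (total_action \<rho>\<^sub>B \<rho>\<^sub>C \<rho>\<^sub>A)"
    and "action_B M (total_action \<rho>\<^sub>B \<rho>\<^sub>C \<rho>\<^sub>A) = \<rho>\<^sub>B"
    and "action_C M (total_action \<rho>\<^sub>B \<rho>\<^sub>C \<rho>\<^sub>A) = \<rho>\<^sub>C"
    and "action_A M (total_action \<rho>\<^sub>B \<rho>\<^sub>C \<rho>\<^sub>A) = \<rho>\<^sub>A"
proof -
  note parts = assms[unfolded compatible_actions_def]
  have CA: "right_module \<C> C \<mu>\<^sub>C \<nu>\<^sub>C M \<rho>\<^sub>C" "right_module \<C> A \<mu>\<^sub>A \<nu>\<^sub>A M \<rho>\<^sub>A" "CA.compatible M \<rho>\<^sub>C \<rho>\<^sub>A"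
    and B: "right_module \<C> B \<mu>\<^sub>B \<nu>\<^sub>B M \<rho>\<^sub>B"
    using parts by simp_all
  note outer = B CA.joint_action_module(1)[OF CA] outer_compatible[OF assms]
  show "right_module \<C> (A \<otimes>\<^sub>o C \<otimes>\<^sub>o B) outer.twisted_mult outer.twisted_unit M (total_action \<rho>\<^sub>B \<rho>\<^sub>C \<rho>\<^sub>A)"
    using outer.joint_action_module(1)[OF outer] by (simp add: total_action_def)
  show "action_B M (total_action \<rho>\<^sub>B \<rho>\<^sub>C \<rho>\<^sub>A) = \<rho>\<^sub>B"
    "action_C M (total_action \<rho>\<^sub>B \<rho>\<^sub>C \<rho>\<^sub>A) = \<rho>\<^sub>C"
    "action_A M (total_action \<rho>\<^sub>B \<rho>\<^sub>C \<rho>\<^sub>A) = \<rho>\<^sub>A"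
    unfolding total_action_def action_B_def action_C_def action_A_def
      outer.joint_action_module(2,3)[OF outer] CA.joint_action_module(2,3)[OF CA] by (rule refl)+
qed

lemma action_components:
  assumes "right_module \<C> (A \<otimes>\<^sub>o C \<otimes>\<^sub>o B) outer.twisted_mult outer.twisted_unit M \<rho>"
  shows "compatible_actions M (action_B M \<rho>) (action_C M \<rho>) (action_A M \<rho>)"
    and "total_action (action_B M \<rho>) (action_C M \<rho>) (action_A M \<rho>) = \<rho>"
proof -
  have "right_module \<C> ((A \<otimes>\<^sub>o C) \<otimes>\<^sub>o B) outer.twisted_mult outer.twisted_unit M \<rho>"
    using assms by simp
  note outer = outer.module_components[OF this]
  note CA = CA.module_components[OF outer(2)]
  have BC: "BC.compatible M (action_B M \<rho>) (action_C M \<rho>)"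
    using outer.compatible_restrict[OF outer(1-3) _ BC.swap_hom outer_swap_incl(1)]
    by (simp add: BC.compatible_def action_B_def action_C_def hom_iff)
  have BA: "BA.compatible M (action_B M \<rho>) (action_A M \<rho>)"
    using outer.compatible_restrict[OF outer(1-3) _ BA.swap_hom outer_swap_incl(2)]
    by (simp add: BA.compatible_def action_B_def action_A_def hom_iff)
  show "compatible_actions M (action_B M \<rho>) (action_C M \<rho>) (action_A M \<rho>)"
    using BC BA outer(1) CA(1-3)
    by (simp only: compatible_actions_def action_B_def action_C_def action_A_def simp_thms)
  show "total_action (action_B M \<rho>) (action_C M \<rho>) (action_A M \<rho>) = \<rho>"
    unfolding total_action_def action_B_def action_C_def action_A_def CA(4) outer(4) ..
qed

lemma linear_total_iff:
  assumes M: "compatible_actions M \<rho>\<^sub>B \<rho>\<^sub>C \<rho>\<^sub>A" and N: "compatible_actions N \<rho>\<^sub>B' \<rho>\<^sub>C' \<rho>\<^sub>A'"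
    and f: "f \<in> Hom M N"
  shows "f \<cdot> total_action \<rho>\<^sub>B \<rho>\<^sub>C \<rho>\<^sub>A = total_action \<rho>\<^sub>B' \<rho>\<^sub>C' \<rho>\<^sub>A' \<cdot> (f \<otimes>\<^sub>m \<i>\<d> (A \<otimes>\<^sub>o C \<otimes>\<^sub>o B)) \<longleftrightarrow>
    f \<cdot> \<rho>\<^sub>B = \<rho>\<^sub>B' \<cdot> (f \<otimes>\<^sub>m \<i>\<d> B) \<and> f \<cdot> \<rho>\<^sub>C = \<rho>\<^sub>C' \<cdot> (f \<otimes>\<^sub>m \<i>\<d> C) \<and> f \<cdot> \<rho>\<^sub>A = \<rho>\<^sub>A' \<cdot> (f \<otimes>\<^sub>m \<i>\<d> A)"
proof -
  have parts: "right_module \<C> B \<mu>\<^sub>B \<nu>\<^sub>B M \<rho>\<^sub>B" "right_module \<C> B \<mu>\<^sub>B \<nu>\<^sub>B N \<rho>\<^sub>B'"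
    "right_module \<C> C \<mu>\<^sub>C \<nu>\<^sub>C M \<rho>\<^sub>C" "right_module \<C> A \<mu>\<^sub>A \<nu>\<^sub>A M \<rho>\<^sub>A" "CA.compatible M \<rho>\<^sub>C \<rho>\<^sub>A"
    "right_module \<C> C \<mu>\<^sub>C \<nu>\<^sub>C N \<rho>\<^sub>C'" "right_module \<C> A \<mu>\<^sub>A \<nu>\<^sub>A N \<rho>\<^sub>A'" "CA.compatible N \<rho>\<^sub>C' \<rho>\<^sub>A'"
    using M N by (simp_all only: compatible_actions_def simp_thms)
  have "f \<cdot> total_action \<rho>\<^sub>B \<rho>\<^sub>C \<rho>\<^sub>A = total_action \<rho>\<^sub>B' \<rho>\<^sub>C' \<rho>\<^sub>A' \<cdot> (f \<otimes>\<^sub>m \<i>\<d> ((A \<otimes>\<^sub>o C) \<otimes>\<^sub>o B)) \<longleftrightarrow>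
      f \<cdot> \<rho>\<^sub>B = \<rho>\<^sub>B' \<cdot> (f \<otimes>\<^sub>m \<i>\<d> B) \<and>
      f \<cdot> CA.joint_action \<rho>\<^sub>C \<rho>\<^sub>A = CA.joint_action \<rho>\<^sub>C' \<rho>\<^sub>A' \<cdot> (f \<otimes>\<^sub>m \<i>\<d> (A \<otimes>\<^sub>o C))"
    unfolding total_action_def
    by (rule outer.linear_joint_iff[OF parts(1) CA.joint_action_module(1)[OF parts(3-5)]
          outer_compatible[OF M] parts(2) CA.joint_action_module(1)[OF parts(6-8)] outer_compatible[OF N] f])
  also have "f \<cdot> CA.joint_action \<rho>\<^sub>C \<rho>\<^sub>A = CA.joint_action \<rho>\<^sub>C' \<rho>\<^sub>A' \<cdot> (f \<otimes>\<^sub>m \<i>\<d> (A \<otimes>\<^sub>o C)) \<longleftrightarrow>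
      f \<cdot> \<rho>\<^sub>C = \<rho>\<^sub>C' \<cdot> (f \<otimes>\<^sub>m \<i>\<d> C) \<and> f \<cdot> \<rho>\<^sub>A = \<rho>\<^sub>A' \<cdot> (f \<otimes>\<^sub>m \<i>\<d> A)"
    by (rule CA.linear_joint_iff[OF parts(3-8) f])
  finally show ?thesis
    by simp
qed

end

section \<open>Categories of objects with additional structure\<close>

text \<open>Both categories of modules have this form, with \<open>L\<close> expressing linearity, so that axioms and equivalences can be treated once for all.\<close>
definition structured ::
  "('o, 'm, 'x) cat_scheme \<Rightarrow> ('o \<times> 's) set \<Rightarrow> ('o \<times> 's \<Rightarrow> 'o \<times> 's \<Rightarrow> 'm \<Rightarrow> bool) \<Rightarrow>
   ('o \<times> 's, ('o \<times> 's) \<times> ('o \<times> 's) \<times> 'm) cat" where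
  "structured \<C> S L = \<lparr>
    Obj = S,
    Arr = {(P, Q, f). P \<in> S \<and> Q \<in> S \<and> f \<in> Hom\<^bsub>\<C>\<^esub> (fst P) (fst Q) \<and> L P Q f},
    src = (\<lambda>(P, Q, f). P),
    tgt = (\<lambda>(P, Q, f). Q),
    idm = (\<lambda>P. (P, P, \<i>\<d>\<^bsub>\<C>\<^esub> (fst P))),
    cmp = (\<lambda>(P', Q', g) (P, Q, f). (P, Q', g \<cdot>\<^bsub>\<C>\<^esub> f)) \<rparr>"

lemma Mod_algebra_structured:
  "Mod_algebra \<C> A \<mu> \<nu> = structured \<C> {(M, \<rho>). right_module \<C> A \<mu> \<nu> M \<rho>}
    (\<lambda>P Q f. f \<cdot>\<^bsub>\<C>\<^esub> snd P = snd Q \<cdot>\<^bsub>\<C>\<^esub> (f \<otimes>\<^sub>m\<^bsub>\<C>\<^esub> \<i>\<d>\<^bsub>\<C>\<^esub> A))"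
  unfolding Mod_algebra_def structured_def by auto

lemma Mod_system_structured:
  "Mod_system \<C> r V \<sigma> \<nu> = structured \<C> {(M, \<rho>). system_module \<C> r V \<sigma> \<nu> M \<rho>}
    (\<lambda>P Q f. \<forall>i\<in>{1..r}. f \<cdot>\<^bsub>\<C>\<^esub> snd P i = snd Q i \<cdot>\<^bsub>\<C>\<^esub> (f \<otimes>\<^sub>m\<^bsub>\<C>\<^esub> \<i>\<d>\<^bsub>\<C>\<^esub> (V i)))"
  unfolding Mod_system_def structured_def by auto

context category
begin

lemma structured_hom:
  "a \<in> Hom\<^bsub>structured \<C> S L\<^esub> P Q \<longleftrightarrow>
    P \<in> S \<and> Q \<in> S \<and> (\<exists>f \<in> Hom (fst P) (fst Q). L P Q f \<and> a = (P, Q, f))"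
  by (auto simp: hom_set_def structured_def)

lemma structured_simps:
  "Obj (structured \<C> S L) = S" "idm (structured \<C> S L) P = (P, P, \<i>\<d> (fst P))"
  "cmp (structured \<C> S L) (P', R, g) (P, Q, f) = (P, R, g \<cdot> f)"
  by (simp_all add: structured_def)

lemma structured_category:
  assumes obj: "\<And>P. P \<in> S \<Longrightarrow> fst P \<in> Obj \<C>"
    and id: "\<And>P. P \<in> S \<Longrightarrow> L P P (\<i>\<d> (fst P))"
    and comp: "\<And>P Q R f g. \<lbrakk>P \<in> S; Q \<in> S; R \<in> S; f \<in> Hom (fst P) (fst Q); g \<in> Hom (fst Q) (fst R);
      L P Q f; L Q R g\<rbrakk> \<Longrightarrow> L P R (g \<cdot> f)"
  shows "category (structured \<C> S L)"
proof
  fix a assume "a \<in> Arr (structured \<C> S L)"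
  then show "src (structured \<C> S L) a \<in> Obj (structured \<C> S L)"
    and "tgt (structured \<C> S L) a \<in> Obj (structured \<C> S L)"
    by (auto simp: structured_def)
qed (auto simp: structured_hom structured_simps obj id comp id_hom cmp_hom cmp_id id_cmp cmp_assoc
    intro: comp)

lemma structured_functor:
  assumes maps: "\<And>P. P \<in> S \<Longrightarrow> \<phi> P \<in> T" and base: "\<And>P. P \<in> S \<Longrightarrow> fst (\<phi> P) = fst P"
    and arrows: "\<And>P Q f. \<lbrakk>P \<in> S; Q \<in> S; f \<in> Hom (fst P) (fst Q); L P Q f\<rbrakk> \<Longrightarrow> L' (\<phi> P) (\<phi> Q) f"
  shows "is_functor (structured \<C> S L) (structured \<C> T L') \<phi> (\<lambda>(P, Q, f). (\<phi> P, \<phi> Q, f))"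
  unfolding is_functor_def
proof (intro conjI allI ballI)
  show "\<phi> ` Obj (structured \<C> S L) \<subseteq> Obj (structured \<C> T L')"
    using maps by (auto simp: structured_simps)
next
  fix P Q a assume "a \<in> Hom\<^bsub>structured \<C> S L\<^esub> P Q"
  then obtain f where "P \<in> S" "Q \<in> S" "f \<in> Hom (fst P) (fst Q)" "L P Q f" "a = (P, Q, f)"
    by (auto simp: structured_hom)
  then show "(case a of (P, Q, f) \<Rightarrow> (\<phi> P, \<phi> Q, f)) \<in> Hom\<^bsub>structured \<C> T L'\<^esub> (\<phi> P) (\<phi> Q)"
    using maps arrows by (simp add: structured_hom base)
next
  fix P assume "P \<in> Obj (structured \<C> S L)"
  then show "(case \<i>\<d>\<^bsub>structured \<C> S L\<^esub> P of (P, Q, f) \<Rightarrow> (\<phi> P, \<phi> Q, f)) = \<i>\<d>\<^bsub>structured \<C> T L'\<^esub> (\<phi> P)"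
    by (simp add: structured_simps base)
next
  fix P Q R a b assume "a \<in> Hom\<^bsub>structured \<C> S L\<^esub> P Q" "b \<in> Hom\<^bsub>structured \<C> S L\<^esub> Q R"
  then show "(case b \<cdot>\<^bsub>structured \<C> S L\<^esub> a of (P, Q, f) \<Rightarrow> (\<phi> P, \<phi> Q, f)) =
    (case b of (P, Q, f) \<Rightarrow> (\<phi> P, \<phi> Q, f)) \<cdot>\<^bsub>structured \<C> T L'\<^esub> (case a of (P, Q, f) \<Rightarrow> (\<phi> P, \<phi> Q, f))"
    by (auto simp: structured_hom structured_simps)
qed

lemma structured_identity_natural_iso:
  assumes cat: "category (structured \<C> S L)" and obj: "\<And>P. P \<in> S \<Longrightarrow> fst P \<in> Obj \<C>"
    and F: "\<And>P. P \<in> S \<Longrightarrow> F\<^sub>o P = P" "\<And>P Q f. P \<in> S \<Longrightarrow> Q \<in> S \<Longrightarrow> F\<^sub>m (P, Q, f) = (P, Q, f)"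
    and G: "\<And>P. P \<in> S \<Longrightarrow> G\<^sub>o P = P" "\<And>P Q f. P \<in> S \<Longrightarrow> Q \<in> S \<Longrightarrow> G\<^sub>m (P, Q, f) = (P, Q, f)"
  shows "natural_iso (structured \<C> S L) (structured \<C> S L) F\<^sub>o F\<^sub>m G\<^sub>o G\<^sub>m (\<lambda>P. (P, P, \<i>\<d> (fst P)))"
  unfolding natural_iso_def
proof (intro conjI allI ballI)
  fix P assume "P \<in> Obj (structured \<C> S L)"
  then have P: "P \<in> S" "(P, P, \<i>\<d> (fst P)) \<in> Hom\<^bsub>structured \<C> S L\<^esub> P P"
    using category.id_hom[OF cat, of P] by (simp_all add: structured_simps)
  then show "is_iso (structured \<C> S L) (F\<^sub>o P) (G\<^sub>o P) (P, P, \<i>\<d> (fst P))"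
    unfolding is_iso_def F(1)[OF P(1)] G(1)[OF P(1)]
    by (intro conjI bexI[where x = "(P, P, \<i>\<d> (fst P))"]) (simp_all add: structured_simps obj)
next
  fix P Q a assume "a \<in> Hom\<^bsub>structured \<C> S L\<^esub> P Q"
  then obtain f where f: "P \<in> S" "Q \<in> S" "f \<in> Hom (fst P) (fst Q)" "a = (P, Q, f)"
    by (auto simp: structured_hom)
  then show "(Q, Q, \<i>\<d> (fst Q)) \<cdot>\<^bsub>structured \<C> S L\<^esub> F\<^sub>m a = G\<^sub>m a \<cdot>\<^bsub>structured \<C> S L\<^esub> (P, P, \<i>\<d> (fst P))"
    by (simp add: structured_simps F G cmp_id[OF f(3)] id_cmp[OF f(3)])
qed

text \<open>A bijection of structures over the identity of \<open>\<C>\<close> that respects the predicate on morphisms in both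
  directions is an isomorphism of categories, and the unit and counit of the equivalence are identities.\<close>
lemma structured_equivalence:
  assumes cat: "category (structured \<C> S L)" "category (structured \<C> T L')"
    and obj: "\<And>P. P \<in> S \<Longrightarrow> fst P \<in> Obj \<C>" "\<And>P. P \<in> T \<Longrightarrow> fst P \<in> Obj \<C>"
    and maps: "\<And>P. P \<in> S \<Longrightarrow> \<phi> P \<in> T" "\<And>P. P \<in> T \<Longrightarrow> \<psi> P \<in> S"
    and base: "\<And>P. P \<in> S \<Longrightarrow> fst (\<phi> P) = fst P"
    and inverse: "\<And>P. P \<in> S \<Longrightarrow> \<psi> (\<phi> P) = P" "\<And>P. P \<in> T \<Longrightarrow> \<phi> (\<psi> P) = P"
    and arrows: "\<And>P Q f. \<lbrakk>P \<in> S; Q \<in> S; f \<in> Hom (fst P) (fst Q)\<rbrakk> \<Longrightarrow> L' (\<phi> P) (\<phi> Q) f \<longleftrightarrow> L P Q f"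
  shows "equivalent_categories (structured \<C> S L) (structured \<C> T L')"
proof -
  have base': "fst (\<psi> P) = fst P" if "P \<in> T" for P
    using base[OF maps(2)[OF that]] inverse(2)[OF that] by simp
  have arrows': "L (\<psi> P) (\<psi> Q) f \<longleftrightarrow> L' P Q f" if "P \<in> T" "Q \<in> T" "f \<in> Hom (fst P) (fst Q)" for P Q f
    using arrows[of "\<psi> P" "\<psi> Q" f] that by (simp add: maps base' inverse)
  let ?F = "\<lambda>(P, Q, f). (\<phi> P, \<phi> Q, f)" and ?G = "\<lambda>(P, Q, f). (\<psi> P, \<psi> Q, f)"
  let ?\<eta> = "\<lambda>P. (P, P, \<i>\<d> (fst P))"
  have "is_functor (structured \<C> S L) (structured \<C> T L') \<phi> ?F"
    by (rule structured_functor) (simp_all add: maps base arrows)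
  moreover have "is_functor (structured \<C> T L') (structured \<C> S L) \<psi> ?G"
    by (rule structured_functor) (simp_all add: maps base' arrows')
  moreover have "natural_iso (structured \<C> S L) (structured \<C> S L) (\<lambda>P. P) (\<lambda>a. a) (\<psi> \<circ> \<phi>) (?G \<circ> ?F) ?\<eta>"
    by (rule structured_identity_natural_iso[OF cat(1) obj(1)]) (simp_all add: inverse)
  moreover have "natural_iso (structured \<C> T L') (structured \<C> T L') (\<phi> \<circ> \<psi>) (?F \<circ> ?G) (\<lambda>P. P) (\<lambda>a. a) ?\<eta>"
    by (rule structured_identity_natural_iso[OF cat(2) obj(2)]) (simp_all add: inverse)
  ultimately show ?thesis
    unfolding equivalent_categories_def using cat by blast
qed

end

lemma (in strict_monoidal_category) linear_id:
  assumes "\<rho> \<in> Hom (M \<otimes>\<^sub>o X) M" "M \<in> Obj \<C>" "X \<in> Obj \<C>"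
  shows "\<i>\<d> M \<cdot> \<rho> = \<rho> \<cdot> (\<i>\<d> M \<otimes>\<^sub>m \<i>\<d> X)"
  using assms by (simp add: hom_iff)

lemma (in strict_monoidal_category) linear_comp:
  assumes \<rho>: "\<rho> \<in> Hom (M \<otimes>\<^sub>o X) M" "\<rho>' \<in> Hom (N \<otimes>\<^sub>o X) N" "\<rho>'' \<in> Hom (K \<otimes>\<^sub>o X) K"
    and X: "X \<in> Obj \<C>" and fg: "f \<in> Hom M N" "g \<in> Hom N K"
    and f: "f \<cdot> \<rho> = \<rho>' \<cdot> (f \<otimes>\<^sub>m \<i>\<d> X)" and g: "g \<cdot> \<rho>' = \<rho>'' \<cdot> (g \<otimes>\<^sub>m \<i>\<d> X)"
  shows "(g \<cdot> f) \<cdot> \<rho> = \<rho>'' \<cdot> ((g \<cdot> f) \<otimes>\<^sub>m \<i>\<d> X)"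
proof -
  have [simp]: "\<rho> \<in> Arr \<C>" "src \<C> \<rho> = M \<otimes>\<^sub>o X" "tgt \<C> \<rho> = M" "\<rho>' \<in> Arr \<C>" "src \<C> \<rho>' = N \<otimes>\<^sub>o X"
    "tgt \<C> \<rho>' = N" "\<rho>'' \<in> Arr \<C>" "src \<C> \<rho>'' = K \<otimes>\<^sub>o X" "tgt \<C> \<rho>'' = K"
    "f \<in> Arr \<C>" "src \<C> f = M" "tgt \<C> f = N" "g \<in> Arr \<C>" "src \<C> g = N" "tgt \<C> g = K" "X \<in> Obj \<C>"
    using assms by (simp_all add: hom_iff)
  have "(g \<cdot> f) \<cdot> \<rho> = (g \<cdot> \<rho>') \<cdot> (f \<otimes>\<^sub>m \<i>\<d> X)"
    using f by simp
  also have "\<dots> = \<rho>'' \<cdot> ((g \<cdot> f) \<otimes>\<^sub>m \<i>\<d> X)"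
    unfolding g by (simp add: whisker_cmp)
  finally show ?thesis .
qed

lemma (in unital_algebra) Mod_algebra_category: "category (Mod_algebra \<C> A \<mu> \<nu>)"
  unfolding Mod_algebra_structured
  using alg_Obj
  by (intro structured_category)
    (auto simp: right_module_def right_module_axioms_def intro!: linear_id intro: linear_comp)

lemma (in braided_system) Mod_system_category: "category (Mod_system \<C> r V \<sigma> \<nu>)"
  unfolding Mod_system_structured
proof (intro structured_category; clarsimp)
  fix M \<rho> assume "system_module \<C> r V \<sigma> \<nu> M \<rho>"
  then interpret system_module \<C> r V \<sigma> \<nu> M \<rho> .
  show "M \<in> Obj \<C>" by (rule smod_Obj)
  fix i assume "Suc 0 \<le> i" "i \<le> r"
  then show "\<i>\<d> M \<cdot> \<rho> i = \<rho> i \<cdot> (\<i>\<d> M \<otimes>\<^sub>m \<i>\<d> (V i))"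
    using \<rho>_hom smod_Obj V_Obj by (intro linear_id) auto
next
  fix M \<rho> N \<rho>' K \<rho>'' f g i
  assume M: "system_module \<C> r V \<sigma> \<nu> M \<rho>" and N: "system_module \<C> r V \<sigma> \<nu> N \<rho>'"
    and K: "system_module \<C> r V \<sigma> \<nu> K \<rho>''" and i: "Suc 0 \<le> i" "i \<le> r"
    and hom: "f \<in> Hom M N" "g \<in> Hom N K"
    and lin: "\<forall>i\<in>{Suc 0..r}. f \<cdot> \<rho> i = \<rho>' i \<cdot> (f \<otimes>\<^sub>m \<i>\<d> (V i))"
      "\<forall>i\<in>{Suc 0..r}. g \<cdot> \<rho>' i = \<rho>'' i \<cdot> (g \<otimes>\<^sub>m \<i>\<d> (V i))"
  show "(g \<cdot> f) \<cdot> \<rho> i = \<rho>'' i \<cdot> ((g \<cdot> f) \<otimes>\<^sub>m \<i>\<d> (V i))"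
    using system_module.\<rho>_hom[OF M] system_module.\<rho>_hom[OF N] system_module.\<rho>_hom[OF K] lin hom i V_Obj[of i]
    by (intro linear_comp[where \<rho>' = "\<rho>' i" and M = M and N = N and K = K]) auto
qed

section \<open>Braided systems of three algebras and their modules\<close>

locale braided_triple_family = braided_triple +
  fixes V :: "nat \<Rightarrow> 'a" and mult unit :: "nat \<Rightarrow> 'b" and \<xi> :: "nat \<Rightarrow> nat \<Rightarrow> 'b"
  assumes V: "V 1 = B" "V 2 = C" "V 3 = A"
    and mult: "mult 1 = \<mu>\<^sub>B" "mult 2 = \<mu>\<^sub>C" "mult 3 = \<mu>\<^sub>A"
    and unit: "unit 1 = \<nu>\<^sub>B" "unit 2 = \<nu>\<^sub>C" "unit 3 = \<nu>\<^sub>A"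
    and \<xi>: "\<xi> 1 2 = \<xi>\<^sub>B\<^sub>C" "\<xi> 1 3 = \<xi>\<^sub>B\<^sub>A" "\<xi> 2 3 = \<xi>\<^sub>C\<^sub>A"
begin

abbreviation "\<sigma> \<equiv> completed \<C> mult unit \<xi>"

text \<open>Here and below \<open>One_nat_def\<close> is kept out of the simplifier, since the values of the families are stated
  at the index \<open>1\<close> and would not be found at \<open>Suc 0\<close>.\<close>
lemma \<sigma>_values:
  "\<sigma> 1 1 = \<nu>\<^sub>B \<otimes>\<^sub>m \<mu>\<^sub>B" "\<sigma> 2 2 = \<nu>\<^sub>C \<otimes>\<^sub>m \<mu>\<^sub>C" "\<sigma> 3 3 = \<nu>\<^sub>A \<otimes>\<^sub>m \<mu>\<^sub>A"
  "\<sigma> 1 2 = \<xi>\<^sub>B\<^sub>C" "\<sigma> 1 3 = \<xi>\<^sub>B\<^sub>A" "\<sigma> 2 3 = \<xi>\<^sub>C\<^sub>A"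
  by (simp_all add: completed_def mult unit \<xi> del: One_nat_def)

lemma index_cases: "1 \<le> i \<Longrightarrow> i \<le> 3 \<Longrightarrow> i = 1 \<or> i = 2 \<or> i = (3 :: nat)"
  by linarith

lemma index_pair_cases:
  "1 \<le> i \<Longrightarrow> i \<le> j \<Longrightarrow> j \<le> 3 \<Longrightarrow> i = 1 \<and> j = 1 \<or> i = 2 \<and> j = 2 \<or> i = 3 \<and> j = 3 \<or>
    i = 1 \<and> j = 2 \<or> i = 1 \<and> j = 3 \<or> i = 2 \<and> j = (3 :: nat)"
  by linarith

lemma index_triple_cases:
  assumes "1 \<le> i" "i \<le> j" "j \<le> k" "k \<le> (3 :: nat)"
  shows "(i, j, k) \<in> {(1, 1, 1), (2, 2, 2), (3, 3, 3), (1, 1, 2), (1, 2, 2), (1, 1, 3), (1, 3, 3),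
    (2, 2, 3), (2, 3, 3), (1, 2, 3)}"
proof -
  have "i = 1 \<or> i = 2 \<or> i = 3" "j = 1 \<or> j = 2 \<or> j = 3" "k = 1 \<or> k = 2 \<or> k = 3"
    using assms by linarith+
  then show ?thesis
    using assms by (elim disjE; simp)
qed

text \<open>Of the ten Yang-Baxter equations, the three with equal indices are associativity, the six with
  two equal indices come from the distributive laws, and the remaining one is assumed.\<close>
lemma braided_system_of_triple: "braided_system_of_algebras \<C> 3 V mult unit \<xi>"
proof (intro braided_system_of_algebras.intro braided_system.intro braided_system_axioms.intro
    braided_system_of_algebras_axioms.intro strict_monoidal_category_axioms)
  fix i :: nat assume "1 \<le> i" "i \<le> 3"
  then have i: "i = 1 \<or> i = 2 \<or> i = 3" by (rule index_cases)
  then show "V i \<in> Obj \<C>"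
    by (auto simp: V simp del: One_nat_def)
  from i show "unital_algebra \<C> (V i) (mult i) (unit i)"
    by (auto simp: V mult unit BC.X.unital_algebra_axioms BC.Y.unital_algebra_axioms
        BA.Y.unital_algebra_axioms simp del: One_nat_def)
next
  fix i j :: nat assume "1 \<le> i" "i \<le> j" "j \<le> 3"
  from index_pair_cases[OF this]
  show "\<sigma> i j \<in> Hom (V i \<otimes>\<^sub>o V j) (V j \<otimes>\<^sub>o V i)"
    by (elim disjE conjE; simp only: V \<sigma>_values; simp add: hom_iff)
next
  fix i j k :: nat assume "1 \<le> i" "i \<le> j" "j \<le> k" "k \<le> 3"
  from index_triple_cases[OF this]
  show "(\<sigma> j k \<otimes>\<^sub>m \<i>\<d> (V i)) \<cdot> (\<i>\<d> (V j) \<otimes>\<^sub>m \<sigma> i k) \<cdot> (\<sigma> i j \<otimes>\<^sub>m \<i>\<d> (V k)) =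
      (\<i>\<d> (V k) \<otimes>\<^sub>m \<sigma> i j) \<cdot> (\<sigma> i k \<otimes>\<^sub>m \<i>\<d> (V j)) \<cdot> (\<i>\<d> (V i) \<otimes>\<^sub>m \<sigma> j k)"
    by (elim insertE emptyE Pair_inject;
      simp only: V \<sigma>_values BC.X.multiplication_swap_yang_baxter
        BC.Y.multiplication_swap_yang_baxter BA.Y.multiplication_swap_yang_baxter
        BC.yang_baxter_XXY BC.yang_baxter_XYY BA.yang_baxter_XXY BA.yang_baxter_XYY
        CA.yang_baxter_XXY CA.yang_baxter_XYY yang_baxter_BCA)
next
  fix i j :: nat assume "1 \<le> i" "i < j" "j \<le> 3"
  then have ij: "i = 1 \<and> j = 2 \<or> i = 1 \<and> j = 3 \<or> i = 2 \<and> j = 3"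
    by linarith
  then show "\<xi> i j \<cdot> (unit i \<otimes>\<^sub>m \<i>\<d> (V j)) = \<i>\<d> (V j) \<otimes>\<^sub>m unit i"
    by (auto simp: V unit \<xi> BC.swap_unit_left BA.swap_unit_left CA.swap_unit_left simp del: One_nat_def)
  from ij show "\<xi> i j \<cdot> (\<i>\<d> (V i) \<otimes>\<^sub>m unit j) = unit j \<otimes>\<^sub>m \<i>\<d> (V i)"
    by (auto simp: V unit \<xi> BC.swap_unit_right BA.swap_unit_right CA.swap_unit_right simp del: One_nat_def)
qed

lemma pointed: "pointed_braided_system \<C> 3 V \<sigma> unit"
proof -
  interpret braided_system_of_algebras \<C> 3 V mult unit \<xi>
    by (rule braided_system_of_triple)
  show ?thesis
    by unfold_locales (rule unital_algebra.unit_hom[OF V_algebra])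
qed

lemma all_indices: "(\<forall>i\<in>{1..3}. P i) \<longleftrightarrow> P 1 \<and> P 2 \<and> P (3 :: nat)"
proof -
  have "{1..3} = {1, 2, 3 :: nat}"
    by auto
  then show ?thesis
    by simp
qed

text \<open>The conditions with \<open>i = j\<close> say that each component is a module, those with \<open>i < j\<close> are the three
  compatibilities.\<close>
lemma system_module_iff:
  "system_module \<C> 3 V \<sigma> unit M \<rho> \<longleftrightarrow>
    \<rho> \<in> extensional {1..3} \<and> compatible_actions M (\<rho> 1) (\<rho> 2) (\<rho> 3)"
proof
  assume "system_module \<C> 3 V \<sigma> unit M \<rho>"
  then interpret system_module \<C> 3 V \<sigma> unit M \<rho> .
  have hom: "\<rho> 1 \<in> Hom (M \<otimes>\<^sub>o B) M" "\<rho> 2 \<in> Hom (M \<otimes>\<^sub>o C) M" "\<rho> 3 \<in> Hom (M \<otimes>\<^sub>o A) M"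
    using PiE_mem[OF \<rho>_hom, of 1] PiE_mem[OF \<rho>_hom, of 2] PiE_mem[OF \<rho>_hom, of 3]
    by (simp_all add: V del: One_nat_def)
  have unit: "\<rho> 1 \<cdot> (\<i>\<d> M \<otimes>\<^sub>m \<nu>\<^sub>B) = \<i>\<d> M" "\<rho> 2 \<cdot> (\<i>\<d> M \<otimes>\<^sub>m \<nu>\<^sub>C) = \<i>\<d> M" "\<rho> 3 \<cdot> (\<i>\<d> M \<otimes>\<^sub>m \<nu>\<^sub>A) = \<i>\<d> M"
    using \<rho>_\<nu>[of 1] \<rho>_\<nu>[of 2] \<rho>_\<nu>[of 3] by (simp_all add: unit del: One_nat_def)
  show "\<rho> \<in> extensional {1..3} \<and> compatible_actions M (\<rho> 1) (\<rho> 2) (\<rho> 3)"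
    using \<rho>_\<sigma>[of 1 1] \<rho>_\<sigma>[of 2 2] \<rho>_\<sigma>[of 3 3] \<rho>_\<sigma>[of 1 2] \<rho>_\<sigma>[of 1 3] \<rho>_\<sigma>[of 2 3]
      BC.X.module_iff_swap_invariant[OF smod_Obj hom(1) unit(1)]
      BC.Y.module_iff_swap_invariant[OF smod_Obj hom(2) unit(2)]
      BA.Y.module_iff_swap_invariant[OF smod_Obj hom(3) unit(3)] \<rho>_hom
    by (simp add: V \<sigma>_values compatible_actions_def BC.compatible_def BA.compatible_def
        CA.compatible_def PiE_def del: One_nat_def)
next
  assume R: "\<rho> \<in> extensional {1..3} \<and> compatible_actions M (\<rho> 1) (\<rho> 2) (\<rho> 3)"
  then have modules: "right_module \<C> B \<mu>\<^sub>B \<nu>\<^sub>B M (\<rho> 1)" "right_module \<C> C \<mu>\<^sub>C \<nu>\<^sub>C M (\<rho> 2)" "right_module \<C> A \<mu>\<^sub>A \<nu>\<^sub>A M (\<rho> 3)"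
    by (simp_all only: compatible_actions_def simp_thms)
  interpret MB: right_module \<C> B \<mu>\<^sub>B \<nu>\<^sub>B M "\<rho> 1" by (rule modules)
  interpret MC: right_module \<C> C \<mu>\<^sub>C \<nu>\<^sub>C M "\<rho> 2" by (rule modules)
  interpret MA: right_module \<C> A \<mu>\<^sub>A \<nu>\<^sub>A M "\<rho> 3" by (rule modules)
  interpret pointed_braided_system \<C> 3 V \<sigma> unit
    by (rule pointed)
  show "system_module \<C> 3 V \<sigma> unit M \<rho>"
  proof
    show "M \<in> Obj \<C>"
      by (rule MB.rmod_Obj)
    have "\<forall>i\<in>{1..3}. \<rho> i \<in> Hom (M \<otimes>\<^sub>o V i) M"
      unfolding all_indices V using MB.ract_hom MC.ract_hom MA.ract_hom by blast
    then show "\<rho> \<in> (\<Pi>\<^sub>E i\<in>{1..3}. Hom (M \<otimes>\<^sub>o V i) M)"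
      using R by (simp add: PiE_def Pi_def)
  next
    fix i j :: nat assume "1 \<le> i" "i \<le> j" "j \<le> 3"
    from index_pair_cases[OF this]
    show "\<rho> j \<cdot> (\<rho> i \<otimes>\<^sub>m \<i>\<d> (V j)) = \<rho> i \<cdot> (\<rho> j \<otimes>\<^sub>m \<i>\<d> (V i)) \<cdot> (\<i>\<d> M \<otimes>\<^sub>m \<sigma> i j)"
    proof (elim disjE conjE; simp only: V \<sigma>_values)
      show "\<rho> 1 \<cdot> (\<rho> 1 \<otimes>\<^sub>m \<i>\<d> B) = \<rho> 1 \<cdot> (\<rho> 1 \<otimes>\<^sub>m \<i>\<d> B) \<cdot> (\<i>\<d> M \<otimes>\<^sub>m \<nu>\<^sub>B \<otimes>\<^sub>m \<mu>\<^sub>B)"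
        using BC.X.module_iff_swap_invariant[OF MB.rmod_Obj MB.ract_hom MB.ract_unit] modules by blast
      show "\<rho> 2 \<cdot> (\<rho> 2 \<otimes>\<^sub>m \<i>\<d> C) = \<rho> 2 \<cdot> (\<rho> 2 \<otimes>\<^sub>m \<i>\<d> C) \<cdot> (\<i>\<d> M \<otimes>\<^sub>m \<nu>\<^sub>C \<otimes>\<^sub>m \<mu>\<^sub>C)"
        using BC.Y.module_iff_swap_invariant[OF MC.rmod_Obj MC.ract_hom MC.ract_unit] modules by blast
      show "\<rho> 3 \<cdot> (\<rho> 3 \<otimes>\<^sub>m \<i>\<d> A) = \<rho> 3 \<cdot> (\<rho> 3 \<otimes>\<^sub>m \<i>\<d> A) \<cdot> (\<i>\<d> M \<otimes>\<^sub>m \<nu>\<^sub>A \<otimes>\<^sub>m \<mu>\<^sub>A)"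
        using BA.Y.module_iff_swap_invariant[OF MA.rmod_Obj MA.ract_hom MA.ract_unit] modules by blast
    qed (use R in \<open>simp_all only: compatible_actions_def BC.compatible_def BA.compatible_def
        CA.compatible_def simp_thms\<close>)
  next
    fix i :: nat assume "1 \<le> i" "i \<le> 3"
    from index_cases[OF this] show "\<rho> i \<cdot> (\<i>\<d> M \<otimes>\<^sub>m unit i) = \<i>\<d> M"
      using MB.ract_unit MC.ract_unit MA.ract_unit by (auto simp: unit simp del: One_nat_def)
  qed
qed

definition total_module :: "'a \<times> (nat \<Rightarrow> 'b) \<Rightarrow> 'a \<times> 'b" where
  "total_module P = (fst P, total_action (snd P 1) (snd P 2) (snd P 3))"

text \<open>The actions are undefined outside \<open>{1..3}\<close> because a module over a braided system is an extensional
  family.\<close>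
definition component_modules :: "'a \<times> 'b \<Rightarrow> 'a \<times> (nat \<Rightarrow> 'b)" where
  "component_modules P = (fst P, restrict
    (\<lambda>i. if i = 1 then action_B (fst P) (snd P) else if i = 2 then action_C (fst P) (snd P)
      else action_A (fst P) (snd P)) {1..3})"

lemma modules_equivalent:
  "equivalent_categories (Mod_system \<C> 3 V \<sigma> unit)
    (Mod_algebra \<C> (A \<otimes>\<^sub>o C \<otimes>\<^sub>o B) outer.twisted_mult outer.twisted_unit)"
proof -
  have system: "category (Mod_system \<C> 3 V \<sigma> unit)"
    using braided_system.Mod_system_category braided_system_of_triple
    unfolding braided_system_of_algebras_def by blast
  have algebra: "category (Mod_algebra \<C> (A \<otimes>\<^sub>o C \<otimes>\<^sub>o B) outer.twisted_mult outer.twisted_unit)"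
    using unital_algebra.Mod_algebra_category[OF outer.twisted_algebra] by simp
  have component_values: "snd (component_modules P) 1 = action_B (fst P) (snd P)"
    "snd (component_modules P) 2 = action_C (fst P) (snd P)"
    "snd (component_modules P) 3 = action_A (fst P) (snd P)" for P
    by (simp_all add: component_modules_def)
  show ?thesis
    using system algebra unfolding Mod_system_structured Mod_algebra_structured
  proof (rule structured_equivalence[where \<phi> = total_module and \<psi> = component_modules])
    fix P assume P: "P \<in> {(M, \<rho>). system_module \<C> 3 V \<sigma> unit M \<rho>}"
    then have comp: "compatible_actions (fst P) (snd P 1) (snd P 2) (snd P 3)"
      and ext: "snd P \<in> extensional {1..3}"
      by (auto simp: system_module_iff)
    show "fst P \<in> Obj \<C>"
      using P system_module.smod_Obj by auto
    show "total_module P \<in> {(M, \<rho>). right_module \<C> (A \<otimes>\<^sub>o C \<otimes>\<^sub>o B) outer.twisted_mult outer.twisted_unit M \<rho>}"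
      using total_action(1)[OF comp] by (simp add: total_module_def)
    show "fst (total_module P) = fst P"
      by (simp add: total_module_def)
    have "snd (component_modules (total_module P)) i = snd P i" for i
    proof (cases "i \<in> {1..3}")
      case True
      then have "i = 1 \<or> i = 2 \<or> i = 3" by auto
      then show ?thesis
        by (elim disjE) (simp_all only: component_values, simp_all only: total_module_def fst_conv
            snd_conv total_action(2-4)[OF comp])
    next
      case False
      then show ?thesis
        using extensional_arb[OF ext False] by (simp only: component_modules_def snd_conv restrict_def if_False)
    qed
    moreover have "fst (component_modules (total_module P)) = fst P"
      by (simp add: component_modules_def total_module_def)
    ultimately show "component_modules (total_module P) = P"
      by (intro prod_eqI HOL.ext)
  next
    fix P assume P: "P \<in> {(M, \<rho>). right_module \<C> (A \<otimes>\<^sub>o C \<otimes>\<^sub>o B) outer.twisted_mult outer.twisted_unit M \<rho>}"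
    then have mod: "right_module \<C> (A \<otimes>\<^sub>o C \<otimes>\<^sub>o B) outer.twisted_mult outer.twisted_unit (fst P) (snd P)"
      by auto
    show "fst P \<in> Obj \<C>"
      using mod by (rule right_module.rmod_Obj)
    have "system_module \<C> 3 V \<sigma> unit (fst (component_modules P)) (snd (component_modules P))"
      unfolding system_module_iff component_values using action_components(1)[OF mod]
      by (simp add: component_modules_def)
    then show "component_modules P \<in> {(M, \<rho>). system_module \<C> 3 V \<sigma> unit M \<rho>}"
      by (simp add: case_prod_beta)
    show "total_module (component_modules P) = P"
      unfolding total_module_def component_values action_components(2)[OF mod]
      by (simp add: component_modules_def)
  next
    fix P Q f
    assume P: "P \<in> {(M, \<rho>). system_module \<C> 3 V \<sigma> unit M \<rho>}"
      and Q: "Q \<in> {(M, \<rho>). system_module \<C> 3 V \<sigma> unit M \<rho>}" and f: "f \<in> Hom (fst P) (fst Q)"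
    then have "compatible_actions (fst P) (snd P 1) (snd P 2) (snd P 3)"
      "compatible_actions (fst Q) (snd Q 1) (snd Q 2) (snd Q 3)"
      by (auto simp: system_module_iff)
    from linear_total_iff[OF this f]
    show "f \<cdot> snd (total_module P) = snd (total_module Q) \<cdot> (f \<otimes>\<^sub>m \<i>\<d> (A \<otimes>\<^sub>o C \<otimes>\<^sub>o B)) \<longleftrightarrow>
        (\<forall>i\<in>{1..3}. f \<cdot> snd P i = snd Q i \<cdot> (f \<otimes>\<^sub>m \<i>\<d> (V i)))"
      unfolding all_indices V by (simp add: total_module_def del: One_nat_def)
  qed
qed

end

section \<open>Bicomodule algebras\<close>

theorem proposition5p2:
  fixes \<C> :: "('o, 'm, 'x) symcat_scheme" (structure)
    and H A B C :: 'o
    and \<mu>\<^sub>H \<nu>\<^sub>H \<Delta> \<epsilon> \<mu>\<^sub>A \<nu>\<^sub>A lam \<mu>\<^sub>B \<nu>\<^sub>B \<rho> \<mu>\<^sub>C \<nu>\<^sub>C \<delta>\<^sub>l \<delta>\<^sub>r :: 'm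
    and V :: "nat \<Rightarrow> 'o" and mult unit :: "nat \<Rightarrow> 'm" and \<xi> :: "nat \<Rightarrow> nat \<Rightarrow> 'm"
    and \<mu> \<nu> :: 'm
  assumes "strict_symmetric_monoidal_category \<C>"
    and "bialgebra \<C> H \<mu>\<^sub>H \<nu>\<^sub>H \<Delta> \<epsilon>"
    and "left_module_algebra \<C> H \<mu>\<^sub>H \<nu>\<^sub>H \<Delta> \<epsilon> A \<mu>\<^sub>A \<nu>\<^sub>A lam"
    and "right_module_algebra \<C> H \<mu>\<^sub>H \<nu>\<^sub>H \<Delta> \<epsilon> B \<mu>\<^sub>B \<nu>\<^sub>B \<rho>"
    and "bicomodule_algebra \<C> H \<mu>\<^sub>H \<nu>\<^sub>H \<Delta> \<epsilon> C \<mu>\<^sub>C \<nu>\<^sub>C \<delta>\<^sub>l \<delta>\<^sub>r"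
    and "V 1 = B" "V 2 = C" "V 3 = A"
    and "mult 1 = \<mu>\<^sub>B" "mult 2 = \<mu>\<^sub>C" "mult 3 = \<mu>\<^sub>A"
    and "unit 1 = \<nu>\<^sub>B" "unit 2 = \<nu>\<^sub>C" "unit 3 = \<nu>\<^sub>A"
    and "\<xi> 1 2 = (\<i>\<d> C \<otimes>\<^sub>m \<rho>) \<cdot> (\<c> B C \<otimes>\<^sub>m \<i>\<d> H) \<cdot> (\<i>\<d> B \<otimes>\<^sub>m \<delta>\<^sub>r)"
    and "\<xi> 1 3 = \<c> B A"
    and "\<xi> 2 3 = (lam \<otimes>\<^sub>m \<i>\<d> C) \<cdot> (\<i>\<d> H \<otimes>\<^sub>m \<c> C A) \<cdot> (\<delta>\<^sub>l \<otimes>\<^sub>m \<i>\<d> A)"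
    and "\<mu> = (\<mu>\<^sub>A \<otimes>\<^sub>m \<mu>\<^sub>C \<otimes>\<^sub>m \<mu>\<^sub>B)
               \<cdot> at_pos \<C> [A, A, C, B, C, B] 4 (\<xi> 1 2)
               \<cdot> at_pos \<C> [A, C, A, B, C, B] 2 (\<xi> 2 3)
               \<cdot> at_pos \<C> [A, C, B, A, C, B] 3 (\<xi> 1 3)"
    and "\<nu> = \<nu>\<^sub>A \<otimes>\<^sub>m \<nu>\<^sub>C \<otimes>\<^sub>m \<nu>\<^sub>B"
  shows "braided_system_of_algebras \<C> 3 V mult unit \<xi>
    \<and> unital_algebra \<C> (A \<otimes>\<^sub>o C \<otimes>\<^sub>o B) \<mu> \<nu>
    \<and> equivalent_categories
        (Mod_system \<C> 3 V (completed \<C> mult unit \<xi>) unit)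
        (Mod_algebra \<C> (A \<otimes>\<^sub>o C \<otimes>\<^sub>o B) \<mu> \<nu>)"
proof -
  interpret bicomodule_action \<C> H \<mu>\<^sub>H \<nu>\<^sub>H \<Delta> \<epsilon> A \<mu>\<^sub>A \<nu>\<^sub>A lam B \<mu>\<^sub>B \<nu>\<^sub>B \<rho> C \<mu>\<^sub>C \<nu>\<^sub>C \<delta>\<^sub>l \<delta>\<^sub>r
    using assms(3-5) by (rule bicomodule_action.intro)
  have "braided_triple \<C> B \<mu>\<^sub>B \<nu>\<^sub>B C \<mu>\<^sub>C \<nu>\<^sub>C A \<mu>\<^sub>A \<nu>\<^sub>A \<xi>\<^sub>B\<^sub>C (\<c> B A) \<xi>\<^sub>C\<^sub>A"
    by (intro braided_triple.intro braided_triple_axioms.intro strict_monoidal_category_axioms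
        law_BC law_BA law_CA yang_baxter_BCA)
  then interpret braided_triple_family \<C> B \<mu>\<^sub>B \<nu>\<^sub>B C \<mu>\<^sub>C \<nu>\<^sub>C A \<mu>\<^sub>A \<nu>\<^sub>A \<xi>\<^sub>B\<^sub>C "\<c> B A" \<xi>\<^sub>C\<^sub>A V mult unit \<xi>
    using assms by (intro braided_triple_family.intro braided_triple_family_axioms.intro)
      (simp_all only: \<xi>\<^sub>B\<^sub>C_def \<xi>\<^sub>C\<^sub>A_def)
  have mult_eq: "\<mu> = outer.twisted_mult"
    unfolding outer_mult_eq by (simp only: assms(15-18) \<xi>\<^sub>B\<^sub>C_def \<xi>\<^sub>C\<^sub>A_def)
  have unit_eq: "\<nu> = outer.twisted_unit"
    unfolding outer_unit_eq by (rule assms(19))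
  have "unital_algebra \<C> (A \<otimes>\<^sub>o C \<otimes>\<^sub>o B) \<mu> \<nu>"
    using outer.twisted_algebra unfolding mult_eq unit_eq by simp
  then show ?thesis
    using braided_system_of_triple modules_equivalent unfolding mult_eq unit_eq by blast
qed

end
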